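(* Let $n\ge 1$ be an integer, let $p,r\in(0,1)$ and $\lambda>0$ satisfy $\frac1p+\frac1r-\frac{\lambda}{n}=2$, and put $q=\frac{r}{r-1}\in(-\infty,0)$. Let $$\mathscr{C}_{n,p,r}=\inf\left\{\|I_\lambda f\|_{L^q(\mathbf{R}^n)}\ :\ f\ge 0,\ \|f\|_{L^p(\mathbf{R}^n)}=1\right\}.$$ Then there exists a non-negative function $f\in L^p(\mathbf{R}^n)$ such that $\|f\|_{L^p(\mathbf{R}^n)}=1$ and $\|I_\lambda f\|_{L^q(\mathbf{R}^n)}=\mathscr{C}_{n,p,r}$. Moreover, if $f$ is any minimizer (that is, $f\ge 0$, $\|f\|_{L^p(\mathbf{R}^n)}=1$ and $\|I_\lambda f\|_{L^q(\mathbf{R}^n)}=\mathscr{C}_{n,p,r}$), then there exist a non-negative, strictly decreasing function $h$ on $[0,\infty)$ and a point $x_0\in\mathbf{R}^n$ such that $f(x)=h(|x+x_0|)$ for a.e. $x\in\mathbf{R}^n$.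
   Context: For a non-negative measurable function $f$ on $\mathbf{R}^n$, $(I_\lambda f)(x)=\int_{\mathbf{R}^n} f(y)\,|x-y|^{\lambda}\,dy\in[0,+\infty]$. For any nonzero real exponent $s<1$ (in particular $s=p\in(0,1)$ or $s=q<0$) and a non-negative measurable function $g$, $\|g\|_{L^s(\mathbf{R}^n)}=\left(\int_{\mathbf{R}^n} g^s\,dx\right)^{1/s}$; for negative $s$ one uses the conventions $(+\infty)^s=0$, $0^{s}=+\infty$, and the same for the outer power $1/s$. *)

theory Defs
  imports "HOL-Analysis.Analysis"
begin

(* Real powers of extended non-negative reals with the conventions
   top^s = 0 and 0^s = top for s < 0.  The exponent s = 0 is never used
   (the branch below makes x^0 = 1 for every x). *)
definition ennpowr :: "ennreal \<Rightarrow> real \<Rightarrow> ennreal" (infixr "ennpowr" 80) where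
  "x ennpowr s =
     (if s = 0 then 1
      else if x = top then (if s > 0 then top else 0)
      else if x = 0 then (if s > 0 then 0 else top)
      else ennreal (enn2real x powr s))"

(* The L^s "norm" on R^n, n = CARD('n), meant for measurable g and s \<noteq> 0, s < 1. *)
definition Ls_norm :: "real \<Rightarrow> (real ^ 'n \<Rightarrow> ennreal) \<Rightarrow> ennreal" where
  "Ls_norm s g = (\<integral>\<^sup>+ x. g x ennpowr s \<partial>lebesgue) ennpowr (1 / s)"

definition I_op :: "real \<Rightarrow> (real ^ 'n \<Rightarrow> real) \<Rightarrow> real ^ 'n \<Rightarrow> ennreal" where
  "I_op lam f x = (\<integral>\<^sup>+ y. ennreal (f y * norm (x - y) powr lam) \<partial>lebesgue)"

definition admissible :: "real \<Rightarrow> (real ^ 'n \<Rightarrow> real) set" where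
  "admissible p =
     {f. f \<in> borel_measurable lebesgue \<and> (\<forall>x. 0 \<le> f x) \<and> Ls_norm p (\<lambda>x. ennreal (f x)) = 1}"

(* The dimension n is passed as a type argument. *)
definition inf_const :: "'n::finite itself \<Rightarrow> real \<Rightarrow> real \<Rightarrow> real \<Rightarrow> ennreal" where
  "inf_const _ lam p q = (INF f \<in> (admissible p :: (real ^ 'n \<Rightarrow> real) set). Ls_norm q (I_op lam f))"

end

theory Submission
  imports Defs "HOL-Complex_Analysis.Great_Picard"
begin

text \<open>
The proof works with \<open>a = p / (1 - p)\<close> and \<open>b = r / (1 - r) = - q\<close>, for which the relation between the exponents reads
\<open>lam = n / a + n / b\<close>. As \<open>q < 0\<close>, minimizing the norm of the potential \<open>F = I f\<close> means maximizing the energy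
\<open>\<integral> F\<^sup>q\<close> among densities with \<open>\<integral> f\<^sup>p = 1\<close>.

Existence. Since the kernel grows at infinity, parts of a density that drift apart or live on different scales
interact strongly, which makes their potentials large and the energy small; so maximizing sequences are compact up to
the symmetries. Quantitatively, the triangle inequality bounds \<open>|x - z|\<^sup>\<lambda> \<integral> f\<close> by \<open>F x + F z\<close>, up to a constant
(\<open>pot_add_ge\<close>). Translate and dilate so that \<open>F\<close> has its minimum, with value 1, at the origin (\<open>normalize\<close>). Then
\<open>F\<close> lies between two constant multiples of \<open>1 + |x|\<^sup>\<lambda>\<close>, the lower one depending on the exponents only
(\<open>normalized_pot_lower_bound\<close>) and the upper one on a lower bound for the energy (\<open>normalized_mass_upper_bound\<close>).
Potentials of such densities are equicontinuous, so along a subsequence the \<open>F\<close> converge pointwise. The densities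
need not converge, but the dual densities \<open>g = F powr (-b - 1)\<close> do, with domination, and replacing a density by the best
response to its dual density does not lower the energy (\<open>dual_step\<close>, \<open>improve\<close>). The best response to the limit of the
\<open>g\<close> is a maximizer (\<open>energy_maximum_attained\<close>).

Symmetry. For a maximizer the best response changes nothing, so \<open>f\<close> is a multiple of \<open>(I g) powr (-a - 1)\<close>
(\<open>maximizer_Euler_Lagrange\<close>); in particular \<open>f\<close> has a continuous representative that tends to 0 at infinity. The pair
\<open>f, g\<close> minimizes the bilinear form \<open>\<integral>\<integral> f x * g y * |x - y|\<^sup>\<lambda>\<close> under its constraints. Polarization in a hyperplane
preserves the constraints and decreases the form, so equality holds. It follows that in each half space either \<open>f\<close> agrees
with its reflection, or \<open>f\<close> is strictly larger throughout, or strictly smaller throughout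
(\<open>reflection_trichotomy\<close>). Comparing two points through their bisecting hyperplane, with the maximum point of \<open>f\<close> as
centre, this says that \<open>f\<close> is radially decreasing; and strictly so, for symmetry in a hyperplane that misses the
centre would contradict the decay (\<open>radially_decreasing\<close>).
\<close>

section \<open>The weight\<close>

definition weight :: "real \<Rightarrow> 'a::euclidean_space \<Rightarrow> real" where
  "weight lam x = 1 + norm x powr lam"

lemma weight_ge_1: "1 \<le> weight lam x"
  by (simp add: weight_def)

lemma weight_pos: "0 < weight lam x"
  using weight_ge_1[of lam x] by linarith

lemma measurable_weight [measurable]: "weight lam \<in> borel_measurable borel"
  unfolding weight_def[abs_def] by measurable

text \<open>On the dyadic shell \<open>2 ^ k \<le> norm x < 2 ^ (k + 1)\<close> the function is at most \<open>2 powr (- lam * s * k)\<close>, while the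
shell has volume of order \<open>2 ^ (DIM('a) * k)\<close>, so the integral is dominated by a convergent geometric series.\<close>

lemma integrable_weight_powr:
  fixes lam s :: real
  assumes lam: "0 < lam" and s: "real DIM('a) < lam * s"
  shows "integrable lborel (\<lambda>x::'a::euclidean_space. weight lam x powr (-s))"
proof -
  define n where "n = DIM('a)"
  define \<tau> where "\<tau> = 2 powr (-(lam * s))"
  define V where "V = measure lborel (ball (0::'a) 1)"
  have \<tau>: "0 < \<tau>" by (simp add: \<tau>_def)
  have spos: "0 < s" using lam s
    by (metis less_le_trans linorder_not_less mult_nonneg_nonpos of_nat_0_le_iff order_le_less)
  have shell: "ennreal (weight lam x powr (-s))
      \<le> (\<Sum>k. ennreal (\<tau> ^ k) * indicator (ball (0::'a) (2 ^ Suc k)) x)" for x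
  proof -
    have ex: "\<exists>k. norm x < 2 ^ Suc k"
      by (metis power_Suc real_arch_pow one_less_numeral_iff semiring_norm(76) less_trans
          power_strict_increasing lessI)
    (* The term of this index alone bounds the function at x; the shell of index 0 is the whole ball
       of radius 2, where the bound 1 suffices. *)
    define k where "k = (LEAST k. norm x < 2 ^ Suc k)"
    have k: "norm x < 2 ^ Suc k" unfolding k_def by (rule LeastI_ex[OF ex])
    have le: "weight lam x powr (-s) \<le> \<tau> ^ k"
    proof (cases k)
      case 0
      have "weight lam x powr (-s) \<le> 1"
        using weight_ge_1[of lam x] spos powr_mono[of "-s" 0 "weight lam x"] by simp
      then show ?thesis using 0 by simp
    next
      case (Suc j)
      have "\<not> norm x < 2 ^ Suc j"
        using not_less_Least[of j "\<lambda>k. norm x < 2 ^ Suc k"] Suc k_def by auto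
      then have low: "2 ^ k \<le> norm x" using Suc by simp
      have "(2 ^ k) powr lam \<le> norm x powr lam"
        by (intro powr_mono2) (use lam low in auto)
      then have "(2 ^ k) powr lam \<le> weight lam x" by (simp add: weight_def)
      then have "weight lam x powr (-s) \<le> ((2 ^ k) powr lam) powr (-s)"
        using spos by (intro powr_mono2') auto
      also have "\<dots> = \<tau> ^ k"
        by (simp add: \<tau>_def powr_powr powr_realpow[symmetric] mult_ac)
      finally show ?thesis .
    qed
    have "ennreal (weight lam x powr (-s)) \<le> ennreal (\<tau> ^ k)"
      using le by (rule ennreal_leI)
    also have "\<dots> = ennreal (\<tau> ^ k) * indicator (ball (0::'a) (2 ^ Suc k)) x"
      using k by (simp add: indicator_def)
    also have "\<dots> \<le> (\<Sum>k. ennreal (\<tau> ^ k) * indicator (ball (0::'a) (2 ^ Suc k)) x)"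
    proof -
      have "h k \<le> suminf h" for h :: "nat \<Rightarrow> ennreal"
        using sum_le_suminf[of h "{k}"] by (simp add: summableI)
      then show ?thesis .
    qed
    finally show ?thesis .
  qed
  have ball: "emeasure lborel (ball (0::'a) (2 ^ Suc k)) = ennreal (unit_ball_vol (real n) * 2 ^ n * (2 ^ n) ^ k)" for k
    by (subst emeasure_ball) (auto simp: n_def power_mult[symmetric] power_add[symmetric] mult_ac)
  have ratio: "\<tau> * 2 ^ n < 1"
  proof -
    have "\<tau> * 2 ^ n = 2 powr (real n - lam * s)"
      by (simp add: \<tau>_def powr_realpow[symmetric] powr_add[symmetric])
    also have "\<dots> < 2 powr 0" by (rule powr_less_mono) (use s in \<open>auto simp: n_def\<close>)
    finally show ?thesis by simp
  qed
  have "(\<integral>\<^sup>+x. ennreal (weight lam (x::'a) powr (-s)) \<partial>lborel)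
      \<le> (\<integral>\<^sup>+x. (\<Sum>k. ennreal (\<tau> ^ k) * indicator (ball (0::'a) (2 ^ Suc k)) x) \<partial>lborel)"
    by (intro nn_integral_mono shell)
  also have "\<dots> = (\<Sum>k. ennreal (\<tau> ^ k) * emeasure lborel (ball (0::'a) (2 ^ Suc k)))"
    
  proof (subst nn_integral_suminf)
    show "(\<lambda>x. ennreal (\<tau> ^ i) * indicator (ball (0::'a) (2 ^ Suc i)) x) \<in> borel_measurable lborel" for i
      by (intro borel_measurable_times_ennreal borel_measurable_const borel_measurable_indicator) simp
  qed (intro suminf_cong nn_integral_cmult_indicator, simp)
  also have "\<dots> = (\<Sum>k. ennreal (unit_ball_vol (real n) * 2 ^ n * (\<tau> * 2 ^ n) ^ k))"
    unfolding ball using \<tau> by (simp add: ennreal_mult'[symmetric] power_mult_distrib mult_ac del: power_Suc)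
  also have "\<dots> < \<infinity>"
  proof -
    have "summable (\<lambda>k. unit_ball_vol (real n) * 2 ^ n * (\<tau> * 2 ^ n) ^ k)"
      using ratio \<tau> by (intro summable_mult summable_geometric) simp
    then show ?thesis using \<tau>
      by (subst suminf_ennreal2) (auto intro!: mult_nonneg_nonneg)
  qed
  finally show ?thesis
    by (intro integrableI_nonneg) (auto simp del: ennreal_suminf_cmult)
qed

text \<open>A positive constant added to the growing term makes the integral as small as desired. Both a priori bounds below
absorb their error terms with this choice of \<open>M\<close>.\<close>

lemma small_tail_integral:
  fixes lam s \<delta> \<epsilon> :: real
  assumes lam: "0 < lam" and s: "real DIM('a) < lam * s" and d: "0 < \<delta>" and e: "0 < \<epsilon>"
  obtains M where "0 < M" "integrable lborel (\<lambda>x::'a::euclidean_space. (M + \<delta> * norm x powr lam) powr (-s))"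
    "(\<integral>(x::'a). (M + \<delta> * norm x powr lam) powr (-s) \<partial>lborel) \<le> \<epsilon>"
proof -
  (* The exponent s' is still integrable, and the surplus s - s' turns into a negative power of M. *)
  define s' where "s' = (real DIM('a) / lam + s) / 2"
  have s': "real DIM('a) < lam * s'" "s' < s" "0 < s'"
  proof -
    have "real DIM('a) / lam < s" using s lam by (simp add: field_simps)
    then show "s' < s" "real DIM('a) < lam * s'" using lam by (auto simp: s'_def field_simps)
    then show "0 < s'" using lam by (metis less_le_trans linorder_not_less mult_nonneg_nonpos of_nat_0_le_iff order_le_less)
  qed
  define J where "J = \<delta> powr (-s') * (\<integral>(x::'a). weight lam x powr (-s') \<partial>lborel)"
  have J0: "0 \<le> J" unfolding J_def by (intro mult_nonneg_nonneg integral_nonneg_AE) auto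
  have "((\<lambda>M. M powr (-(s - s')) * J) \<longlongrightarrow> 0 * J) at_top"
    by (intro tendsto_intros tendsto_neg_powr filterlim_ident) (use s' in auto)
  then have "\<forall>\<^sub>F M in at_top. M powr (-(s - s')) * J < \<epsilon>"
    using e by (simp add: order_tendstoD(2))
  then have "\<forall>\<^sub>F M in at_top. M powr (-(s - s')) * J < \<epsilon> \<and> \<delta> \<le> M"
    using eventually_ge_at_top[of \<delta>] by (rule eventually_conj)
  then obtain M where M: "M powr (-(s - s')) * J < \<epsilon>" "\<delta> \<le> M"
    by (auto simp: eventually_at_top_linorder)
  have M0: "0 < M" using M(2) d by linarith
  have bound: "(M + \<delta> * norm x powr lam) powr (-s)
      \<le> M powr (-(s - s')) * \<delta> powr (-s') * weight lam x powr (-s')" for x :: 'a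
  proof -
    let ?m = "M + \<delta> * norm x powr lam"
    have m: "M \<le> ?m" "\<delta> * weight lam x \<le> ?m" using d M by (auto simp: weight_def algebra_simps)
    have "?m powr (-s) = ?m powr (-(s - s')) * ?m powr (-s')"
      by (simp add: powr_add[symmetric])
    also have "\<dots> \<le> M powr (-(s - s')) * (\<delta> * weight lam x) powr (-s')"
      by (intro mult_mono powr_mono2') (use m M0 s' d in \<open>auto simp: weight_pos\<close>)
    finally show ?thesis using d by (simp add: powr_mult less_imp_le[OF weight_pos] mult_ac)
  qed
  have int': "integrable lborel (\<lambda>x::'a. M powr (-(s - s')) * \<delta> powr (-s') * weight lam x powr (-s'))"
    by (intro integrable_mult_right integrable_weight_powr lam s')
  have int: "integrable lborel (\<lambda>x::'a. (M + \<delta> * norm x powr lam) powr (-s))"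
    by (rule Bochner_Integration.integrable_bound[OF int']) (use bound in \<open>auto\<close>)
  have "(\<integral>(x::'a). (M + \<delta> * norm x powr lam) powr (-s) \<partial>lborel)
      \<le> (\<integral>(x::'a). M powr (-(s - s')) * \<delta> powr (-s') * weight lam x powr (-s') \<partial>lborel)"
    by (intro integral_mono int int' bound)
  also have "\<dots> = M powr (-(s - s')) * J" by (simp add: J_def mult_ac)
  finally have "(\<integral>(x::'a). (M + \<delta> * norm x powr lam) powr (-s) \<partial>lborel) \<le> \<epsilon>" using M by linarith
  with M0 int show ?thesis by (rule that)
qed

lemma norm_powr_quasi_triangle:
  fixes u v :: "'a::real_normed_vector"
  assumes "0 < lam"
  shows "norm (u + v) powr lam \<le> 2 powr lam * (norm u powr lam + norm v powr lam)"
proof -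
  let ?m = "max (norm u) (norm v)"
  have "norm (u + v) \<le> 2 * ?m" using norm_triangle_ineq[of u v] by linarith
  then have "norm (u + v) powr lam \<le> (2 * ?m) powr lam" using assms by (intro powr_mono2) auto
  also have "\<dots> = 2 powr lam * ?m powr lam" by (simp add: powr_mult)
  also have "?m powr lam \<le> norm u powr lam + norm v powr lam" by (simp add: max_def)
  finally show ?thesis by (simp add: mult_left_mono)
qed

text \<open>This is why the weight is the right one: a density that is integrable against it has a finite potential everywhere,
and the potential in turn grows at most like the weight.\<close>

lemma kernel_le_weight:
  fixes x y :: "'a::euclidean_space"
  assumes "0 < lam"
  shows "norm (x - y) powr lam \<le> 2 powr lam * weight lam x * weight lam y"
proof -
  have "norm (x - y) powr lam \<le> 2 powr lam * (norm x powr lam + norm y powr lam)"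
    using norm_powr_quasi_triangle[OF assms, of x "-y"] by simp
  also have "\<dots> \<le> 2 powr lam * (weight lam x * weight lam y)"
    by (intro mult_left_mono) (auto simp: weight_def algebra_simps)
  finally show ?thesis by (simp add: mult_ac)
qed

text \<open>Either \<open>d\<close> is small compared with \<open>u\<close>, and enters as a factor, or it is not, and \<open>d\<close> itself dominates. This avoids
separate treatments of \<open>lam \<le> 1\<close> and \<open>lam > 1\<close> when the kernel is compared at two points.\<close>

lemma powr_perturb:
  fixes lam \<theta> u d v :: real
  assumes "0 < lam" "0 < \<theta>" "0 \<le> u" "0 \<le> d" "0 \<le> v" "v \<le> u + d"
  shows "v powr lam \<le> (1 + \<theta>) powr lam * u powr lam + (1 + 1 / \<theta>) powr lam * d powr lam"
proof (cases "d \<le> \<theta> * u")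
  case True
  have "v powr lam \<le> ((1 + \<theta>) * u) powr lam"
    using assms True by (intro powr_mono2) (auto simp: algebra_simps)
  also have "\<dots> = (1 + \<theta>) powr lam * u powr lam" using assms by (simp add: powr_mult)
  finally show ?thesis by (simp add: add_increasing2)
next
  case False
  then have "u \<le> d / \<theta>" using assms by (simp add: field_simps)
  then have "v powr lam \<le> ((1 + 1 / \<theta>) * d) powr lam"
    using assms by (intro powr_mono2) (auto simp: algebra_simps)
  also have "\<dots> = (1 + 1 / \<theta>) powr lam * d powr lam" using assms by (simp add: powr_mult)
  finally show ?thesis by (simp add: add_increasing)
qed

text \<open>For \<open>lam > 1\<close> the kernel is not uniformly continuous, but relative to the weight of \<open>y\<close> it is continuous in \<open>x\<close>
uniformly in \<open>y\<close>. Hence potentials of densities of bounded weighted mass are equicontinuous.\<close>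

lemma kernel_equicontinuous:
  fixes x :: "'a::euclidean_space"
  assumes lam: "0 < lam" and e: "0 < \<epsilon>"
  obtains \<delta> where "0 < \<delta>"
    "\<And>x' y. norm (x' - x) < \<delta> \<Longrightarrow> \<bar>norm (x' - y) powr lam - norm (x - y) powr lam\<bar> \<le> \<epsilon> * weight lam y"
proof -
  define K where "K = 2 powr lam * (1 + (norm x + 1) powr lam)"
  have K: "0 < K" by (simp add: K_def add_pos_nonneg)
  have "((\<lambda>\<theta>. (1 + \<theta>) powr lam) \<longlongrightarrow> (1 + 0) powr lam) (at_right (0::real))"
    by (intro tendsto_intros) auto
  then have "\<forall>\<^sub>F \<theta> in at_right (0::real). (1 + \<theta>) powr lam < 1 + \<epsilon> / (2 * K)"
    using e K by (intro order_tendstoD(2)[where y=1]) auto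
  then obtain \<theta> :: real where th: "0 < \<theta>" "(1 + \<theta>) powr lam < 1 + \<epsilon> / (2 * K)"
    by (auto simp: eventually_at_right_field) (metis dense)
  have "((\<lambda>d. (1 + 1 / \<theta>) powr lam * d powr lam) \<longlongrightarrow> (1 + 1 / \<theta>) powr lam * 0 powr lam) (at_right (0::real))"
    by (intro tendsto_intros) (use lam th in \<open>auto simp: eventually_at_filter\<close>)
  then have "\<forall>\<^sub>F d in at_right (0::real). (1 + 1 / \<theta>) powr lam * d powr lam < \<epsilon> / 2"
    using e by (intro order_tendstoD(2)) auto
  then obtain b where b: "0 < b" "\<And>d. 0 < d \<Longrightarrow> d < b \<Longrightarrow> (1 + 1 / \<theta>) powr lam * d powr lam < \<epsilon> / 2"
    by (auto simp: eventually_at_right_field)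
  define \<delta> where "\<delta> = min 1 (b / 2)"
  have d: "0 < \<delta>" "\<delta> \<le> 1" "(1 + 1 / \<theta>) powr lam * \<delta> powr lam < \<epsilon> / 2"
    using b by (auto simp: \<delta>_def)
  have one: "norm (z - y) powr lam - norm (z' - y) powr lam \<le> \<epsilon> * weight lam y"
    if z: "norm (z - z') \<le> \<delta>" "norm z' \<le> norm x + 1" for z z' y :: 'a
  proof -
    let ?u = "norm (z' - y) powr lam"
    have "norm (z - y) \<le> norm (z' - y) + \<delta>"
      using z norm_triangle_ineq[of "z - z'" "z' - y"] by simp
    then have "norm (z - y) powr lam \<le> (1 + \<theta>) powr lam * ?u + (1 + 1 / \<theta>) powr lam * \<delta> powr lam"
      by (intro powr_perturb) (use lam th d in auto)
    then have "norm (z - y) powr lam - ?u \<le> ((1 + \<theta>) powr lam - 1) * ?u + \<epsilon> / 2"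
      using d by (simp add: algebra_simps)
    also have "((1 + \<theta>) powr lam - 1) * ?u \<le> \<epsilon> / (2 * K) * (K * weight lam y)"
    proof (rule mult_mono)
      have "?u \<le> 2 powr lam * weight lam z' * weight lam y" by (rule kernel_le_weight[OF lam])
      also have "\<dots> \<le> K * weight lam y"
        unfolding K_def using z lam less_imp_le[OF weight_pos, of lam y]
        by (intro mult_right_mono mult_left_mono) (auto simp: weight_def[of lam z'] intro: powr_mono2)
      finally show "?u \<le> K * weight lam y" .
    qed (use th e K in auto)
    also have "\<dots> + \<epsilon> / 2 \<le> \<epsilon> * weight lam y"
      using K e weight_ge_1[of lam y] by (simp add: field_simps)
    finally show ?thesis by simp
  qed
  show ?thesis
  proof (rule that[OF d(1)])
    fix x' y :: 'a assume x': "norm (x' - x) < \<delta>"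
    have "norm x' \<le> norm x + 1" using x' d norm_triangle_ineq2[of x' x] by linarith
    then show "\<bar>norm (x' - y) powr lam - norm (x - y) powr lam\<bar> \<le> \<epsilon> * weight lam y"
      using one[of x' x y] one[of x x' y] x' by (auto simp: norm_minus_commute abs_le_iff)
  qed
qed

section \<open>Potentials\<close>

definition pot :: "real \<Rightarrow> ('a::euclidean_space \<Rightarrow> real) \<Rightarrow> 'a \<Rightarrow> real" where
  "pot lam f x = (\<integral>y. f y * norm (x - y) powr lam \<partial>lborel)"

text \<open>The densities whose potential is finite everywhere; finiteness at two distinct points already suffices, see
\<open>weighted_if_finite_at_two_points\<close>.\<close>

definition weighted :: "real \<Rightarrow> ('a::euclidean_space \<Rightarrow> real) \<Rightarrow> bool" where
  "weighted lam f \<longleftrightarrow> f \<in> borel_measurable borel \<and> (\<forall>x. 0 \<le> f x)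
     \<and> integrable lborel (\<lambda>x. f x * weight lam x)"

lemma weighted_measurable: "weighted lam f \<Longrightarrow> f \<in> borel_measurable borel"
  and weighted_nonneg: "weighted lam f \<Longrightarrow> 0 \<le> f x"
  and weighted_integrable_weight: "weighted lam f \<Longrightarrow> integrable lborel (\<lambda>x. f x * weight lam x)"
  by (simp_all add: weighted_def)

lemma weighted_bound:
  assumes f: "f \<in> borel_measurable borel" "\<And>x. 0 \<le> f x" and g: "weighted lam g"
    and le: "\<And>x. f x \<le> g x"
  shows "weighted lam f"
  unfolding weighted_def
proof (intro conjI allI)
  note [measurable] = f(1)
  show "integrable lborel (\<lambda>x. f x * weight lam x)"
    by (rule Bochner_Integration.integrable_bound[OF weighted_integrable_weight[OF g]])
      (use f le weighted_nonneg[OF g] in \<open>auto simp: abs_mult less_imp_le[OF weight_pos] intro!: mult_right_mono AE_I2\<close>)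
qed (use f in auto)

abbreviation lborel2 :: "('a::euclidean_space \<times> 'a) measure" where
  "lborel2 \<equiv> lborel \<Otimes>\<^sub>M lborel"

lemma measurable_prod_norm [measurable]:
  "(\<lambda>z::'a::euclidean_space \<times> 'a. norm (fst z - snd z)) \<in> borel_measurable lborel2"
proof -
  have "(\<lambda>z::'a\<times>'a. norm (fst z - snd z)) \<in> borel_measurable borel"
    by (intro borel_measurable_continuous_onI continuous_intros)
  then show ?thesis by (simp add: lborel_prod)
qed

context
  fixes lam :: real
  assumes lam: "0 < lam"
begin

lemma weighted_integrable:
  assumes "weighted lam f"
  shows "integrable lborel f"
proof (rule Bochner_Integration.integrable_bound[OF weighted_integrable_weight[OF assms]])
  show "AE x in lborel. norm (f x) \<le> norm (f x * weight lam x)"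
    using weight_ge_1[of lam] by (intro AE_I2) (auto simp: abs_mult mult_le_cancel_left1 abs_of_pos[OF weight_pos])
qed (use weighted_measurable[OF assms] in simp)

lemma weighted_integrable_kernel:
  assumes f: "weighted lam f"
  shows "integrable lborel (\<lambda>y. f y * norm (x - y) powr lam)"
proof (rule Bochner_Integration.integrable_bound)
  show "integrable lborel (\<lambda>y. 2 powr lam * weight lam x * (f y * weight lam y))"
    by (intro integrable_mult_right weighted_integrable_weight f)
  note [measurable] = weighted_measurable[OF f]
  show "(\<lambda>y. f y * norm (x - y) powr lam) \<in> borel_measurable lborel" by measurable
  show "AE y in lborel. norm (f y * norm (x - y) powr lam)
      \<le> norm (2 powr lam * weight lam x * (f y * weight lam y))"
  proof (intro AE_I2)
    fix y
    have "f y * norm (x - y) powr lam \<le> f y * (2 powr lam * weight lam x * weight lam y)"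
      by (intro mult_left_mono kernel_le_weight lam weighted_nonneg[OF f])
    then show "norm (f y * norm (x - y) powr lam) \<le> norm (2 powr lam * weight lam x * (f y * weight lam y))"
      using weighted_nonneg[OF f, of y] weight_pos[of lam x] weight_pos[of lam y]
      by (simp add: abs_mult mult_ac)
  qed
qed

lemma pot_nonneg: "weighted lam f \<Longrightarrow> 0 \<le> pot lam f x"
  unfolding pot_def by (intro integral_nonneg_AE AE_I2) (simp add: weighted_nonneg)

lemma nn_integral_kernel_eq_pot:
  assumes "weighted lam f"
  shows "(\<integral>\<^sup>+y. ennreal (f y * norm (x - y) powr lam) \<partial>lborel) = ennreal (pot lam f x)"
  unfolding pot_def
  by (intro nn_integral_eq_integral weighted_integrable_kernel AE_I2 assms mult_nonneg_nonneg weighted_nonneg[OF assms]) auto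

lemma pot_le_weight:
  assumes f: "weighted lam f"
  shows "pot lam f x \<le> 2 powr lam * (\<integral>y. f y * weight lam y \<partial>lborel) * weight lam x"
proof -
  have "pot lam f x \<le> (\<integral>y. 2 powr lam * weight lam x * (f y * weight lam y) \<partial>lborel)"
    unfolding pot_def
  proof (intro integral_mono weighted_integrable_kernel integrable_mult_right weighted_integrable_weight f)
    fix y
    have "f y * norm (x - y) powr lam \<le> f y * (2 powr lam * weight lam x * weight lam y)"
      by (intro mult_left_mono kernel_le_weight lam weighted_nonneg[OF f])
    then show "f y * norm (x - y) powr lam \<le> 2 powr lam * weight lam x * (f y * weight lam y)"
      by (simp add: mult_ac)
  qed
  also have "\<dots> = 2 powr lam * (\<integral>y. f y * weight lam y \<partial>lborel) * weight lam x" by simp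
  finally show ?thesis .
qed

lemma pot_equicontinuous:
  fixes x :: "'a::euclidean_space"
  assumes e: "0 < \<epsilon>"
  obtains \<delta> where "0 < \<delta>"
    "\<And>f x'. weighted lam f \<Longrightarrow> norm (x' - x) < \<delta> \<Longrightarrow>
       \<bar>pot lam f x' - pot lam f x\<bar> \<le> \<epsilon> * (\<integral>y. f y * weight lam y \<partial>lborel)"
proof -
  obtain \<delta> where d: "0 < \<delta>"
    "\<And>x' y. norm (x' - x) < \<delta> \<Longrightarrow> \<bar>norm (x' - y) powr lam - norm (x - y) powr lam\<bar> \<le> \<epsilon> * weight lam y"
    using kernel_equicontinuous[OF lam e, of x] by blast
  show ?thesis
  proof (rule that[OF d(1)])
    fix f :: "'a \<Rightarrow> real" and x' assume f: "weighted lam f" and x': "norm (x' - x) < \<delta>"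
    note int = weighted_integrable_kernel[OF f]
    have "\<bar>pot lam f x' - pot lam f x\<bar>
        = \<bar>\<integral>y. f y * norm (x' - y) powr lam - f y * norm (x - y) powr lam \<partial>lborel\<bar>"
      unfolding pot_def by (subst Bochner_Integration.integral_diff) (auto intro: int)
    also have "\<dots> \<le> (\<integral>y. \<bar>f y * norm (x' - y) powr lam - f y * norm (x - y) powr lam\<bar> \<partial>lborel)"
      by (rule integral_abs_bound)
    also have "\<dots> \<le> (\<integral>y. \<epsilon> * (f y * weight lam y) \<partial>lborel)"
    proof (intro integral_mono integrable_abs Bochner_Integration.integrable_diff int
        integrable_mult_right weighted_integrable_weight f)
      fix y
      have "f y * \<bar>norm (x' - y) powr lam - norm (x - y) powr lam\<bar> \<le> f y * (\<epsilon> * weight lam y)"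
        by (intro mult_left_mono d(2) x' weighted_nonneg[OF f])
      then show "\<bar>f y * norm (x' - y) powr lam - f y * norm (x - y) powr lam\<bar> \<le> \<epsilon> * (f y * weight lam y)"
        using weighted_nonneg[OF f, of y] by (simp add: abs_mult right_diff_distrib[symmetric] mult_ac)
    qed
    finally show "\<bar>pot lam f x' - pot lam f x\<bar> \<le> \<epsilon> * (\<integral>y. f y * weight lam y \<partial>lborel)" by simp
  qed
qed

lemma weighted_integral_nonneg:
  assumes "weighted lam f" shows "0 \<le> (\<integral>y. f y * weight lam y \<partial>lborel)"
  by (intro integral_nonneg_AE AE_I2 mult_nonneg_nonneg weighted_nonneg[OF assms] less_imp_le[OF weight_pos])

lemma isCont_pot:
  assumes f: "weighted lam f"
  shows "isCont (pot lam f) x"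
  unfolding continuous_at_eps_delta
proof (intro allI impI)
  fix e :: real assume e: "0 < e"
  define W where "W = (\<integral>y. f y * weight lam y \<partial>lborel)"
  have W: "0 \<le> W" unfolding W_def by (rule weighted_integral_nonneg[OF f])
  then have "0 < e / (W + 1)" using e by simp
  from pot_equicontinuous[OF this, of x] obtain \<delta> where \<delta>: "0 < \<delta>"
    "\<And>f x'. weighted lam f \<Longrightarrow> norm (x' - x) < \<delta> \<Longrightarrow>
       \<bar>pot lam f x' - pot lam f x\<bar> \<le> e / (W + 1) * (\<integral>y. f y * weight lam y \<partial>lborel)" by blast
  note d = \<delta>(1) \<delta>(2)[OF f, folded W_def]
  have "e / (W + 1) * W < e" using e W by (simp add: field_simps)
  moreover have "\<bar>pot lam f x' - pot lam f x\<bar> \<le> e / (W + 1) * W" if "dist x' x < \<delta>" for x'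
    using d(2) that by (simp add: dist_norm)
  ultimately show "\<exists>d>0. \<forall>x'. dist x' x < d \<longrightarrow> dist (pot lam f x') (pot lam f x) < e"
    using d(1) unfolding dist_real_def by (meson le_less_trans)
qed

lemma continuous_on_pot:
  assumes "weighted lam f" shows "continuous_on A (pot lam f)"
  by (intro continuous_at_imp_continuous_on ballI isCont_pot assms)

lemma measurable_pot:
  assumes "weighted lam f" shows "pot lam f \<in> borel_measurable borel"
  by (intro borel_measurable_continuous_onI continuous_on_pot assms)

text \<open>By the triangle inequality every \<open>y\<close> is far from \<open>x\<close> or far from \<open>z\<close>, so two values of a potential together
control the total mass of the density. All growth estimates for potentials are instances of this: read as a bound
on \<open>pot lam f x\<close> with \<open>z\<close> fixed it is a lower bound of order \<open>norm x powr lam\<close>, and read as a bound on the mass it is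
the compactness estimate.\<close>

lemma pot_add_ge:
  assumes f: "weighted lam f"
  shows "norm (x - z) powr lam * (\<integral>y. f y \<partial>lborel) \<le> 2 powr lam * (pot lam f x + pot lam f z)"
proof -
  have "norm (x - z) powr lam * (\<integral>y. f y \<partial>lborel) = (\<integral>y. norm (x - z) powr lam * f y \<partial>lborel)"
    by simp
  also have "\<dots> \<le> (\<integral>y. 2 powr lam * (f y * norm (x - y) powr lam + f y * norm (z - y) powr lam) \<partial>lborel)"
  proof (intro integral_mono integrable_mult_right Bochner_Integration.integrable_add
      weighted_integrable_kernel weighted_integrable f)
    fix y
    have "norm (x - z) powr lam \<le> 2 powr lam * (norm (x - y) powr lam + norm (z - y) powr lam)"
      using norm_powr_quasi_triangle[OF lam, of "x - y" "y - z"] by (simp add: norm_minus_commute)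
    from mult_left_mono[OF this weighted_nonneg[OF f, of y]]
    show "norm (x - z) powr lam * f y \<le> 2 powr lam * (f y * norm (x - y) powr lam + f y * norm (z - y) powr lam)"
      by (simp add: algebra_simps)
  qed
  also have "\<dots> = 2 powr lam * (pot lam f x + pot lam f z)"
    unfolding pot_def by (simp add: weighted_integrable_kernel[OF f])
  finally show ?thesis .
qed

text \<open>The kernel vanishes at \<open>y = x\<close>, so finiteness of the potential at \<open>x\<close> says little about the density near \<open>x\<close>;
a second point covers that neighbourhood.\<close>

lemma weighted_if_finite_at_two_points:
  fixes f :: "'a::euclidean_space \<Rightarrow> real"
  assumes [measurable]: "f \<in> borel_measurable borel" and f0: "\<And>x. 0 \<le> f x" and ne: "x \<noteq> z"
    and fin: "(\<integral>\<^sup>+y. ennreal (f y * norm (x - y) powr lam) \<partial>lborel) < \<infinity>"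
      "(\<integral>\<^sup>+y. ennreal (f y * norm (z - y) powr lam) \<partial>lborel) < \<infinity>"
  shows "weighted lam f"
proof -
  have int: "integrable lborel (\<lambda>y. f y * norm (x - y) powr lam)"
    "integrable lborel (\<lambda>y. f y * norm (z - y) powr lam)"
    using fin by (auto intro!: integrableI_nonneg simp: f0)
  define c where "c = 2 powr lam / norm (x - z) powr lam"
  have xz: "0 < norm (x - z) powr lam" using ne by simp
  define k where "k = 1 + 2 powr lam * norm x powr lam"
  have k: "0 \<le> k" by (simp add: k_def)
  show ?thesis
    unfolding weighted_def
  proof (intro conjI allI f0)
    show "integrable lborel (\<lambda>y. f y * weight lam y)"
    proof (rule Bochner_Integration.integrable_bound)
      show "integrable lborel (\<lambda>y. 2 powr lam * (f y * norm (x - y) powr lam)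
          + k * (c * (f y * norm (x - y) powr lam + f y * norm (z - y) powr lam)))"
        by (intro integrable_mult_right Bochner_Integration.integrable_add int)
      show "AE y in lborel. norm (f y * weight lam y) \<le> norm (2 powr lam * (f y * norm (x - y) powr lam)
          + k * (c * (f y * norm (x - y) powr lam + f y * norm (z - y) powr lam)))"
      proof (intro AE_I2)
        fix y
        have "norm (x - z) powr lam \<le> 2 powr lam * (norm (x - y) powr lam + norm (z - y) powr lam)"
          using norm_powr_quasi_triangle[OF lam, of "x - y" "y - z"] by (simp add: norm_minus_commute)
        then have 1: "1 \<le> c * (norm (x - y) powr lam + norm (z - y) powr lam)"
          using xz by (simp add: c_def field_simps)
        have "norm y powr lam \<le> 2 powr lam * (norm (x - y) powr lam + norm x powr lam)"
          using norm_powr_quasi_triangle[OF lam, of "y - x" x] by (simp add: norm_minus_commute)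
        then have "weight lam y \<le> 2 powr lam * norm (x - y) powr lam + k * 1"
          by (simp add: weight_def k_def algebra_simps)
        also have "\<dots> \<le> 2 powr lam * norm (x - y) powr lam + k * (c * (norm (x - y) powr lam + norm (z - y) powr lam))"
          by (intro add_mono mult_left_mono 1 k order_refl)
        finally have "f y * weight lam y \<le> f y * (2 powr lam * norm (x - y) powr lam + k * (c * (norm (x - y) powr lam + norm (z - y) powr lam)))"
          by (rule mult_left_mono) (rule f0)
        then show "norm (f y * weight lam y) \<le> norm (2 powr lam * (f y * norm (x - y) powr lam)
          + k * (c * (f y * norm (x - y) powr lam + f y * norm (z - y) powr lam)))"
          using f0[of y] weight_pos[of lam y] by (simp add: abs_mult algebra_simps)
      qed
    qed measurable
  qed measurable
qed

lemma pot_attains_inf: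
  fixes f :: "'a::euclidean_space \<Rightarrow> real"
  assumes f: "weighted lam f" and mass: "0 < (\<integral>y. f y \<partial>lborel)"
  obtains z where "0 < pot lam f z" "\<And>x. pot lam f z \<le> pot lam f x"
proof -
  define m where "m = (\<integral>y. f y \<partial>lborel)"
  have m: "0 < m" using mass by (simp add: m_def)
  (* Beyond this radius pot_add_ge forces the potential above its value at the origin. *)
  define R where "R = (2 powr lam * (2 * pot lam f 0) / m) powr (1 / lam)"
  have far: "pot lam f 0 \<le> pot lam f x" if "R < norm x" for x
  proof -
    have "2 powr lam * (2 * pot lam f 0) / m = R powr lam"
      using lam m pot_nonneg[OF f, of 0] by (simp add: R_def powr_powr)
    also have "\<dots> \<le> norm x powr lam" using that lam by (intro powr_mono2) (auto simp: R_def)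
    finally have "2 powr lam * (2 * pot lam f 0) \<le> norm x powr lam * m"
      using m by (simp add: field_simps)
    also have "\<dots> \<le> 2 powr lam * (pot lam f x + pot lam f 0)"
      using pot_add_ge[OF f, of x 0] by (simp add: m_def)
    finally show ?thesis by simp
  qed
  obtain z where z: "z \<in> cball 0 (max R 0)" "\<And>x. x \<in> cball 0 (max R 0) \<Longrightarrow> pot lam f z \<le> pot lam f x"
    using continuous_attains_inf[of "cball (0::'a) (max R 0)", OF _ _ continuous_on_pot[OF f]] by auto
  have min: "pot lam f z \<le> pot lam f x" for x
  proof (cases "norm x \<le> max R 0")
    case False
    then have "pot lam f 0 \<le> pot lam f x" by (intro far) linarith
    then show ?thesis using z(2)[of 0] by auto
  qed (use z in auto)
  have "0 < pot lam f z"
  proof (rule ccontr)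
    assume "\<not> 0 < pot lam f z"
    then have "pot lam f z = 0" using pot_nonneg[OF f, of z] by simp
    then have "AE y in lborel. f y * norm (z - y) powr lam = 0"
      unfolding pot_def
      by (subst (asm) integral_nonneg_eq_0_iff_AE)
        (auto intro!: weighted_integrable_kernel f AE_I2 mult_nonneg_nonneg weighted_nonneg[OF f])
    moreover have "AE y in lborel. y \<noteq> z"
      using AE_lborel_singleton[of z] by simp
    ultimately have "AE y in lborel. f y = 0" by eventually_elim auto
    then have "(\<integral>y. f y \<partial>lborel) = 0" by (rule integral_eq_zero_AE)
    then show False using mass by simp
  qed
  then show ?thesis using min by (rule that)
qed

lemma pot_ge_weight:
  assumes f: "weighted lam f" and mass: "0 < (\<integral>y. f y \<partial>lborel)"
  obtains c where "0 < c" "\<And>x. c * weight lam x \<le> pot lam f x"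
proof -
  obtain z where z: "0 < pot lam f z" "\<And>x. pot lam f z \<le> pot lam f x"
    using pot_attains_inf[OF f mass] by blast
  define m where "m = (\<integral>y. f y \<partial>lborel)"
  have m: "0 < m" using mass by (simp add: m_def)
  define k where "k = 2 powr lam * (2 powr lam * 2 / m) + (1 + 2 powr lam * norm z powr lam) / pot lam f z"
  have k: "0 < k" using m z by (simp add: k_def add_pos_nonneg)
  show ?thesis
  proof (rule that[of "1 / k"])
    fix x
    have "norm (x - z) powr lam * m \<le> 2 powr lam * (pot lam f x + pot lam f z)"
      using pot_add_ge[OF f, of x z] by (simp add: m_def)
    also have "\<dots> \<le> 2 powr lam * (2 * pot lam f x)" using z(2)[of x] by simp
    finally have "norm (x - z) powr lam \<le> 2 powr lam * 2 / m * pot lam f x" using m by (simp add: field_simps)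
    then have 1: "2 powr lam * norm (x - z) powr lam \<le> 2 powr lam * (2 powr lam * 2 / m * pot lam f x)"
      by (rule mult_left_mono) simp
    have "1 \<le> pot lam f x / pot lam f z" using z by simp
    then have 2: "(1 + 2 powr lam * norm z powr lam) * 1
        \<le> (1 + 2 powr lam * norm z powr lam) * (pot lam f x / pot lam f z)"
      by (rule mult_left_mono) (auto intro: add_nonneg_nonneg)
    have "norm x powr lam \<le> 2 powr lam * (norm (x - z) powr lam + norm z powr lam)"
      using norm_powr_quasi_triangle[OF lam, of "x - z" z] by simp
    with 1 2 have "weight lam x \<le> 2 powr lam * (2 powr lam * 2 / m * pot lam f x)
        + (1 + 2 powr lam * norm z powr lam) * (pot lam f x / pot lam f z)"
      by (simp add: weight_def algebra_simps)
    also have "\<dots> = k * pot lam f x" by (simp add: k_def algebra_simps add_divide_distrib)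
    finally show "1 / k * weight lam x \<le> pot lam f x" using k by (simp add: field_simps)
  qed (use k in simp)
qed

lemma weighted_mult_pot:
  assumes f: "weighted lam f" and g: "weighted lam g"
  shows "integrable lborel (\<lambda>x. f x * pot lam g x)"
    and "(\<integral>\<^sup>+x. ennreal (f x * pot lam g x) \<partial>lborel) = ennreal (\<integral>x. f x * pot lam g x \<partial>lborel)"
    and "0 \<le> (\<integral>x. f x * pot lam g x \<partial>lborel)"
proof -
  note [measurable] = weighted_measurable[OF f] measurable_pot[OF g]
  show int: "integrable lborel (\<lambda>x. f x * pot lam g x)"
  proof (rule Bochner_Integration.integrable_bound)
    show "integrable lborel (\<lambda>x. 2 powr lam * (\<integral>y. g y * weight lam y \<partial>lborel) * (f x * weight lam x))"
      by (intro integrable_mult_right weighted_integrable_weight f)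
    show "AE x in lborel. norm (f x * pot lam g x)
        \<le> norm (2 powr lam * (\<integral>y. g y * weight lam y \<partial>lborel) * (f x * weight lam x))"
    proof (intro AE_I2)
      fix x
      have "f x * pot lam g x \<le> f x * (2 powr lam * (\<integral>y. g y * weight lam y \<partial>lborel) * weight lam x)"
        by (intro mult_left_mono pot_le_weight weighted_nonneg[OF f] g)
      then show "norm (f x * pot lam g x)
        \<le> norm (2 powr lam * (\<integral>y. g y * weight lam y \<partial>lborel) * (f x * weight lam x))"
        using weighted_nonneg[OF f, of x] pot_nonneg[OF g, of x] weight_pos[of lam x]
          weighted_integral_nonneg[OF g]
        by (simp add: abs_mult mult_ac)
    qed
  qed measurable
  have nn: "0 \<le> f x * pot lam g x" for x
    using weighted_nonneg[OF f, of x] pot_nonneg[OF g, of x] by simp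
  show "0 \<le> (\<integral>x. f x * pot lam g x \<partial>lborel)" by (intro integral_nonneg_AE AE_I2 nn)
  show "(\<integral>\<^sup>+x. ennreal (f x * pot lam g x) \<partial>lborel) = ennreal (\<integral>x. f x * pot lam g x \<partial>lborel)"
    by (intro nn_integral_eq_integral int AE_I2 nn)
qed

lemma nn_integral_mult_pot:
  fixes f g :: "'a::euclidean_space \<Rightarrow> real"
  assumes f: "weighted lam f" and g: "weighted lam g"
  shows "(\<integral>\<^sup>+x. \<integral>\<^sup>+y. ennreal (f x * g y * norm (x - y) powr lam) \<partial>lborel \<partial>lborel)
    = ennreal (\<integral>x. f x * pot lam g x \<partial>lborel)"
proof -
  note [measurable] = weighted_measurable[OF g]
  have "(\<integral>\<^sup>+x. \<integral>\<^sup>+y. ennreal (f x * g y * norm (x - y) powr lam) \<partial>lborel \<partial>lborel)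
      = (\<integral>\<^sup>+x. ennreal (f x * pot lam g x) \<partial>lborel)"
  proof (rule nn_integral_cong)
    fix x :: 'a
    have "(\<integral>\<^sup>+y. ennreal (f x * g y * norm (x - y) powr lam) \<partial>lborel)
        = (\<integral>\<^sup>+y. ennreal (f x) * ennreal (g y * norm (x - y) powr lam) \<partial>lborel)"
      using weighted_nonneg[OF f, of x] by (simp add: ennreal_mult'[symmetric] mult_ac)
    also have "\<dots> = ennreal (f x) * ennreal (pot lam g x)"
      by (subst nn_integral_cmult) (auto simp: nn_integral_kernel_eq_pot[OF g])
    finally show "(\<integral>\<^sup>+y. ennreal (f x * g y * norm (x - y) powr lam) \<partial>lborel) = ennreal (f x * pot lam g x)"
      using weighted_nonneg[OF f, of x] by (simp add: ennreal_mult'[symmetric])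
  qed
  also have "\<dots> = ennreal (\<integral>x. f x * pot lam g x \<partial>lborel)" by (rule weighted_mult_pot[OF f g])
  finally show ?thesis .
qed

lemma integral_mult_pot_commute:
  fixes f g :: "'a::euclidean_space \<Rightarrow> real"
  assumes f: "weighted lam f" and g: "weighted lam g"
  shows "(\<integral>x. f x * pot lam g x \<partial>lborel) = (\<integral>x. g x * pot lam f x \<partial>lborel)"
proof -
  note [measurable] = weighted_measurable[OF f] weighted_measurable[OF g]
  have "ennreal (\<integral>x. f x * pot lam g x \<partial>lborel)
      = (\<integral>\<^sup>+x. \<integral>\<^sup>+y. ennreal (f x * g y * norm (x - y) powr lam) \<partial>lborel \<partial>lborel)"
    by (rule nn_integral_mult_pot[OF f g, symmetric])
  also have "\<dots> = (\<integral>\<^sup>+y. \<integral>\<^sup>+x. ennreal (f x * g y * norm (x - y) powr lam) \<partial>lborel \<partial>lborel)"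
    by (intro lborel_pair.Fubini'[symmetric]) (simp add: case_prod_beta')
  also have "\<dots> = (\<integral>\<^sup>+y. \<integral>\<^sup>+x. ennreal (g y * f x * norm (y - x) powr lam) \<partial>lborel \<partial>lborel)"
    by (simp add: mult_ac norm_minus_commute)
  also have "\<dots> = ennreal (\<integral>x. g x * pot lam f x \<partial>lborel)"
    by (rule nn_integral_mult_pot[OF g f])
  finally show ?thesis
    using weighted_mult_pot(3)[OF f g] weighted_mult_pot(3)[OF g f] by simp
qed

end

section \<open>The reverse Hoelder inequality and a priori bounds\<close>

text \<open>Weighted arithmetic and geometric means. Both parts follow from \<open>ln u \<le> u - 1\<close>, with equality only at \<open>u = 1\<close>,
applied to \<open>s / m\<close> and \<open>t / m\<close> where \<open>m\<close> is the geometric mean.\<close>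

lemma Young_with_equality:
  fixes p s t :: real
  assumes p: "0 < p" "p < 1" and s: "0 \<le> s" and t: "0 < t"
  shows "s powr p * t powr (1 - p) \<le> p * s + (1 - p) * t"
    and "s powr p * t powr (1 - p) = p * s + (1 - p) * t \<Longrightarrow> s = t"
proof -
  have "s powr p * t powr (1 - p) \<le> p * s + (1 - p) * t
      \<and> (s powr p * t powr (1 - p) = p * s + (1 - p) * t \<longrightarrow> s = t)"
  proof (cases "s = 0")
    case True
    then show ?thesis using p t mult_pos_pos[of "1 - p" t] by auto
  next
    case False
    then have s: "0 < s" using s by simp
    define m where "m = s powr p * t powr (1 - p)"
    have m: "0 < m" using s t by (simp add: m_def)
    have "ln m = p * ln s + (1 - p) * ln t"
      using s t by (simp add: m_def ln_mult)
    then have sum0: "p * ln (s / m) + (1 - p) * ln (t / m) = 0"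
      using s t m by (simp add: ln_div algebra_simps)
    have gs: "ln (s / m) \<le> s / m - 1" "ln (t / m) \<le> t / m - 1"
      using s t m by (auto intro!: ln_le_minus_one)
    then have ps: "p * ln (s / m) \<le> p * (s / m - 1)" "(1 - p) * ln (t / m) \<le> (1 - p) * (t / m - 1)"
      using p by (auto intro!: mult_left_mono)
    have split: "p * s + (1 - p) * t = m * (1 + (p * (s / m - 1) + (1 - p) * (t / m - 1)))"
      using m by (simp add: field_simps)
    have le: "m \<le> p * s + (1 - p) * t"
      unfolding split using ps sum0 m by (simp add: mult_le_cancel_left1)
    have eq: "s = t" if "m = p * s + (1 - p) * t"
    proof -
      have "p * (s / m - 1) + (1 - p) * (t / m - 1) = 0"
        using that m unfolding split by (simp add: mult_cancel_left1)
      then have "p * ln (s / m) = p * (s / m - 1)" "(1 - p) * ln (t / m) = (1 - p) * (t / m - 1)"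
        using ps sum0 by linarith+
      then have "ln (s / m) = s / m - 1" "ln (t / m) = t / m - 1" using p by auto
      then have "s / m = 1" "t / m = 1"
        using ln_eq_minus_one[OF divide_pos_pos[OF s m]] ln_eq_minus_one[OF divide_pos_pos[OF t m]] by blast+
      then show ?thesis using m by simp
    qed
    show ?thesis using le eq by (auto simp: m_def)
  qed
  then show "s powr p * t powr (1 - p) \<le> p * s + (1 - p) * t"
    and "s powr p * t powr (1 - p) = p * s + (1 - p) * t \<Longrightarrow> s = t" by auto
qed

lemma powr_split:
  fixes p a u v :: real
  assumes p: "0 < p" "p < 1" and a: "a = p / (1 - p)" and u: "0 \<le> u" and v: "0 < v"
  shows "u powr p = (u * v) powr p * (v powr (-a)) powr (1 - p)"
proof -
  have "-a * (1 - p) = -p" using a p by simp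
  then have "(v powr (-a)) powr (1 - p) = v powr (-p)" by (simp add: powr_powr)
  moreover have "(u * v) powr p = u powr p * v powr p" using u v by (simp add: powr_mult)
  ultimately show ?thesis using v by (simp add: powr_add[symmetric])
qed

text \<open>Hoelder's inequality for \<open>u powr p = (u * v) powr p * (v powr (-a)) powr (1 - p)\<close>; as a lower bound for the integral of
\<open>u * v\<close> it is the reverse inequality for exponents below 1. Equality determines \<open>u\<close> from \<open>v\<close>, which is the source
of the Euler-Lagrange equation.\<close>

lemma reverse_Hoelder:
  fixes p a :: real and u v :: "'a \<Rightarrow> real"
  assumes p: "0 < p" "p < 1" and a: "a = p / (1 - p)"
    and um [measurable]: "u \<in> borel_measurable M" and u: "\<And>x. 0 \<le> u x" and v: "\<And>x. 0 < v x"
    and uv: "integrable M (\<lambda>x. u x * v x)" and va: "integrable M (\<lambda>x. v x powr (-a))"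
    and U: "0 < (\<integral>x. u x * v x \<partial>M)" and V: "0 < (\<integral>x. v x powr (-a) \<partial>M)"
  shows "integrable M (\<lambda>x. u x powr p)"
    and "(\<integral>x. u x powr p \<partial>M) \<le> (\<integral>x. u x * v x \<partial>M) powr p * (\<integral>x. v x powr (-a) \<partial>M) powr (1 - p)"
    and "(\<integral>x. u x powr p \<partial>M) = (\<integral>x. u x * v x \<partial>M) powr p * (\<integral>x. v x powr (-a) \<partial>M) powr (1 - p)
      \<Longrightarrow> AE x in M. u x = (\<integral>x. u x * v x \<partial>M) / (\<integral>x. v x powr (-a) \<partial>M) * v x powr (-a - 1)"
proof -
  define U where "U = (\<integral>x. u x * v x \<partial>M)"
  define V where "V = (\<integral>x. v x powr (-a) \<partial>M)"
  have UV: "0 < U" "0 < V" using assms by (simp_all add: U_def V_def)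
  define s where "s x = u x * v x / U" for x
  define t where "t x = v x powr (-a) / V" for x
  have st: "0 \<le> s x" "0 < t x" for x using u[of x] v[of x] UV by (auto simp: s_def t_def)
  have eq: "u x powr p = U powr p * V powr (1 - p) * (s x powr p * t x powr (1 - p))" for x
    using UV u[of x] v[of x] powr_split[OF p a u[of x] v[of x]] by (simp add: s_def t_def powr_divide)
  define k where "k = U powr p * V powr (1 - p)"
  have k: "0 < k" using UV by (simp add: k_def)
  have le: "u x powr p \<le> k * (p * s x + (1 - p) * t x)" for x
    unfolding eq k_def[symmetric] using Young_with_equality(1)[OF p st] k by (intro mult_left_mono) auto
  have ist: "integrable M (\<lambda>x. k * (p * s x + (1 - p) * t x))"
    unfolding s_def t_def by (intro integrable_mult_right Bochner_Integration.integrable_add integrable_divide uv va)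
  show ip: "integrable M (\<lambda>x. u x powr p)"
    by (rule Bochner_Integration.integrable_bound[OF ist]) (auto intro!: AE_I2 order_trans[OF le])
  have val: "(\<integral>x. k * (p * s x + (1 - p) * t x) \<partial>M) = k"
  proof -
    have "(\<integral>x. k * (p * s x + (1 - p) * t x) \<partial>M) = k * (p * (U / U) + (1 - p) * (V / V))"
      unfolding s_def t_def using uv va by (simp add: U_def V_def)
    also have "\<dots> = k" using UV by simp
    finally show ?thesis .
  qed
  show "(\<integral>x. u x powr p \<partial>M) \<le> (\<integral>x. u x * v x \<partial>M) powr p * (\<integral>x. v x powr (-a) \<partial>M) powr (1 - p)"
    using integral_mono[OF ip ist le] unfolding val by (simp add: k_def U_def V_def)
  show "AE x in M. u x = (\<integral>x. u x * v x \<partial>M) / (\<integral>x. v x powr (-a) \<partial>M) * v x powr (-a - 1)"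
    if "(\<integral>x. u x powr p \<partial>M) = (\<integral>x. u x * v x \<partial>M) powr p * (\<integral>x. v x powr (-a) \<partial>M) powr (1 - p)"
  proof -
    have "(\<integral>x. k * (p * s x + (1 - p) * t x) - u x powr p \<partial>M) = 0"
      using ist ip that val by (simp add: k_def U_def V_def)
    then have "AE x in M. k * (p * s x + (1 - p) * t x) - u x powr p = 0"
      using le ist ip by (subst (asm) integral_nonneg_eq_0_iff_AE) auto
    then show ?thesis
    proof eventually_elim
      case (elim x)
      then have "s x powr p * t x powr (1 - p) = p * s x + (1 - p) * t x"
        unfolding eq k_def[symmetric] using k by simp
      then have "u x * v x / U = v x powr (-a) / V"
        using Young_with_equality(2)[OF p st] by (simp add: s_def t_def)
      then have "u x * v x = (U / V * v x powr (-a - 1)) * v x"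
        using UV v[of x] by (simp add: field_simps powr_diff)
      then have "u x = U / V * v x powr (-a - 1)"
        using v[of x] by (metis mult_right_cancel order_less_irrefl)
      then show ?case by (simp add: U_def V_def)
    qed
  qed
qed

lemma integrable_powr_if_ge_weight:
  fixes F :: "'a::euclidean_space \<Rightarrow> real"
  assumes lam: "0 < lam" and s: "real DIM('a) < lam * s" and [measurable]: "F \<in> borel_measurable borel"
    and c: "0 < c" "\<And>x. c * weight lam x \<le> F x"
  shows "integrable lborel (\<lambda>x. F x powr (-s))"
    and "F x powr (-s) \<le> c powr (-s) * weight lam x powr (-s)"
proof -
  have "0 < s" using lam s
    by (metis less_le_trans linorder_not_less mult_nonneg_nonpos of_nat_0_le_iff order_le_less)
  then have le: "F x powr (-s) \<le> c powr (-s) * weight lam x powr (-s)" for x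
    using powr_mono2'[of "-s" "c * weight lam x" "F x"] c weight_pos[of lam x]
    by (simp add: powr_mult)
  then show "F x powr (-s) \<le> c powr (-s) * weight lam x powr (-s)" .
  show "integrable lborel (\<lambda>x. F x powr (-s))"
    by (rule Bochner_Integration.integrable_bound[OF integrable_mult_right[OF integrable_weight_powr[OF lam s], of "c powr (-s)"]])
      (use le in auto)
qed

text \<open>A constant that depends on the exponents only. The split \<open>f powr p \<le> f * m + m powr (-a)\<close> with
\<open>m y = M + norm y powr lam / 4\<close> gives \<open>1 \<le> M * (mass of f) + 1/4 * pot lam f 0 + 1/4\<close>, so the mass is bounded below;
as the origin is a minimum of the potential, \<open>2 * pot lam f x \<ge> pot lam f x + pot lam f 0\<close>, and
\<open>pot_add_ge\<close> concludes.\<close>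

lemma normalized_pot_lower_bound:
  fixes p a lam :: real
  assumes lam: "0 < lam" and p: "0 < p" "p < 1" and a: "a = p / (1 - p)" and dim: "real DIM('a) < lam * a"
  obtains c where "0 < c"
    "\<And>f x. weighted lam f \<Longrightarrow> integrable lborel (\<lambda>x. f x powr p) \<Longrightarrow> (\<integral>x. f x powr p \<partial>lborel) = 1
       \<Longrightarrow> pot lam f 0 = 1 \<Longrightarrow> (\<And>x. 1 \<le> pot lam f x) \<Longrightarrow> c * weight lam (x::'a::euclidean_space) \<le> pot lam f x"
proof -
  obtain M where M: "0 < M"
    "integrable lborel (\<lambda>x::'a. (M + (1/4) * norm x powr lam) powr (-a))"
    "(\<integral>(x::'a). (M + (1/4) * norm x powr lam) powr (-a) \<partial>lborel) \<le> 1/4"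
    using small_tail_integral[OF lam dim, of "1/4" "1/4"] by auto
  define k where "k = 1 + 2 powr lam * 4 * M"
  have k: "0 < k" using M by (simp add: k_def add_pos_nonneg)
  show ?thesis
  proof (rule that[of "1 / k"])
    fix f :: "'a \<Rightarrow> real" and x :: 'a
    assume f: "weighted lam f" and fp: "integrable lborel (\<lambda>x. f x powr p)" "(\<integral>x. f x powr p \<partial>lborel) = 1"
      and F0: "pot lam f 0 = 1" and F: "\<And>x. 1 \<le> pot lam f x"
    define m where "m y = M + (1/4) * norm (y::'a) powr lam" for y
    have m: "0 < m y" for y using M by (simp add: m_def add_pos_nonneg)
    have pw: "f y powr p \<le> M * f y + (1/4) * (f y * norm (0 - y) powr lam) + m y powr (-a)" for y
    proof -
      have "f y powr p \<le> p * (f y * m y) + (1 - p) * (m y powr (-a))"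
        unfolding powr_split[OF p a weighted_nonneg[OF f] m[of y], of y]
        using m[of y] by (intro Young_with_equality(1) p mult_nonneg_nonneg weighted_nonneg[OF f]) auto
      also have "\<dots> \<le> 1 * (f y * m y) + 1 * (m y powr (-a))"
        using p m[of y] weighted_nonneg[OF f, of y] by (intro add_mono mult_right_mono) auto
      finally show ?thesis by (simp add: m_def algebra_simps)
    qed
    have ints: "integrable lborel (\<lambda>y. M * f y)" "integrable lborel (\<lambda>y. (1/4) * (f y * norm (0 - y) powr lam))"
      "integrable lborel (\<lambda>y. m y powr (-a))"
      using M weighted_integrable[OF lam f] weighted_integrable_kernel[OF lam f, of 0] by (auto simp: m_def[abs_def])
    have "(\<integral>y. f y powr p \<partial>lborel) \<le> (\<integral>y. M * f y + (1/4) * (f y * norm (0 - y) powr lam) + m y powr (-a) \<partial>lborel)"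
      by (intro integral_mono fp pw Bochner_Integration.integrable_add ints)
    also have "\<dots> = M * (\<integral>y. f y \<partial>lborel) + (1/4) * pot lam f 0 + (\<integral>y. m y powr (-a) \<partial>lborel)"
      using ints unfolding pot_def by (simp add: Bochner_Integration.integral_add)
    also have "\<dots> \<le> M * (\<integral>y. f y \<partial>lborel) + 1/2"
      using M F0 by (simp add: m_def)
    finally have mass: "1 \<le> 2 * M * (\<integral>y. f y \<partial>lborel)" using fp(2) by simp
    have "norm x powr lam * 1 \<le> norm x powr lam * (2 * M * (\<integral>y. f y \<partial>lborel))"
      by (intro mult_left_mono mass) simp
    also have "\<dots> = 2 * M * (norm (x - 0) powr lam * (\<integral>y. f y \<partial>lborel))" by simp
    also have "\<dots> \<le> 2 * M * (2 powr lam * (pot lam f x + pot lam f 0))"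
      using pot_add_ge[OF lam f, of x 0] M by (intro mult_left_mono) auto
    also have "\<dots> \<le> 2 * M * (2 powr lam * (2 * pot lam f x))"
      using M F[of x] F0 by (intro mult_left_mono) auto
    finally have "weight lam x \<le> k * pot lam f x"
      using F[of x] by (simp add: weight_def k_def algebra_simps)
    then show "1 / k * weight lam x \<le> pot lam f x" using k by (simp add: field_simps)
  qed (use k in simp)
qed

text \<open>If the integral of the negative power of the potential is not small, then the potential must be moderate at some
point outside a fixed small ball about the origin. Together with the value 1 at the origin, \<open>pot_add_ge\<close> bounds
the mass. The point may lie arbitrarily far away: distance only improves the bound.\<close>

lemma normalized_mass_upper_bound:
  fixes b c \<kappa> lam :: real
  assumes lam: "0 < lam" and b: "0 < b" and dim: "real DIM('a) < lam * b" and c: "0 < c" and k: "0 < \<kappa>"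
  obtains K where
    "\<And>f. weighted lam f \<Longrightarrow> pot lam f 0 = 1 \<Longrightarrow> (\<And>x::'a::euclidean_space. c * weight lam x \<le> pot lam f x)
       \<Longrightarrow> \<kappa> \<le> (\<integral>x. pot lam f x powr (-b) \<partial>lborel) \<Longrightarrow> (\<integral>x. f x \<partial>lborel) \<le> K"
proof -
  obtain M where M: "0 < M"
    "integrable lborel (\<lambda>x::'a. (M + (c/2) * norm x powr lam) powr (-b))"
    "(\<integral>(x::'a). (M + (c/2) * norm x powr lam) powr (-b) \<partial>lborel) \<le> \<kappa>/4"
    using small_tail_integral[OF lam dim, of "c/2" "\<kappa>/4"] c k by auto
  define V where "V = c powr (-b) * unit_ball_vol (real DIM('a))"
  have V: "0 \<le> V" by (simp add: V_def)
  define \<eta> where "\<eta> = min 1 (\<kappa> / (4 * (V + 1)))"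
  have eta: "0 < \<eta>" "\<eta> \<le> 1" "\<eta> \<le> \<kappa> / (4 * (V + 1))" using k V by (auto simp: \<eta>_def)
  have vol: "c powr (-b) * measure lborel (ball (0::'a) \<eta>) \<le> \<kappa> / 4"
  proof -
    have "\<eta> ^ DIM('a) \<le> \<eta> ^ 1" by (intro power_decreasing) (use eta in auto)
    then have "V * \<eta> ^ DIM('a) \<le> (V + 1) * \<eta>" using V eta by (intro mult_mono) auto
    also have "\<dots> \<le> (V + 1) * (\<kappa> / (4 * (V + 1)))" using eta V by (intro mult_left_mono) auto
    also have "\<dots> = \<kappa> / 4"
    proof -
      have "4 * V + 4 \<noteq> 0" using V by linarith
      then show ?thesis by (simp add: field_simps)
    qed
    finally show ?thesis using eta content_ball[of \<eta> "0::'a"] by (simp add: V_def mult_ac)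
  qed
  show ?thesis
  proof (rule that[of "2 powr lam * (2 * M + 1) / \<eta> powr lam"])
    fix f :: "'a \<Rightarrow> real"
    assume f: "weighted lam f" and F0: "pot lam f 0 = 1" and F: "\<And>x. c * weight lam x \<le> pot lam f x"
      and X: "\<kappa> \<le> (\<integral>x. pot lam f x powr (-b) \<partial>lborel)"
    \<comment> \<open>If the potential were large off the ball of radius \<open>\<eta>\<close>, the integral of its negative power would be
      smaller than \<open>\<kappa>\<close>.\<close>
    have "\<exists>z. \<eta> \<le> norm z \<and> pot lam f z \<le> 2 * M"
    proof (rule ccontr)
      assume "\<not> ?thesis"
      then have big: "2 * M < pot lam f z" if "\<eta> \<le> norm z" for z using that by force
      have pw: "pot lam f x powr (-b) \<le> c powr (-b) * indicator (ball 0 \<eta>) x + (M + (c/2) * norm x powr lam) powr (-b)" for x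
      proof (cases "norm x < \<eta>")
        case True
        have "weight lam x powr (-b) \<le> 1"
          using powr_mono2'[of "-b" 1 "weight lam x"] b weight_ge_1[of lam x] by simp
        then have "c powr (-b) * weight lam x powr (-b) \<le> c powr (-b)" by (simp add: mult_left_le)
        then have "pot lam f x powr (-b) \<le> c powr (-b)"
          using integrable_powr_if_ge_weight(2)[OF lam dim measurable_pot[OF lam f] c F, of x] by linarith
        then show ?thesis using True by (simp add: indicator_def add_increasing2)
      next
        case False
        then have "2 * M < pot lam f x" by (intro big) simp
        moreover have "c * norm x powr lam \<le> pot lam f x"
          using F[of x] c by (simp add: weight_def algebra_simps)
        ultimately have "M + (c/2) * norm x powr lam \<le> pot lam f x" by simp
        then have "pot lam f x powr (-b) \<le> (M + (c/2) * norm x powr lam) powr (-b)"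
          using M c b by (intro powr_mono2') (auto intro: add_pos_nonneg)
        then show ?thesis by (simp add: add_increasing)
      qed
      have i1: "integrable lborel (\<lambda>x. c powr (-b) * indicat_real (ball (0::'a) \<eta>) x)"
        using emeasure_lborel_ball_finite[of "0::'a" \<eta>] by (intro integrable_mult_right integrable_real_indicator) auto
      have "\<kappa> \<le> (\<integral>x. c powr (-b) * indicat_real (ball (0::'a) \<eta>) x + (M + (c/2) * norm x powr lam) powr (-b) \<partial>lborel)"
        by (rule order_trans[OF X], intro integral_mono pw Bochner_Integration.integrable_add i1 M(2)
            integrable_powr_if_ge_weight(1)[OF lam dim measurable_pot[OF lam f] c F])
      also have "\<dots> = c powr (-b) * measure lborel (ball (0::'a) \<eta>) + (\<integral>x. (M + (c/2) * norm (x::'a) powr lam) powr (-b) \<partial>lborel)"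
        by (subst Bochner_Integration.integral_add[OF i1 M(2)]) simp
      also have "\<dots> \<le> \<kappa> / 2" using vol M(3) by simp
      finally show False using k by simp
    qed
    then obtain z where z: "\<eta> \<le> norm z" "pot lam f z \<le> 2 * M" by blast
    have f0: "0 \<le> (\<integral>x. f x \<partial>lborel)" by (intro integral_nonneg_AE AE_I2 weighted_nonneg[OF f])
    have "\<eta> powr lam * (\<integral>x. f x \<partial>lborel) \<le> norm (z - 0) powr lam * (\<integral>x. f x \<partial>lborel)"
      using z eta lam f0 by (intro mult_right_mono powr_mono2) auto
    also have "\<dots> \<le> 2 powr lam * (pot lam f z + pot lam f 0)" by (rule pot_add_ge[OF lam f])
    also have "\<dots> \<le> 2 powr lam * (2 * M + 1)" using z F0 by (intro mult_left_mono) auto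
    finally show "(\<integral>x. f x \<partial>lborel) \<le> 2 powr lam * (2 * M + 1) / \<eta> powr lam"
      using eta by (simp add: field_simps)
  qed
qed

lemma integral_lborel_affine:
  fixes h :: "'a::euclidean_space \<Rightarrow> real"
  assumes c: "0 < c" and [measurable]: "h \<in> borel_measurable borel"
  shows "integrable lborel (\<lambda>x. h (t + c *\<^sub>R x)) \<longleftrightarrow> integrable lborel h"
    and "(\<integral>x. h (t + c *\<^sub>R x) \<partial>lborel) = (\<integral>x. h x \<partial>lborel) / c ^ DIM('a)"
proof -
  let ?T = "\<lambda>x::'a. t + c *\<^sub>R x"
  have l: "(lborel :: 'a measure) = density (distr lborel borel ?T) (\<lambda>_. ennreal (c ^ DIM('a)))"
    using lborel_affine[of c t] c by simp
  have "integrable lborel h \<longleftrightarrow> integrable (density (distr lborel borel ?T) (\<lambda>_. ennreal (c ^ DIM('a)))) h"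
    using l by simp
  also have "\<dots> \<longleftrightarrow> integrable lborel (\<lambda>x. c ^ DIM('a) * h (?T x))"
    using c by (subst integrable_density) (auto simp: integrable_distr_eq)
  also have "\<dots> \<longleftrightarrow> integrable lborel (\<lambda>x. h (?T x))" using c by (simp add: integrable_mult_right_iff)
  finally show "integrable lborel (\<lambda>x. h (?T x)) \<longleftrightarrow> integrable lborel h" by simp
  have "(\<integral>x. h x \<partial>lborel) = (\<integral>x. h x \<partial>density (distr lborel borel ?T) (\<lambda>_. ennreal (c ^ DIM('a))))"
    using l by simp
  also have "\<dots> = (\<integral>x. c ^ DIM('a) * h (?T x) \<partial>lborel)"
    using c by (subst integral_density) (auto simp: integral_distr)
  also have "\<dots> = c ^ DIM('a) * (\<integral>x. h (?T x) \<partial>lborel)" by simp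
  finally show "(\<integral>x. h (?T x) \<partial>lborel) = (\<integral>x. h x \<partial>lborel) / c ^ DIM('a)" using c by simp
qed

lemma mass_pos_if_powr_integral_pos:
  assumes lam: "0 < lam" and f: "weighted lam f" and p: "0 < p" and "0 < (\<integral>x. f x powr p \<partial>lborel)"
  shows "0 < (\<integral>x. f x \<partial>lborel)"
proof (rule ccontr)
  assume "\<not> ?thesis"
  moreover have "0 \<le> (\<integral>x. f x \<partial>lborel)" by (intro integral_nonneg_AE AE_I2 weighted_nonneg[OF f])
  ultimately have "(\<integral>x. f x \<partial>lborel) = 0" by simp
  then have "AE x in lborel. f x = 0"
    by (subst (asm) integral_nonneg_eq_0_iff_AE) (auto intro: weighted_integrable lam f weighted_nonneg[OF f])
  then have "AE x in lborel. f x powr p = 0" by eventually_elim auto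
  then have "(\<integral>x. f x powr p \<partial>lborel) = 0" by (rule integral_eq_zero_AE)
  then show False using assms by simp
qed

text \<open>Translations and dilations act on the problem, and the relation between the exponents says exactly that they
preserve both the constraint and the energy. They are used to move the minimum of the potential to the origin and
to give it the value 1.\<close>

lemma normalize:
  fixes f :: "'a::euclidean_space \<Rightarrow> real" and lam p b :: real
  assumes lam: "0 < lam" and p: "0 < p" and b: "0 < b"
    and rel: "real DIM('a) / p - real DIM('a) - lam = - (real DIM('a) / b)"
    and f: "weighted lam f" and fp: "integrable lborel (\<lambda>x. f x powr p)" "(\<integral>x. f x powr p \<partial>lborel) = 1"
  obtains g :: "'a \<Rightarrow> real" where "weighted lam g" "integrable lborel (\<lambda>x. g x powr p)" "(\<integral>x. g x powr p \<partial>lborel) = 1"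
    "pot lam g 0 = 1" "\<And>x. 1 \<le> pot lam g x"
    "(\<integral>x. pot lam g x powr (-b) \<partial>lborel) = (\<integral>x. pot lam f x powr (-b) \<partial>lborel)"
proof -
  note [measurable] = weighted_measurable[OF f] measurable_pot[OF lam f]
  define n where "n = real DIM('a)"
  have n: "0 < n" by (simp add: n_def)
  have "0 < (\<integral>x. f x \<partial>lborel)" using mass_pos_if_powr_integral_pos[OF lam f p] fp by simp
  then obtain z where z: "0 < pot lam f z" "\<And>x. pot lam f z \<le> pot lam f x"
    using pot_attains_inf[OF lam f] by blast
  (* Up to the change of variable the new potential is s powr (-n/b) times the old one; this s makes its
     minimum equal to 1. *)
  define s where "s = pot lam f z powr (b / n)"
  have s: "0 < s" using z by (simp add: s_def)
  have sn: "s powr (-(n / b)) = 1 / pot lam f z"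
    using b n z by (simp add: s_def powr_powr powr_minus_divide)
  have spow: "s ^ DIM('a) = s powr n" using s by (simp add: n_def powr_realpow)
  let ?C = "1 + (1/s) powr lam * 2 powr lam * weight lam z"
  define g where "g x = s powr (n / p) * f (z + s *\<^sub>R x)" for x
  have [measurable]: "g \<in> borel_measurable borel" unfolding g_def[abs_def] by measurable
  have gw: "weighted lam g"
    unfolding weighted_def
  proof (intro conjI allI)
    show "0 \<le> g x" for x using weighted_nonneg[OF f] by (simp add: g_def)
    define h where "h y = f y * weight lam ((1 / s) *\<^sub>R (y - z))" for y
    have [measurable]: "h \<in> borel_measurable borel" unfolding h_def[abs_def] by measurable
    have "integrable lborel h"
    proof (rule Bochner_Integration.integrable_bound)
      show "integrable lborel (\<lambda>y. ?C * (f y * weight lam y))"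
        by (intro integrable_mult_right weighted_integrable_weight f)
      show "AE y in lborel. norm (h y) \<le> norm (?C * (f y * weight lam y))"
      proof (intro AE_I2)
        fix y
        have "norm ((1 / s) *\<^sub>R (y - z)) powr lam = (1/s) powr lam * norm (y - z) powr lam"
          using s by (simp add: powr_mult powr_divide)
        also have "\<dots> \<le> (1/s) powr lam * (2 powr lam * weight lam y * weight lam z)"
          by (intro mult_left_mono kernel_le_weight lam) simp
        finally have "weight lam ((1 / s) *\<^sub>R (y - z)) \<le> ?C * weight lam y"
        proof -
          assume "norm ((1 / s) *\<^sub>R (y - z)) powr lam \<le> (1/s) powr lam * (2 powr lam * weight lam y * weight lam z)"
          moreover have "weight lam ((1 / s) *\<^sub>R (y - z)) = 1 + norm ((1 / s) *\<^sub>R (y - z)) powr lam"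
            by (simp only: weight_def)
          moreover have "(1/s) powr lam * (2 powr lam * weight lam y * weight lam z)
              = (1/s) powr lam * 2 powr lam * weight lam z * weight lam y" by (simp only: mult_ac)
          ultimately show ?thesis using weight_ge_1[of lam y] by (simp only: distrib_right mult_1)
        qed
        from mult_left_mono[OF this weighted_nonneg[OF f, of y]]
        show "norm (h y) \<le> norm (?C * (f y * weight lam y))"
          using weighted_nonneg[OF f, of y] weight_pos[of lam y] weight_pos[of lam z] weight_pos[of lam "(1 / s) *\<^sub>R (y - z)"]
          by (simp add: h_def abs_mult mult_ac abs_of_pos add_pos_nonneg)
      qed
    qed measurable
    then have "integrable lborel (\<lambda>x. h (z + s *\<^sub>R x))" by (subst integral_lborel_affine(1)[OF s]) auto
    then have "integrable lborel (\<lambda>x. s powr (n / p) * h (z + s *\<^sub>R x))" by (rule integrable_mult_right)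
    then show "integrable lborel (\<lambda>x. g x * weight lam x)"
      using s by (simp add: g_def h_def mult_ac)
  qed measurable
  have gp: "g x powr p = s powr n * f (z + s *\<^sub>R x) powr p" for x
    using p by (simp add: g_def powr_mult weighted_nonneg[OF f] powr_powr)
  have potg: "pot lam g x = pot lam f (z + s *\<^sub>R x) / pot lam f z" for x
  proof -
    have "pot lam g x = (\<integral>y. s powr (n / p - lam) * (f (z + s *\<^sub>R y) * norm ((z + s *\<^sub>R x) - (z + s *\<^sub>R y)) powr lam) \<partial>lborel)"
      unfolding pot_def
    proof (rule Bochner_Integration.integral_cong[OF refl])
      fix y
      have "norm ((z + s *\<^sub>R x) - (z + s *\<^sub>R y)) = s * norm (x - y)"
        using s by (simp add: scaleR_diff_right[symmetric])
      then show "g y * norm (x - y) powr lam = s powr (n / p - lam) * (f (z + s *\<^sub>R y) * norm ((z + s *\<^sub>R x) - (z + s *\<^sub>R y)) powr lam)"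
        using s by (simp add: g_def powr_mult powr_diff)
    qed
    also have "\<dots> = s powr (n / p - lam) * (\<integral>y. f (z + s *\<^sub>R y) * norm ((z + s *\<^sub>R x) - (z + s *\<^sub>R y)) powr lam \<partial>lborel)"
      by simp
    also have "\<dots> = s powr (n / p - lam) * (pot lam f (z + s *\<^sub>R x) / s ^ DIM('a))"
      by (subst integral_lborel_affine(2)[OF s, of "\<lambda>y. f y * norm ((z + s *\<^sub>R x) - y) powr lam" z]) (auto simp: pot_def)
    also have "\<dots> = s powr (n / p - lam - n) * pot lam f (z + s *\<^sub>R x)"
      unfolding spow by (simp add: powr_diff)
    also have "n / p - lam - n = - (n / b)" using rel by (simp add: n_def)
    finally show ?thesis unfolding sn by simp
  qed
  show ?thesis
  proof (rule that[OF gw])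
    show "integrable lborel (\<lambda>x. g x powr p)"
      unfolding gp using fp(1) by (intro integrable_mult_right) (subst integral_lborel_affine(1)[OF s, of "\<lambda>y. f y powr p"], auto)
    show "(\<integral>x. g x powr p \<partial>lborel) = 1"
      unfolding gp using fp(2) s integral_lborel_affine(2)[OF s, of "\<lambda>y. f y powr p" z] by (simp add: spow)
    show "pot lam g 0 = 1" "1 \<le> pot lam g x" for x using z by (auto simp: potg)
    have "pot lam g x powr (-b) = s powr n * (pot lam f (z + s *\<^sub>R x)) powr (-b)" for x
    proof -
      have "pot lam g x powr (-b) = pot lam f z powr b * (pot lam f (z + s *\<^sub>R x)) powr (-b)"
        unfolding potg using z(1) pot_nonneg[OF lam f] by (simp add: powr_divide powr_minus_divide)
      also have "pot lam f z powr b = s powr n" using n z by (simp add: s_def powr_powr)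
      finally show ?thesis .
    qed
    then show "(\<integral>x. pot lam g x powr (-b) \<partial>lborel) = (\<integral>x. pot lam f x powr (-b) \<partial>lborel)"
      using s integral_lborel_affine(2)[OF s, of "\<lambda>x. pot lam f x powr (-b)" z] by (simp add: spow)
  qed
qed

section \<open>Existence of a maximizer\<close>

lemma pot_mono:
  assumes lam: "0 < lam" and f: "weighted lam f" and g: "weighted lam g" and le: "\<And>x. f x \<le> g x"
  shows "pot lam f x \<le> pot lam g x"
  unfolding pot_def
  by (intro integral_mono weighted_integrable_kernel lam f g mult_right_mono le) auto

text \<open>A diagonal argument gives convergence on a countable dense set, and equicontinuity extends it to all points. The
potentials are divided by the weight because the diagonal argument wants uniformly bounded functions.\<close>

lemma pot_convergent_subsequence:
  fixes f :: "nat \<Rightarrow> 'a::euclidean_space \<Rightarrow> real"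
  assumes lam: "0 < lam" and f: "\<And>n. weighted lam (f n)"
    and W: "\<And>n. (\<integral>y. f n y * weight lam y \<partial>lborel) \<le> W"
  obtains k F where "strict_mono (k :: nat \<Rightarrow> nat)" "\<And>x. (\<lambda>n. pot lam (f (k n)) x) \<longlonglongrightarrow> F x"
proof -
  obtain D :: "'a set" where D: "countable D" "\<And>X. open X \<Longrightarrow> X \<noteq> {} \<Longrightarrow> \<exists>d\<in>D. d \<in> X"
    by (rule countable_dense_setE) auto
  have W0: "0 \<le> W" using weighted_integral_nonneg[OF lam f, of 0] W[of 0] by linarith
  define q where "q n x = pot lam (f n) x / weight lam x" for n x
  have "norm (q n x) \<le> 2 powr lam * W" for n x
  proof -
    have "pot lam (f n) x \<le> 2 powr lam * (\<integral>y. f n y * weight lam y \<partial>lborel) * weight lam x"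
      by (rule pot_le_weight[OF lam f])
    also have "\<dots> \<le> 2 powr lam * W * weight lam x"
      by (intro mult_right_mono mult_left_mono W less_imp_le[OF weight_pos]) simp
    finally show ?thesis
      using pot_nonneg[OF lam f, of n x] weight_pos[of lam x] by (simp add: q_def field_simps)
  qed
  then obtain k where k: "strict_mono (k :: nat \<Rightarrow> nat)" "\<And>x. x \<in> D \<Longrightarrow> \<exists>l. (\<lambda>n. q (k n) x) \<longlonglongrightarrow> l"
    using function_convergent_subsequence[OF D(1), of q "2 powr lam * W"] by blast
  have conv: "convergent (\<lambda>n. pot lam (f (k n)) x)" for x
    unfolding Cauchy_convergent_iff[symmetric]
  proof (rule metric_CauchyI)
    fix e :: real assume e: "0 < e"
    define \<epsilon> where "\<epsilon> = e / (4 * (W + 1))"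
    have eps: "0 < \<epsilon>" using e W0 by (simp add: \<epsilon>_def)
    obtain \<delta> where d: "0 < \<delta>" "\<And>f x'. weighted lam f \<Longrightarrow> norm (x' - x) < \<delta> \<Longrightarrow>
       \<bar>pot lam f x' - pot lam f x\<bar> \<le> \<epsilon> * (\<integral>y. f y * weight lam y \<partial>lborel)"
      using pot_equicontinuous[OF lam eps, of x] by blast
    obtain z where z: "z \<in> D" "z \<in> ball x \<delta>" using D(2)[of "ball x \<delta>"] d by auto
    have near: "\<bar>pot lam (f n) z - pot lam (f n) x\<bar> \<le> e / 4" for n
    proof -
      have "\<bar>pot lam (f n) z - pot lam (f n) x\<bar> \<le> \<epsilon> * (\<integral>y. f n y * weight lam y \<partial>lborel)"
        using z by (intro d f) (simp add: dist_norm norm_minus_commute)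
      also have "\<dots> \<le> \<epsilon> * (W + 1)" using eps W[of n] by (intro mult_left_mono) auto
      also have "\<dots> = e / 4" using W0 by (simp add: \<epsilon>_def field_simps)
      finally show ?thesis .
    qed
    obtain l where "(\<lambda>n. q (k n) z) \<longlonglongrightarrow> l" using k z by blast
    then have "(\<lambda>n. q (k n) z * weight lam z) \<longlonglongrightarrow> l * weight lam z" by (intro tendsto_intros)
    then have "(\<lambda>n. pot lam (f (k n)) z) \<longlonglongrightarrow> l * weight lam z"
      using weight_pos[of lam z] by (simp add: q_def)
    then have "Cauchy (\<lambda>n. pot lam (f (k n)) z)" by (rule LIMSEQ_imp_Cauchy)
    moreover have "0 < e / 4" using e by simp
    ultimately obtain N where N: "\<forall>m\<ge>N. \<forall>n\<ge>N. dist (pot lam (f (k m)) z) (pot lam (f (k n)) z) < e / 4"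
      by (blast dest: metric_CauchyD)
    show "\<exists>N. \<forall>m\<ge>N. \<forall>n\<ge>N. dist (pot lam (f (k m)) x) (pot lam (f (k n)) x) < e"
    proof (intro exI allI impI)
      fix m n assume "N \<le> m" "N \<le> n"
      then have "\<bar>pot lam (f (k m)) z - pot lam (f (k n)) z\<bar> < e / 4" using N by (simp add: dist_real_def)
      then show "dist (pot lam (f (k m)) x) (pot lam (f (k n)) x) < e"
        using near[of "k m"] near[of "k n"] e unfolding dist_real_def by linarith
    qed
  qed
  show ?thesis
    by (rule that[OF k(1), of "\<lambda>x. lim (\<lambda>n. pot lam (f (k n)) x)"]) (use conv in \<open>simp add: convergent_LIMSEQ_iff\<close>)
qed

text \<open>With \<open>a = p / (1 - p)\<close> and \<open>b = r / (1 - r)\<close> the relation between the exponents becomes the symmetric formula for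
\<open>lam\<close>, and the powers \<open>-a\<close> and \<open>-b\<close> of any function that grows like the weight are integrable. The
parameter \<open>ty\<close> only pins the space, hence the dimension, to the locale.\<close>

locale hls_exponents =
  fixes p r lam a b :: real and ty :: "'a::euclidean_space itself"
  assumes p: "0 < p" "p < 1" and r: "0 < r" "r < 1"
    and a: "a = p / (1 - p)" and b: "b = r / (1 - r)"
    and lam: "lam = real DIM('a) / a + real DIM('a) / b"
begin

lemma ab_pos: "0 < a" "0 < b"
  using p r by (simp_all add: a b)

lemma lam_pos: "0 < lam"
  using ab_pos by (simp add: lam add_pos_pos)

lemma dim_less: "real DIM('a) < lam * a" "real DIM('a) < lam * b"
  using ab_pos by (simp_all add: lam field_simps)

lemma exponents: "(a + 1) * p = a" "(b + 1) * r = b" "1 - 1 / p = - 1 / a"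
  "real DIM('a) / p - real DIM('a) - lam = - (real DIM('a) / b)"
proof -
  show 1: "(a + 1) * p = a" "(b + 1) * r = b" using p r by (simp_all add: a b field_simps)
  show 2: "1 - 1 / p = - 1 / a" using p by (simp add: a field_simps)
  have "real DIM('a) / p - real DIM('a) = - (real DIM('a) * (1 - 1 / p))" by (simp add: algebra_simps)
  then show "real DIM('a) / p - real DIM('a) - lam = - (real DIM('a) / b)" unfolding 2 by (simp add: lam)
qed

definition unit_density :: "('a \<Rightarrow> real) \<Rightarrow> bool" where
  "unit_density f \<longleftrightarrow> weighted lam f \<and> integrable lborel (\<lambda>x. f x powr p) \<and> (\<integral>x. f x powr p \<partial>lborel) = 1"

text \<open>Since \<open>b = - q\<close>, this is \<open>\<integral> (I f)\<^sup>q\<close>; the outer exponent \<open>1 / q\<close> is negative, so minimizers of the norm are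
maximizers of the energy.\<close>

definition energy :: "('a \<Rightarrow> real) \<Rightarrow> real" where
  "energy f = (\<integral>x. pot lam f x powr (-b) \<partial>lborel)"

lemma unit_densityD:
  assumes "unit_density f"
  shows "weighted lam f" "integrable lborel (\<lambda>x. f x powr p)" "(\<integral>x. f x powr p \<partial>lborel) = 1"
    "0 < (\<integral>x. f x \<partial>lborel)"
  using assms mass_pos_if_powr_integral_pos[OF lam_pos _ p(1), of f] by (auto simp: unit_density_def)

lemma integral_powr_pos:
  fixes F :: "'a \<Rightarrow> real"
  assumes "\<And>x. 0 < F x" and int: "integrable lborel (\<lambda>x. F x powr s)"
  shows "0 < (\<integral>x. F x powr s \<partial>lborel)"
proof (rule ccontr)
  assume "\<not> ?thesis"
  moreover have "0 \<le> (\<integral>x. F x powr s \<partial>lborel)" by (intro integral_nonneg_AE) simp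
  ultimately have "(\<integral>x. F x powr s \<partial>lborel) = 0" by simp
  then have "AE x in lborel. F x powr s = 0"
    using int by (subst (asm) integral_nonneg_eq_0_iff_AE) auto
  moreover have "AE x in lborel. F x powr s \<noteq> 0"
    using assms(1) by (intro AE_I2) (simp add: less_imp_neq[symmetric])
  ultimately have "AE x in lborel::'a measure. False" by eventually_elim simp
  then have "UNIV \<in> null_sets (lborel :: 'a measure)" using AE_iff_null[of "lborel::'a measure" "\<lambda>_. False"] by simp
  then show False by (simp add: null_sets_def)
qed

lemma
  fixes f :: "'a \<Rightarrow> real"
  assumes "weighted lam f" "0 < (\<integral>x. f x \<partial>lborel)"
  shows pot_pos: "0 < pot lam f x"
    and integrable_pot_powr: "real DIM('a) < lam * s \<Longrightarrow> integrable lborel (\<lambda>x. pot lam f x powr (-s))"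
    and integral_pot_powr_pos: "real DIM('a) < lam * s \<Longrightarrow> 0 < (\<integral>x. pot lam f x powr (-s) \<partial>lborel)"
proof -
  obtain c where c: "0 < c" "\<And>x. c * weight lam x \<le> pot lam f x"
    using pot_ge_weight[OF lam_pos assms] by blast
  show *: "0 < pot lam f x" for x
    using c mult_pos_pos[OF c(1) weight_pos[of lam x]] by (metis less_le_trans)
  assume s: "real DIM('a) < lam * s"
  show **: "integrable lborel (\<lambda>x. pot lam f x powr (-s))"
    by (rule integrable_powr_if_ge_weight(1)[OF lam_pos s measurable_pot[OF lam_pos assms(1)] c])
  show "0 < (\<integral>x. pot lam f x powr (-s) \<partial>lborel)"
    by (rule integral_powr_pos[OF * **])
qed

lemma energy_pos: "unit_density f \<Longrightarrow> 0 < energy f"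
  unfolding energy_def by (intro integral_pot_powr_pos unit_densityD dim_less) auto

lemma weighted_powr:
  fixes H :: "'a \<Rightarrow> real"
  assumes [measurable]: "H \<in> borel_measurable borel" and c: "0 < c" "\<And>x. c * weight lam x \<le> H x"
    and s: "real DIM('a) < lam * s" "0 < s"
  shows "weighted lam (\<lambda>x. H x powr (-s - 1))"
  unfolding weighted_def
proof (intro conjI allI)
  show "integrable lborel (\<lambda>x. H x powr (-s - 1) * weight lam x)"
  proof (rule Bochner_Integration.integrable_bound)
    show "integrable lborel (\<lambda>x::'a. c powr (-s - 1) * weight lam x powr (-s))"
      by (intro integrable_mult_right integrable_weight_powr lam_pos s)
    show "AE x in lborel. norm (H x powr (-s - 1) * weight lam x) \<le> norm (c powr (-s - 1) * weight lam x powr (-s))"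
    proof (intro AE_I2)
      fix x
      have "H x powr (-s - 1) \<le> (c * weight lam x) powr (-s - 1)"
        by (intro powr_mono2') (use c s weight_pos[of lam x] in auto)
      also have "\<dots> = c powr (-s - 1) * weight lam x powr (-s - 1)"
        using c weight_pos[of lam x] by (simp add: powr_mult)
      finally have "H x powr (-s - 1) * weight lam x \<le> c powr (-s - 1) * weight lam x powr (-s - 1) * weight lam x"
        using weight_pos[of lam x] by (intro mult_right_mono) auto
      also have "\<dots> = c powr (-s - 1) * weight lam x powr (-s)"
        using weight_pos[of lam x] by (simp add: powr_diff)
      finally show "norm (H x powr (-s - 1) * weight lam x) \<le> norm (c powr (-s - 1) * weight lam x powr (-s))"
        using weight_pos[of lam x] by (simp add: abs_mult)
    qed
  qed measurable
qed auto

text \<open>By the equality case of the reverse Hoelder inequality this is, among all unit densities, the one with the smallest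
pairing with \<open>H\<close>.\<close>

lemma unit_density_powr:
  fixes H :: "'a \<Rightarrow> real"
  assumes [measurable]: "H \<in> borel_measurable borel" and c: "0 < c" "\<And>x. c * weight lam x \<le> H x"
  shows "unit_density (\<lambda>x. (\<integral>x. H x powr (-a) \<partial>lborel) powr (- 1 / p) * H x powr (-a - 1))"
proof -
  define D where "D = (\<integral>x. H x powr (-a) \<partial>lborel)"
  have H: "0 < H x" for x using c mult_pos_pos[OF c(1) weight_pos[of lam x]] by (metis less_le_trans)
  note int = integrable_powr_if_ge_weight(1)[OF lam_pos dim_less(1) assms]
  have D: "0 < D" unfolding D_def by (rule integral_powr_pos[OF H int])
  have eq: "(D powr (- 1 / p) * H x powr (-a - 1)) powr p = 1 / D * H x powr (-a)" for x
  proof -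
    have "(-a - 1) * p = -a" using exponents(1) by (simp add: algebra_simps)
    then have "(H x powr (-a - 1)) powr p = H x powr (-a)" by (simp only: powr_powr)
    moreover have "(D powr (- 1 / p)) powr p = 1 / D"
      unfolding powr_powr using p D by (simp add: powr_minus_divide)
    ultimately show ?thesis by (simp add: powr_mult)
  qed
  have w: "weighted lam (\<lambda>x. H x powr (-a - 1))"
    by (rule weighted_powr[OF assms dim_less(1) ab_pos(1)])
  have "weighted lam (\<lambda>x. D powr (- 1 / p) * H x powr (-a - 1))"
    using w unfolding weighted_def by (auto simp: mult.assoc)
  then show ?thesis
    unfolding unit_density_def D_def[symmetric] eq using int D by (simp add: D_def[symmetric])
qed

lemma unit_density_exists: "\<exists>f. unit_density f"
  using unit_density_powr[of "weight lam" 1] measurable_weight by auto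

lemma dual_powr:
  fixes F :: "'a \<Rightarrow> real"
  assumes m: "F \<in> borel_measurable borel" and c: "0 < c" "\<And>x. c * weight lam x \<le> F x"
  shows "weighted lam (\<lambda>x. F x powr (-b - 1))"
    and "integrable lborel (\<lambda>x. (F x powr (-b - 1)) powr r)"
    and "(\<integral>x. (F x powr (-b - 1)) powr r \<partial>lborel) = (\<integral>x. F x powr (-b) \<partial>lborel)"
    and "0 < (\<integral>x. F x powr (-b) \<partial>lborel)"
    and "0 < (\<integral>x. F x powr (-b - 1) \<partial>lborel)"
proof -
  have F: "0 < F x" for x using c mult_pos_pos[OF c(1) weight_pos[of lam x]] by (metis less_le_trans)
  note int = integrable_powr_if_ge_weight(1)[OF lam_pos dim_less(2) assms]
  show w: "weighted lam (\<lambda>x. F x powr (-b - 1))"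
    by (rule weighted_powr[OF assms dim_less(2) ab_pos(2)])
  have "(-b - 1) * r = -b" using exponents(2) by (simp add: algebra_simps)
  then have eq: "(F x powr (-b - 1)) powr r = F x powr (-b)" for x by (simp only: powr_powr)
  show "integrable lborel (\<lambda>x. (F x powr (-b - 1)) powr r)"
    and "(\<integral>x. (F x powr (-b - 1)) powr r \<partial>lborel) = (\<integral>x. F x powr (-b) \<partial>lborel)"
    unfolding eq using int by auto
  show "0 < (\<integral>x. F x powr (-b) \<partial>lborel)" by (rule integral_powr_pos[OF F int])
  show "0 < (\<integral>x. F x powr (-b - 1) \<partial>lborel)"
    by (rule integral_powr_pos[OF F weighted_integrable[OF lam_pos w]])
qed

text \<open>The energy as a dual norm: a lower bound for the pairing of \<open>g\<close> with the potential of \<open>f\<close>.\<close>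

lemma energy_duality:
  assumes f: "unit_density f" and g: "weighted lam g"
    and gr: "0 < (\<integral>x. g x powr r \<partial>lborel)"
  shows "(\<integral>x. g x powr r \<partial>lborel) \<le> (\<integral>x. g x * pot lam f x \<partial>lborel) powr r * energy f powr (1 - r)"
    and "0 < (\<integral>x. g x * pot lam f x \<partial>lborel)"
proof -
  note fD = unit_densityD[OF f]
  have int: "integrable lborel (\<lambda>x. g x * pot lam f x)" by (rule weighted_mult_pot(1)[OF lam_pos g fD(1)])
  show pos: "0 < (\<integral>x. g x * pot lam f x \<partial>lborel)"
  proof (rule ccontr)
    assume "\<not> ?thesis"
    then have "(\<integral>x. g x * pot lam f x \<partial>lborel) = 0" using weighted_mult_pot(3)[OF lam_pos g fD(1)] by simp
    then have "AE x in lborel. g x * pot lam f x = 0"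
      by (subst (asm) integral_nonneg_eq_0_iff_AE)
        (auto intro!: int AE_I2 mult_nonneg_nonneg weighted_nonneg[OF g] pot_nonneg lam_pos fD)
    then have "AE x in lborel. g x powr r = 0"
    proof eventually_elim
      case (elim x)
      then show ?case using pot_pos[OF fD(1,4), of x] by simp
    qed
    then have "(\<integral>x. g x powr r \<partial>lborel) = 0" by (rule integral_eq_zero_AE)
    then show False using gr by simp
  qed
  show "(\<integral>x. g x powr r \<partial>lborel) \<le> (\<integral>x. g x * pot lam f x \<partial>lborel) powr r * energy f powr (1 - r)"
    unfolding energy_def
    by (rule reverse_Hoelder(2)[OF r b])
      (use weighted_measurable[OF g] in \<open>auto intro!: weighted_nonneg[OF g] pot_pos[OF fD(1,4)] int pos
        integrable_pot_powr[OF fD(1,4)] integral_pot_powr_pos[OF fD(1,4)] dim_less\<close>)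
qed

text \<open>Given \<open>g\<close>, the best response to it is the normalized power \<open>-a - 1\<close> of its potential. Its pairing with \<open>g\<close> is
\<open>D powr (- 1 / a)\<close>, and \<open>energy_duality\<close> turns this into a lower bound for its energy. The condition on \<open>S\<close> and \<open>D\<close>
is the one that \<open>dual_step\<close> provides, and it survives passage to the limit because it involves integrals of
potentials only.\<close>

lemma improve:
  fixes g :: "'a \<Rightarrow> real"
  assumes g: "weighted lam g" and S: "0 < (\<integral>x. g x powr r \<partial>lborel)" (is "0 < ?S")
  defines "D \<equiv> \<integral>x. pot lam g x powr (-a) \<partial>lborel"
  obtains f where "unit_density f"
    "1 \<le> ?S powr p * D powr (1 - p) \<Longrightarrow> ?S \<le> energy f"
    "1 < ?S powr p * D powr (1 - p) \<Longrightarrow> ?S < energy f"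
proof -
  have mass: "0 < (\<integral>x. g x \<partial>lborel)" by (rule mass_pos_if_powr_integral_pos[OF lam_pos g r(1) S])
  note m = measurable_pot[OF lam_pos g]
  obtain c where c: "0 < c" "\<And>x. c * weight lam x \<le> pot lam g x"
    using pot_ge_weight[OF lam_pos g mass] by blast
  define f where "f x = D powr (- 1 / p) * pot lam g x powr (-a - 1)" for x
  have f: "unit_density f" unfolding f_def[abs_def] D_def by (rule unit_density_powr[OF m c])
  have D: "0 < D" unfolding D_def by (rule integral_pot_powr_pos[OF g mass dim_less(1)])
  have "(\<integral>x. g x * pot lam f x \<partial>lborel) = (\<integral>x. f x * pot lam g x \<partial>lborel)"
    by (rule integral_mult_pot_commute[OF lam_pos g unit_densityD(1)[OF f]])
  also have "\<dots> = (\<integral>x. D powr (- 1 / p) * pot lam g x powr (-a) \<partial>lborel)"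
    using pot_pos[OF g mass] by (intro Bochner_Integration.integral_cong) (auto simp: f_def powr_diff less_imp_neq[symmetric] abs_of_pos)
  also have "\<dots> = D powr (- 1 / p) * D powr 1" using D by (simp add: D_def)
  also have "\<dots> = D powr (1 - 1 / p)" by (simp only: powr_add[symmetric]) simp
  also have "1 - 1 / p = - 1 / a" by (rule exponents)
  finally have pairing: "(\<integral>x. g x * pot lam f x \<partial>lborel) = D powr (- 1 / a)" .
  have E: "0 < energy f" by (rule energy_pos[OF f])
  have "?S \<le> (D powr (- 1 / a)) powr r * energy f powr (1 - r)"
    using energy_duality(1)[OF f g S] unfolding pairing .
  then have "?S * (D powr (1 / a)) powr r \<le> (D powr (- 1 / a)) powr r * energy f powr (1 - r) * (D powr (1 / a)) powr r"
    by (rule mult_right_mono) simp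
  also have "\<dots> = energy f powr (1 - r)"
  proof -
    have "(D powr (- 1 / a)) powr r * (D powr (1 / a)) powr r = 1"
      unfolding powr_powr powr_add[symmetric] using D by simp
    then show ?thesis by (simp add: mult_ac)
  qed
  finally have low: "?S * (D powr (1 / a)) powr r \<le> energy f powr (1 - r)" .
  have root: "(?S powr p * D powr (1 - p)) powr (1 / p) = ?S * D powr (1 / a)"
    using p S D by (simp add: powr_mult powr_powr a)
  have prod: "?S * (D powr (1 / a)) powr r = ?S powr (1 - r) * (?S * D powr (1 / a)) powr r"
    using S by (simp add: powr_mult powr_diff)
  show ?thesis
  proof (rule that[OF f])
    assume "1 \<le> ?S powr p * D powr (1 - p)"
    then have "1 \<le> ?S * D powr (1 / a)" unfolding root[symmetric] using p by (intro ge_one_powr_ge_zero) auto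
    then have "1 \<le> (?S * D powr (1 / a)) powr r" using r by (intro ge_one_powr_ge_zero) auto
    then have "?S powr (1 - r) * 1 \<le> ?S powr (1 - r) * (?S * D powr (1 / a)) powr r"
      by (intro mult_left_mono) auto
    then have "?S powr (1 - r) \<le> energy f powr (1 - r)" using low prod by simp
    then show "?S \<le> energy f"
      using powr_less_mono2[of "1 - r" "energy f" ?S] r E by force
  next
    assume "1 < ?S powr p * D powr (1 - p)"
    then have "1 < ?S * D powr (1 / a)" unfolding root[symmetric] using p by (intro gr_one_powr) auto
    then have "1 < (?S * D powr (1 / a)) powr r" using r by (intro gr_one_powr) auto
    then have "?S powr (1 - r) * 1 < ?S powr (1 - r) * (?S * D powr (1 / a)) powr r"
      using S by (intro mult_strict_left_mono) auto
    then have "?S powr (1 - r) < energy f powr (1 - r)" using low prod by simp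
    then show "?S < energy f"
      using powr_mono2[of "1 - r" "energy f" ?S] r E by force
  qed
qed

text \<open>The other half of the alternation: from \<open>f\<close> pass to the best response \<open>g\<close> to its potential. The pairing of the two is
the energy, and the reverse Hoelder inequality for \<open>f\<close> and the potential of \<open>g\<close> does the rest.\<close>

lemma dual_step:
  assumes f: "unit_density f"
  defines "g \<equiv> \<lambda>x. pot lam f x powr (-b - 1)"
  defines "D \<equiv> \<integral>x. pot lam g x powr (-a) \<partial>lborel"
  shows "(\<integral>x. f x * pot lam g x \<partial>lborel) = energy f"
    and "1 \<le> energy f powr p * D powr (1 - p)"
    and "1 = energy f powr p * D powr (1 - p) \<Longrightarrow>
      AE x in lborel. f x = energy f / D * pot lam g x powr (-a - 1)"
proof -
  note fD = unit_densityD[OF f]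
  obtain c where c: "0 < c" "\<And>x. c * weight lam x \<le> pot lam f x"
    using pot_ge_weight[OF lam_pos fD(1,4)] by blast
  note dual = dual_powr[OF measurable_pot[OF lam_pos fD(1)] c, folded g_def]
  have g_mass: "0 < (\<integral>x. g x \<partial>lborel)" using dual(5) by (simp add: g_def)
  have "(\<integral>x. f x * pot lam g x \<partial>lborel) = (\<integral>x. g x * pot lam f x \<partial>lborel)"
    by (rule integral_mult_pot_commute[OF lam_pos fD(1) dual(1)])
  also have "\<dots> = energy f"
    unfolding energy_def g_def using pot_pos[OF fD(1,4)]
    by (intro Bochner_Integration.integral_cong) (auto simp: powr_diff less_imp_neq[symmetric] abs_of_pos)
  finally show pairing: "(\<integral>x. f x * pot lam g x \<partial>lborel) = energy f" .
  note RH = reverse_Hoelder[OF p a, of f lborel "pot lam g"]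
  have prems: "f \<in> borel_measurable lborel" "\<And>x. 0 \<le> f x" "\<And>x. 0 < pot lam g x"
    "integrable lborel (\<lambda>x. f x * pot lam g x)" "integrable lborel (\<lambda>x. pot lam g x powr (-a))"
    "0 < (\<integral>x. f x * pot lam g x \<partial>lborel)" "0 < (\<integral>x. pot lam g x powr (-a) \<partial>lborel)"
    using weighted_measurable[OF fD(1)] weighted_nonneg[OF fD(1)] pot_pos[OF dual(1) g_mass]
      weighted_mult_pot(1)[OF lam_pos fD(1) dual(1)] integrable_pot_powr[OF dual(1) g_mass dim_less(1)]
      integral_pot_powr_pos[OF dual(1) g_mass dim_less(1)] energy_pos[OF f] pairing by auto
  show "1 \<le> energy f powr p * D powr (1 - p)"
    using RH(2)[OF prems] unfolding fD(3) pairing D_def .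
  assume "1 = energy f powr p * D powr (1 - p)"
  then show "AE x in lborel. f x = energy f / D * pot lam g x powr (-a - 1)"
    using RH(3)[OF prems] unfolding fD(3) pairing D_def by simp
qed

lemma normalized_density:
  assumes "unit_density f"
  obtains g where "unit_density g" "pot lam g 0 = 1" "\<And>x. 1 \<le> pot lam g x" "energy g = energy f"
  using normalize[OF lam_pos p(1) ab_pos(2) exponents(4) unit_densityD(1-3)[OF assms]]
  unfolding unit_density_def energy_def by metis

lemma unit_density_pot_lower_bound:
  obtains c where "0 < c"
    "\<And>f x. unit_density f \<Longrightarrow> pot lam f 0 = 1 \<Longrightarrow> (\<And>x. 1 \<le> pot lam f x) \<Longrightarrow> c * weight lam x \<le> pot lam f x"
proof (rule normalized_pot_lower_bound[OF lam_pos p a dim_less(1)])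
  fix c
  assume "0 < c" and c: "\<And>f x. weighted lam f \<Longrightarrow> integrable lborel (\<lambda>x. f x powr p) \<Longrightarrow> (\<integral>x. f x powr p \<partial>lborel) = 1
      \<Longrightarrow> pot lam f 0 = 1 \<Longrightarrow> (\<And>x. 1 \<le> pot lam f x) \<Longrightarrow> c * weight lam (x::'a) \<le> pot lam f x"
  show ?thesis by (rule that[OF \<open>0 < c\<close> c]) (auto simp: unit_density_def)
qed

text \<open>This is the reverse Hardy-Littlewood-Sobolev inequality: after normalization the potential lies above a fixed
multiple of the weight.\<close>

lemma energy_bounded: "\<exists>B. \<forall>f. unit_density f \<longrightarrow> energy f \<le> B"
proof -
  obtain c where c: "0 < c"
    "\<And>f x. unit_density f \<Longrightarrow> pot lam f 0 = 1 \<Longrightarrow> (\<And>x. 1 \<le> pot lam f x) \<Longrightarrow> c * weight lam x \<le> pot lam f x"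
    using unit_density_pot_lower_bound by blast
  have "energy f \<le> (\<integral>x. c powr (-b) * weight lam (x::'a) powr (-b) \<partial>lborel)" if f: "unit_density f" for f
  proof -
    obtain g where g: "unit_density g" "pot lam g 0 = 1" "\<And>x. 1 \<le> pot lam g x" "energy g = energy f"
      using normalized_density[OF f] by blast
    note gD = unit_densityD[OF g(1)]
    have low: "c * weight lam x \<le> pot lam g x" for x by (rule c(2)[OF g(1-3)])
    note F = integrable_powr_if_ge_weight[OF lam_pos dim_less(2) measurable_pot[OF lam_pos gD(1)] c(1) low]
    show ?thesis
      unfolding g(4)[symmetric] unfolding energy_def
      by (rule integral_mono[OF F(1) integrable_mult_right[OF integrable_weight_powr[OF lam_pos dim_less(2)]] F(2)])
  qed
  then show ?thesis by blast
qed

lemma tendsto_powr_neg_integral: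
  fixes F :: "nat \<Rightarrow> 'a \<Rightarrow> real"
  assumes s: "real DIM('a) < lam * s" and m: "\<And>n. F n \<in> borel_measurable borel"
    and c: "0 < c" "\<And>n x. c * weight lam x \<le> F n x" and lim: "\<And>x. (\<lambda>n. F n x) \<longlonglongrightarrow> G x"
  shows "(\<lambda>n. \<integral>x. F n x powr (-s) \<partial>lborel) \<longlonglongrightarrow> (\<integral>x. G x powr (-s) \<partial>lborel)"
proof (rule integral_dominated_convergence)
  note [measurable] = m
  have [measurable]: "G \<in> borel_measurable borel" by (rule borel_measurable_LIMSEQ_real[OF lim m])
  show "(\<lambda>x. G x powr (-s)) \<in> borel_measurable lborel" "\<And>n. (\<lambda>x. F n x powr (-s)) \<in> borel_measurable lborel"
    by measurable
  show "integrable lborel (\<lambda>x::'a. c powr (-s) * weight lam x powr (-s))"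
    by (intro integrable_mult_right integrable_weight_powr lam_pos s)
  show "AE x in lborel. norm (F n x powr (-s)) \<le> c powr (-s) * weight lam x powr (-s)" for n
    using integrable_powr_if_ge_weight(2)[OF lam_pos s m[of n] c(1) c(2)[of _ n]] by (intro AE_I2) simp
  have "0 < G x" for x
  proof -
    have "c * weight lam x \<le> G x" by (rule LIMSEQ_le_const[OF lim]) (use c in auto)
    then show ?thesis using mult_pos_pos[OF c(1) weight_pos[of lam x]] by linarith
  qed
  then show "AE x in lborel. (\<lambda>n. F n x powr (-s)) \<longlonglongrightarrow> G x powr (-s)"
    by (intro AE_I2 tendsto_powr lim tendsto_const) (simp add: less_imp_neq[symmetric])
qed

text \<open>A maximizing sequence \<open>f n\<close> is normalized; its potentials then lie between two fixed multiples of the weight and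
converge pointwise along a subsequence. The densities themselves may fail to converge, but the dual densities
\<open>g n\<close>, being powers of the potentials, converge and are dominated, and so do their potentials. In the limit
\<open>improve\<close> turns the dual density into a unit density of at least the supremal energy.\<close>

lemma energy_maximum_attained: "\<exists>f. unit_density f \<and> (\<forall>f'. unit_density f' \<longrightarrow> energy f' \<le> energy f)"
proof -
  define T where "T = energy ` {f. unit_density f}"
  define S where "S = Sup T"
  have bdd: "bdd_above T" using energy_bounded by (auto simp: T_def bdd_above_def)
  have upper: "energy f \<le> S" if "unit_density f" for f
    unfolding S_def by (rule cSup_upper[OF _ bdd]) (use that in \<open>simp add: T_def\<close>)
  obtain f0 where f0: "unit_density f0" using unit_density_exists by blast
  have S: "0 < S" using upper[OF f0] energy_pos[OF f0] by linarith
  have "\<exists>f. unit_density f \<and> pot lam f 0 = 1 \<and> (\<forall>x. 1 \<le> pot lam f x) \<and> S / 2 \<le> energy f \<and> S - 1 / real (Suc n) \<le> energy f" for n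
  proof -
    have "max (S / 2) (S - 1 / real (Suc n)) < S" using S by simp
    then have "max (S / 2) (S - 1 / real (Suc n)) < Sup T" by (simp add: S_def)
    then obtain t where t: "t \<in> T" "max (S / 2) (S - 1 / real (Suc n)) < t"
      using less_cSupD[of T] f0 unfolding T_def by blast
    then obtain f where f: "unit_density f" "max (S / 2) (S - 1 / real (Suc n)) < energy f" by (auto simp: T_def)
    obtain g where g: "unit_density g" "pot lam g 0 = 1" "\<And>x. 1 \<le> pot lam g x" "energy g = energy f"
      using normalized_density[OF f(1)] by blast
    then show ?thesis using f(2) by (intro exI[of _ g]) auto
  qed
  then obtain f where f: "\<And>n. unit_density (f n)" "\<And>n. pot lam (f n) 0 = 1" "\<And>n x. 1 \<le> pot lam (f n) x"
    "\<And>n. S / 2 \<le> energy (f n)" "\<And>n. S - 1 / real (Suc n) \<le> energy (f n)" by metis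
  note fw = unit_densityD(1)[OF f(1)]
  have energy_lim: "(\<lambda>n. energy (f n)) \<longlonglongrightarrow> S"
  proof (rule real_tendsto_sandwich)
    show "(\<lambda>n. S - 1 / real (Suc n)) \<longlonglongrightarrow> S"
      using tendsto_diff[OF tendsto_const[of S] LIMSEQ_inverse_real_of_nat] by (simp add: inverse_eq_divide)
  qed (use f(5) upper[OF f(1)] in auto)
  obtain c where c: "0 < c"
    "\<And>f x. unit_density f \<Longrightarrow> pot lam f 0 = 1 \<Longrightarrow> (\<And>x. 1 \<le> pot lam f x) \<Longrightarrow> c * weight lam x \<le> pot lam f x"
    using unit_density_pot_lower_bound by blast
  have low: "c * weight lam x \<le> pot lam (f n) x" for n x
    by (rule c(2)[OF f(1-3)])
  have "0 < S / 2" using S by simp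
  then obtain K where K: "\<And>f. weighted lam f \<Longrightarrow> pot lam f 0 = 1 \<Longrightarrow> (\<And>x::'a. c * weight lam x \<le> pot lam f x)
       \<Longrightarrow> S / 2 \<le> (\<integral>x. pot lam f x powr (-b) \<partial>lborel) \<Longrightarrow> (\<integral>x. f x \<partial>lborel) \<le> K"
    using normalized_mass_upper_bound[OF lam_pos ab_pos(2) dim_less(2) c(1)] by blast
  have mass: "(\<integral>x. f n x \<partial>lborel) \<le> K" for n
    by (rule K[OF fw f(2) low]) (use f(4) in \<open>simp add: energy_def\<close>)
  have W: "(\<integral>y. f n y * weight lam y \<partial>lborel) \<le> K + 1" for n
  proof -
    have "(\<integral>y. f n y * weight lam y \<partial>lborel) = (\<integral>y. f n y + f n y * norm (0 - y) powr lam \<partial>lborel)"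
      by (simp add: weight_def algebra_simps)
    also have "\<dots> = (\<integral>y. f n y \<partial>lborel) + pot lam (f n) 0"
      unfolding pot_def
      by (rule Bochner_Integration.integral_add[OF weighted_integrable[OF lam_pos fw] weighted_integrable_kernel[OF lam_pos fw]])
    finally show ?thesis using mass[of n] f(2)[of n] by simp
  qed
  obtain k F where k: "strict_mono (k :: nat \<Rightarrow> nat)" and F: "\<And>x. (\<lambda>n. pot lam (f (k n)) x) \<longlonglongrightarrow> F x"
    by (rule pot_convergent_subsequence[OF lam_pos fw W]) (rule that)
  define C where "C = 2 powr lam * (K + 1)"
  have up: "pot lam (f n) x \<le> C * weight lam x" for n x
    unfolding C_def
    by (rule order_trans[OF pot_le_weight[OF lam_pos fw]])
      (intro mult_right_mono mult_left_mono W less_imp_le[OF weight_pos], simp)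
  have C: "0 < C"
  proof -
    have "0 < c * weight lam (0::'a)" using c(1) weight_pos by (rule mult_pos_pos)
    also have "\<dots> \<le> C * weight lam (0::'a)" using low up by (rule order_trans)
    finally show ?thesis using weight_pos[of lam "0::'a"] by (simp add: zero_less_mult_iff)
  qed
  have Fm: "F \<in> borel_measurable borel"
    by (rule borel_measurable_LIMSEQ_real[OF F measurable_pot[OF lam_pos fw]])
  have Flow: "c * weight lam x \<le> F x" for x by (rule LIMSEQ_le_const[OF F]) (use low in auto)
  have FS: "(\<integral>x. F x powr (-b) \<partial>lborel) = S"
  proof (rule LIMSEQ_unique)
    show "(\<lambda>n. energy (f (k n))) \<longlonglongrightarrow> S" using LIMSEQ_subseq_LIMSEQ[OF energy_lim k] by (simp add: o_def)
    show "(\<lambda>n. energy (f (k n))) \<longlonglongrightarrow> (\<integral>x. F x powr (-b) \<partial>lborel)"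
      unfolding energy_def
      by (rule tendsto_powr_neg_integral[OF dim_less(2) measurable_pot[OF lam_pos fw] c(1) low F])
  qed
  define g where "g n = (\<lambda>x. pot lam (f (k n)) x powr (-b - 1))" for n
  define h where "h = (\<lambda>x. F x powr (-b - 1))"
  have gD: "weighted lam (g n)" for n
    unfolding g_def by (rule dual_powr(1)[OF measurable_pot[OF lam_pos fw] c(1) low])
  note hD = dual_powr[OF Fm c(1) Flow, folded h_def]
  have g_lim: "(\<lambda>n. g n x) \<longlonglongrightarrow> h x" for x
  proof -
    have "0 < F x" using Flow[of x] mult_pos_pos[OF c(1) weight_pos[of lam x]] by linarith
    then show ?thesis unfolding g_def h_def by (intro tendsto_powr F tendsto_const) simp
  qed
  (* A common lower bound l for the dual densities keeps their potentials above a multiple of the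
     weight, and a common upper bound u dominates them. *)
  define l where "l x = (C * weight lam x) powr (-b - 1)" for x :: 'a
  have l: "weighted lam l"
    unfolding l_def[abs_def]
    by (rule weighted_powr[OF _ C _ dim_less(2) ab_pos(2)]) (auto intro!: borel_measurable_times)
  have l_mass: "0 < (\<integral>x. l x \<partial>lborel)"
    unfolding l_def
  proof (rule integral_powr_pos)
    show "0 < C * weight lam x" for x :: 'a by (rule mult_pos_pos[OF C weight_pos])
    show "integrable lborel (\<lambda>x::'a. (C * weight lam x) powr (-b - 1))"
      using weighted_integrable[OF lam_pos l] unfolding l_def[abs_def] .
  qed
  have l_le: "l x \<le> g n x" for n x
    unfolding l_def g_def
    by (rule powr_mono2') (use up low ab_pos mult_pos_pos[OF c(1) weight_pos[of lam x]] in \<open>auto intro: less_le_trans\<close>)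
  obtain c1 where c1: "0 < c1" "\<And>x. c1 * weight lam x \<le> pot lam l x"
    using pot_ge_weight[OF lam_pos l l_mass] by blast
  have G_low: "c1 * weight lam x \<le> pot lam (g n) x" for n x
    using c1(2) pot_mono[OF lam_pos l gD l_le] by (rule order_trans)
  define u where "u x = (c * weight lam x) powr (-b - 1)" for x :: 'a
  have u: "weighted lam u"
    unfolding u_def[abs_def]
    by (rule weighted_powr[OF _ c(1) _ dim_less(2) ab_pos(2)]) (auto intro!: borel_measurable_times)
  have g_le: "g n x \<le> u x" for n x
    unfolding u_def g_def
    by (rule powr_mono2') (use low ab_pos mult_pos_pos[OF c(1) weight_pos[of lam x]] in auto)
  have G_lim: "(\<lambda>n. pot lam (g n) x) \<longlonglongrightarrow> pot lam h x" for x
    unfolding pot_def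
  proof (rule integral_dominated_convergence)
    note [measurable] = weighted_measurable[OF hD(1)] weighted_measurable[OF gD]
    show "(\<lambda>y. h y * norm (x - y) powr lam) \<in> borel_measurable lborel"
      "\<And>n. (\<lambda>y. g n y * norm (x - y) powr lam) \<in> borel_measurable lborel" by measurable
    show "integrable lborel (\<lambda>y. u y * norm (x - y) powr lam)" by (rule weighted_integrable_kernel[OF lam_pos u])
    show "AE y in lborel. (\<lambda>n. g n y * norm (x - y) powr lam) \<longlonglongrightarrow> h y * norm (x - y) powr lam"
      by (intro AE_I2 tendsto_mult g_lim tendsto_const)
    show "AE y in lborel. norm (g n y * norm (x - y) powr lam) \<le> u y * norm (x - y) powr lam" for n
      using g_le weighted_nonneg[OF gD] by (intro AE_I2) (auto simp: abs_mult intro!: mult_right_mono)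
  qed
  define D where "D n = (\<integral>x. pot lam (g n) x powr (-a) \<partial>lborel)" for n
  define D' where "D' = (\<integral>x. pot lam h x powr (-a) \<partial>lborel)"
  have D_lim: "D \<longlonglongrightarrow> D'"
    unfolding D_def[abs_def] D'_def
    by (rule tendsto_powr_neg_integral[OF dim_less(1) measurable_pot[OF lam_pos gD] c1(1) G_low G_lim])
  have h_mass: "0 < (\<integral>x. h x \<partial>lborel)" using hD(5) by (simp add: h_def)
  have D': "0 < D'" unfolding D'_def by (rule integral_pot_powr_pos[OF hD(1) h_mass dim_less(1)])
  have "(\<lambda>n. energy (f (k n)) powr p * D n powr (1 - p)) \<longlonglongrightarrow> S powr p * D' powr (1 - p)"
    using LIMSEQ_subseq_LIMSEQ[OF energy_lim k] D_lim S D' by (intro tendsto_intros) (auto simp: o_def)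
  then have "1 \<le> S powr p * D' powr (1 - p)"
    by (rule LIMSEQ_le_const) (use dual_step(2)[OF f(1)] in \<open>auto simp: D_def g_def\<close>)
  moreover have hS: "(\<integral>x. h x powr r \<partial>lborel) = S" using hD(3) FS by (simp add: h_def)
  ultimately obtain f' where "unit_density f'" "S \<le> energy f'"
    using improve[OF hD(1)] S unfolding D'_def by metis
  then show ?thesis using upper by (intro exI[of _ f']) force
qed

text \<open>A maximizer leaves no room for \<open>improve\<close>, so equality holds in the reverse Hoelder inequality of \<open>dual_step\<close>.\<close>

lemma maximizer_Euler_Lagrange:
  assumes f: "unit_density f" and max: "\<And>f'. unit_density f' \<Longrightarrow> energy f' \<le> energy f"
  defines "g \<equiv> \<lambda>x. pot lam f x powr (-b - 1)"
  obtains k where "0 < k" "AE x in lborel. f x = k * pot lam g x powr (-a - 1)"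
proof -
  define D where "D = (\<integral>x. pot lam g x powr (-a) \<partial>lborel)"
  note fD = unit_densityD[OF f]
  obtain c where c: "0 < c" "\<And>x. c * weight lam x \<le> pot lam f x"
    using pot_ge_weight[OF lam_pos fD(1,4)] by blast
  note dual = dual_powr[OF measurable_pot[OF lam_pos fD(1)] c, folded g_def]
  have gr: "(\<integral>x. g x powr r \<partial>lborel) = energy f" using dual(3) by (simp add: energy_def g_def)
  have g_mass: "0 < (\<integral>x. g x \<partial>lborel)" using dual(5) by (simp add: g_def)
  note E = energy_pos[OF f]
  have "\<not> 1 < energy f powr p * D powr (1 - p)"
  proof
    assume "1 < energy f powr p * D powr (1 - p)"
    then obtain f' where "unit_density f'" "energy f < energy f'"
      using improve[OF dual(1)] E unfolding gr D_def by metis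
    then show False using max[of f'] by simp
  qed
  then have "1 = energy f powr p * D powr (1 - p)"
    using dual_step(2)[OF f] by (simp add: D_def g_def)
  then have "AE x in lborel. f x = energy f / D * pot lam g x powr (-a - 1)"
    using dual_step(3)[OF f] by (simp add: D_def g_def)
  moreover have "0 < D" unfolding D_def by (rule integral_pot_powr_pos[OF dual(1) g_mass dim_less(1)])
  ultimately show ?thesis using E by (intro that[of "energy f / D"]) auto
qed

end

section \<open>Reflections and polarization\<close>

definition reflect :: "'a::euclidean_space \<Rightarrow> real \<Rightarrow> 'a \<Rightarrow> 'a" where
  "reflect e t x = x - (2 * (x \<bullet> e - t)) *\<^sub>R e"

lemma continuous_on_reflect [continuous_intros]:
  "continuous_on A f \<Longrightarrow> continuous_on A (\<lambda>x. reflect e t (f x))"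
  unfolding reflect_def by (intro continuous_intros)

lemma measurable_reflect [measurable]: "reflect e t \<in> borel_measurable borel"
  using continuous_on_reflect[OF continuous_on_id, of UNIV e t] by (rule borel_measurable_continuous_onI)

lemma reflect_minus: "reflect (- e) (- t) = reflect e t"
  by (rule ext) (simp add: reflect_def algebra_simps)

context
  fixes e :: "'a::euclidean_space" and t :: real
  assumes e: "norm e = 1"
begin

lemma inner_reflect: "reflect e t x \<bullet> e - t = - (x \<bullet> e - t)"
proof -
  have "e \<bullet> e = 1" using e by (simp add: dot_square_norm)
  then show ?thesis by (simp add: reflect_def inner_diff_left)
qed

lemma reflect_reflect [simp]: "reflect e t (reflect e t x) = x"
proof -
  have "reflect e t (reflect e t x) = reflect e t x + (2 * (x \<bullet> e - t)) *\<^sub>R e"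
    unfolding reflect_def[of e t "reflect e t x"] inner_reflect
    by (simp only: mult_minus_right scaleR_minus_left diff_minus_eq_add)
  then show ?thesis by (simp add: reflect_def)
qed

text \<open>The sign of the product tells whether \<open>x\<close> and \<open>y\<close> lie on the same side of the hyperplane; reflecting one of them
moves them apart exactly if they do.\<close>

lemma norm_reflect_diff_square:
  "(norm (reflect e t x - y))\<^sup>2 = (norm (x - y))\<^sup>2 + 4 * ((x \<bullet> e - t) * (y \<bullet> e - t))"
proof -
  have ee: "e \<bullet> e = 1" using e by (simp add: dot_square_norm)
  have sq: "(norm (v - c *\<^sub>R e))\<^sup>2 = (norm v)\<^sup>2 - 2 * c * (v \<bullet> e) + c\<^sup>2" for v c
    unfolding power2_norm_eq_inner
    using ee by (simp add: inner_diff_left inner_diff_right inner_commute power2_eq_square algebra_simps)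
  have "reflect e t x - y = (x - y) - (2 * (x \<bullet> e - t)) *\<^sub>R e" by (simp add: reflect_def)
  then show ?thesis by (simp only: sq) (simp add: inner_diff_left power2_eq_square algebra_simps)
qed

lemma norm_reflect_reflect: "norm (reflect e t x - reflect e t y) = norm (x - y)"
proof -
  have "(norm (reflect e t x - reflect e t y))\<^sup>2
      = (norm (x - reflect e t y))\<^sup>2 - 4 * ((x \<bullet> e - t) * (y \<bullet> e - t))"
    unfolding norm_reflect_diff_square[of x "reflect e t y"] inner_reflect by (simp add: algebra_simps)
  also have "(norm (x - reflect e t y))\<^sup>2 = (norm (y - x))\<^sup>2 + 4 * ((y \<bullet> e - t) * (x \<bullet> e - t))"
    by (subst norm_minus_commute) (rule norm_reflect_diff_square)
  finally have "(norm (reflect e t x - reflect e t y))\<^sup>2 = (norm (x - y))\<^sup>2"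
    by (simp add: norm_minus_commute)
  then show ?thesis by simp
qed

lemma norm_reflect_commute: "norm (reflect e t x - y) = norm (x - reflect e t y)"
  using norm_reflect_reflect[of x "reflect e t y"] by simp

lemma norm_reflect_le: "norm (x - y) \<le> norm (reflect e t x - y) \<longleftrightarrow> 0 \<le> (x \<bullet> e - t) * (y \<bullet> e - t)"
  and norm_reflect_ge: "norm (reflect e t x - y) \<le> norm (x - y) \<longleftrightarrow> (x \<bullet> e - t) * (y \<bullet> e - t) \<le> 0"
proof -
  define P where "P = (x \<bullet> e - t) * (y \<bullet> e - t)"
  have sq: "(norm (reflect e t x - y))\<^sup>2 = (norm (x - y))\<^sup>2 + 4 * P"
    unfolding P_def by (rule norm_reflect_diff_square)
  show "norm (x - y) \<le> norm (reflect e t x - y) \<longleftrightarrow> 0 \<le> (x \<bullet> e - t) * (y \<bullet> e - t)"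
    using abs_le_square_iff[of "norm (x - y)" "norm (reflect e t x - y)"] unfolding sq P_def[symmetric] by simp
  show "norm (reflect e t x - y) \<le> norm (x - y) \<longleftrightarrow> (x \<bullet> e - t) * (y \<bullet> e - t) \<le> 0"
    using abs_le_square_iff[of "norm (reflect e t x - y)" "norm (x - y)"] unfolding sq P_def[symmetric] by simp
qed

lemma norm_reflect_less: "norm (x - y) < norm (reflect e t x - y) \<longleftrightarrow> 0 < (x \<bullet> e - t) * (y \<bullet> e - t)"
  using norm_reflect_ge[of x y] by linarith

end

lemma reflect_on_hyperplane: "x \<bullet> e = t \<Longrightarrow> reflect e t x = x"
  by (simp add: reflect_def)


text \<open>The reflection in the perpendicular bisector of \<open>x\<close> and \<open>y\<close>.\<close>

lemma reflect_swaps: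
  fixes x y :: "'a::euclidean_space"
  assumes "x \<noteq> y"
  obtains e t where "norm e = 1" "reflect e t x = y"
    "\<And>z. z \<bullet> e < t \<longleftrightarrow> norm (z - x) < norm (z - y)"
proof -
  define d where "d = norm (y - x)"
  have d: "0 < d" using assms by (simp add: d_def)
  define e where "e = (1 / d) *\<^sub>R (y - x)"
  define t where "t = ((1/2) *\<^sub>R (x + y)) \<bullet> e"
  have e: "norm e = 1" using d by (simp add: e_def d_def)
  have ee: "e \<bullet> e = 1" using e by (simp add: dot_square_norm)
  have y: "y = x + d *\<^sub>R e" using d by (simp add: e_def)
  have te: "t = x \<bullet> e + d / 2"
    unfolding t_def using ee by (simp add: y inner_add_left algebra_simps)
  have r: "reflect e t x = y" unfolding reflect_def te using y by simp
  have "z \<bullet> e < t \<longleftrightarrow> norm (z - x) < norm (z - y)" for z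
  proof -
    have "norm (z - x) < norm (z - y) \<longleftrightarrow> norm (x - z) < norm (reflect e t x - z)"
      by (simp add: r norm_minus_commute)
    also have "\<dots> \<longleftrightarrow> 0 < (x \<bullet> e - t) * (z \<bullet> e - t)" by (rule norm_reflect_less[OF e])
    also have "\<dots> \<longleftrightarrow> 0 < - (d / 2) * (z \<bullet> e - t)" by (simp add: te)
    also have "\<dots> \<longleftrightarrow> z \<bullet> e < t" using d by (simp only: zero_less_mult_iff) auto
    finally show ?thesis by simp
  qed
  then show ?thesis by (rule that[OF e r])
qed

lemma nn_integral_lborel_shift:
  fixes \<phi> :: "'a::euclidean_space \<Rightarrow> ennreal"
  assumes [measurable]: "\<phi> \<in> borel_measurable borel"
  shows "(\<integral>\<^sup>+x. \<phi> (c + x) \<partial>lborel) = (\<integral>\<^sup>+x. \<phi> x \<partial>lborel)"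
  by (subst (2) lborel_distr_plus[of c, symmetric]) (simp add: nn_integral_distr)

text \<open>Uniqueness of Haar measure in a special case: Lebesgue measure and its image under \<open>T\<close> are both translation
invariant and give the unit ball the same mass \<open>\<beta>\<close>. Integrating \<open>B y * \<phi> (T x + y)\<close> in the two orders, with
\<open>B\<close> the indicator of the ball, gives \<open>\<beta>\<close> times either integral.\<close>

lemma nn_integral_lborel_reflect_origin:
  fixes \<phi> :: "'a::euclidean_space \<Rightarrow> ennreal"
  assumes e: "norm e = 1" and \<phi>: "\<phi> \<in> borel_measurable borel"
  shows "(\<integral>\<^sup>+x. \<phi> (reflect e 0 x) \<partial>lborel) = (\<integral>\<^sup>+x. \<phi> x \<partial>lborel)"
proof -
  note [measurable] = \<phi>
  define T where "T = reflect e 0"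
  have TT [simp]: "T (T x) = x" for x by (simp add: T_def e)
  have add: "T (x + y) = T x + T y" for x y by (simp add: T_def reflect_def inner_add_left algebra_simps)
  have dist: "dist y (T x) = dist (T y) x" for x y
    using norm_reflect_commute[OF e, of 0 y x] by (simp add: T_def dist_norm)
  have [measurable]: "T \<in> borel_measurable borel" by (simp add: T_def)
  define B :: "'a \<Rightarrow> ennreal" where "B y = indicator (ball 0 1) y" for y
  have [measurable]: "B \<in> borel_measurable borel" unfolding B_def[abs_def] by (intro borel_measurable_indicator) simp
  define \<beta> where "\<beta> = emeasure lborel (ball (0::'a) 1)"
  have ball: "(\<integral>\<^sup>+x. B (y - T x) \<partial>lborel) = \<beta>" for y
  proof -
    have "B (y - T x) = indicator (ball (T y) 1) x" for x
      using dist[of y x] by (simp add: B_def indicator_def dist_norm norm_minus_commute[of "T x" y])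
    then have "(\<integral>\<^sup>+x. B (y - T x) \<partial>lborel) = emeasure lborel (ball (T y) 1)" by simp
    also have "\<dots> = \<beta>" by (simp add: \<beta>_def emeasure_ball)
    finally show ?thesis .
  qed
  have intB: "(\<integral>\<^sup>+y. B y \<partial>lborel) = \<beta>" unfolding B_def \<beta>_def by simp
  have prod [measurable]: "(\<lambda>(x, y). B y * \<phi> (T x + y)) \<in> borel_measurable lborel2"
    "(\<lambda>(x, y). B (y - T x) * \<phi> y) \<in> borel_measurable lborel2"
    by (auto simp: case_prod_beta')
  have "\<beta> * (\<integral>\<^sup>+x. \<phi> (T x) \<partial>lborel) = (\<integral>\<^sup>+y. B y * (\<integral>\<^sup>+x. \<phi> (T x) \<partial>lborel) \<partial>lborel)"
    using intB by (subst nn_integral_multc) auto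
  also have "\<dots> = (\<integral>\<^sup>+y. \<integral>\<^sup>+x. B y * \<phi> (T x + y) \<partial>lborel \<partial>lborel)"
  proof (rule nn_integral_cong)
    fix y
    have "(\<integral>\<^sup>+x. \<phi> (T x) \<partial>lborel) = (\<integral>\<^sup>+x. \<phi> (T (T y + x)) \<partial>lborel)"
      by (rule nn_integral_lborel_shift[symmetric]) measurable
    also have "\<dots> = (\<integral>\<^sup>+x. \<phi> (T x + y) \<partial>lborel)" by (simp add: add add.commute)
    finally show "B y * (\<integral>\<^sup>+x. \<phi> (T x) \<partial>lborel) = (\<integral>\<^sup>+x. B y * \<phi> (T x + y) \<partial>lborel)"
      by (simp add: nn_integral_cmult)
  qed
  also have "\<dots> = (\<integral>\<^sup>+x. \<integral>\<^sup>+y. B y * \<phi> (T x + y) \<partial>lborel \<partial>lborel)"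
    by (rule lborel_pair.Fubini'[OF prod(1)])
  also have "\<dots> = (\<integral>\<^sup>+x. \<integral>\<^sup>+y. B (y - T x) * \<phi> y \<partial>lborel \<partial>lborel)"
  proof (rule nn_integral_cong)
    fix x
    have "(\<integral>\<^sup>+y. B y * \<phi> (T x + y) \<partial>lborel) = (\<integral>\<^sup>+y. B (T x + y - T x) * \<phi> (T x + y) \<partial>lborel)" by simp
    also have "\<dots> = (\<integral>\<^sup>+y. B (y - T x) * \<phi> y \<partial>lborel)"
      by (rule nn_integral_lborel_shift[of "\<lambda>y. B (y - T x) * \<phi> y"]) measurable
    finally show "(\<integral>\<^sup>+y. B y * \<phi> (T x + y) \<partial>lborel) = (\<integral>\<^sup>+y. B (y - T x) * \<phi> y \<partial>lborel)" .
  qed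
  also have "\<dots> = (\<integral>\<^sup>+y. \<integral>\<^sup>+x. B (y - T x) * \<phi> y \<partial>lborel \<partial>lborel)"
    by (rule lborel_pair.Fubini'[OF prod(2), symmetric])
  also have "\<dots> = \<beta> * (\<integral>\<^sup>+y. \<phi> y \<partial>lborel)"
    by (simp add: nn_integral_multc ball nn_integral_cmult)
  finally have "\<beta> * (\<integral>\<^sup>+x. \<phi> (T x) \<partial>lborel) = \<beta> * (\<integral>\<^sup>+y. \<phi> y \<partial>lborel)" .
  moreover have vol: "unit_ball_vol (real DIM('a)) \<noteq> 0"
    by (metis less_irrefl of_nat_0_le_iff unit_ball_vol_pos)
  moreover have "\<beta> \<noteq> 0" "\<beta> \<noteq> top"
    using vol by (simp_all add: \<beta>_def emeasure_ball)
  ultimately show ?thesis by (simp add: ennreal_mult_cancel_left T_def)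
qed

lemma distr_lborel_reflect:
  fixes e :: "'a::euclidean_space"
  assumes e: "norm e = 1"
  shows "distr lborel borel (reflect e t) = lborel"
proof (rule measure_eqI)
  fix A assume "A \<in> sets (distr lborel borel (reflect e t))"
  then have [measurable]: "A \<in> sets borel" by simp
  have shift: "reflect e t x = (2 * t) *\<^sub>R e + reflect e 0 x" for x
    by (simp add: reflect_def algebra_simps)
  have "emeasure (distr lborel borel (reflect e t)) A = (\<integral>\<^sup>+x. indicator A x \<partial>distr lborel borel (reflect e t))"
    by simp
  also have "\<dots> = (\<integral>\<^sup>+x. indicator A ((2 * t) *\<^sub>R e + reflect e 0 x) \<partial>lborel)"
    by (subst nn_integral_distr) (auto simp: shift)
  also have "\<dots> = (\<integral>\<^sup>+x. indicator A ((2 * t) *\<^sub>R e + x) \<partial>lborel)"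
    by (rule nn_integral_lborel_reflect_origin[OF e, of "\<lambda>x. indicator A ((2 * t) *\<^sub>R e + x)"]) measurable
  also have "\<dots> = (\<integral>\<^sup>+x. indicator A x \<partial>lborel)" by (rule nn_integral_lborel_shift) measurable
  finally show "emeasure (distr lborel borel (reflect e t)) A = emeasure lborel A" by simp
qed simp

text \<open>Two-point symmetrization in the hyperplane, with the half space \<open>x \<bullet> e \<le> t\<close> preferred.\<close>

definition polarize :: "'a::euclidean_space \<Rightarrow> real \<Rightarrow> ('a \<Rightarrow> real) \<Rightarrow> 'a \<Rightarrow> real" where
  "polarize e t f x = (if x \<bullet> e \<le> t then max (f x) (f (reflect e t x)) else min (f x) (f (reflect e t x)))"

lemma continuous_on_polarize:
  fixes f :: "'a::euclidean_space \<Rightarrow> real"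
  assumes f: "continuous_on UNIV f" and e: "norm e = 1"
  shows "continuous_on UNIV (polarize e t f)"
proof -
  have c: "continuous_on A f" for A using f continuous_on_subset by blast
  have c': "continuous_on A (\<lambda>x. f (reflect e t x))" for A
    by (rule continuous_on_compose2[OF f]) (auto intro!: continuous_intros)
  show ?thesis
    unfolding polarize_def[abs_def]
    by (rule continuous_on_cases_le[of UNIV "\<lambda>x. x \<bullet> e"])
      (auto intro!: continuous_intros c c' simp: reflect_on_hyperplane)
qed

text \<open>Two pairs of mirror points interact through two distances, the shorter one with kernel \<open>k\<close>. Putting the large values
on the same side increases the sum that goes with \<open>k\<close> at the expense of the one that goes with \<open>l\<close>, while their total
is unchanged.\<close>

lemma four_point_rearrangement:
  fixes f1 f2 g1 g2 k l :: real
  defines "P \<equiv> max f1 f2 * max g1 g2 + min f1 f2 * min g1 g2"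
    and "Q \<equiv> max f1 f2 * min g1 g2 + min f1 f2 * max g1 g2"
  assumes "k \<le> l"
  shows "k * P + l * Q \<le> k * (f1 * g1 + f2 * g2) + l * (f1 * g2 + f2 * g1)"
    and "k < l \<Longrightarrow> k * P + l * Q = k * (f1 * g1 + f2 * g2) + l * (f1 * g2 + f2 * g1) \<Longrightarrow>
      0 \<le> (f1 - f2) * (g1 - g2)"
proof -
  define P' where "P' = f1 * g1 + f2 * g2"
  define Q' where "Q' = f1 * g2 + f2 * g1"
  have d: "P - P' = max 0 (- ((f1 - f2) * (g1 - g2)))"
  proof (cases "f2 \<le> f1"; cases "g2 \<le> g1")
    assume fg: "f2 \<le> f1" "g2 \<le> g1"
    then have "0 \<le> (f1 - f2) * (g1 - g2)" by (intro mult_nonneg_nonneg) auto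
    then have "max 0 (- ((f1 - f2) * (g1 - g2))) = 0" by (intro max_absorb1) linarith
    then show ?thesis using fg by (simp add: P_def P'_def max_absorb1 min_absorb2)
  next
    assume "f2 \<le> f1" "\<not> g2 \<le> g1"
    then show ?thesis using mult_nonneg_nonneg[of "f1 - f2" "g2 - g1"]
      by (auto simp: P_def P'_def max_def min_def algebra_simps)
  next
    assume "\<not> f2 \<le> f1" "g2 \<le> g1"
    then show ?thesis using mult_nonneg_nonneg[of "f2 - f1" "g1 - g2"]
      by (auto simp: P_def P'_def max_def min_def algebra_simps)
  next
    assume "\<not> f2 \<le> f1" "\<not> g2 \<le> g1"
    then show ?thesis using mult_nonneg_nonneg[of "f2 - f1" "g2 - g1"]
      by (auto simp: P_def P'_def max_def min_def algebra_simps)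
  qed
  have "P + Q = P' + Q'" by (auto simp: P_def Q_def P'_def Q'_def max_def min_def algebra_simps)
  then have Q: "Q = P' + Q' - P" by simp
  have gap: "k * P' + l * Q' - (k * P + l * Q) = (l - k) * (P - P')" unfolding Q by (simp add: algebra_simps)
  have "0 \<le> (l - k) * (P - P')" unfolding d using assms by (intro mult_nonneg_nonneg) auto
  then show "k * P + l * Q \<le> k * (f1 * g1 + f2 * g2) + l * (f1 * g2 + f2 * g1)"
    using gap by (simp add: P'_def Q'_def)
  assume kl: "k < l" and "k * P + l * Q = k * (f1 * g1 + f2 * g2) + l * (f1 * g2 + f2 * g1)"
  then have "(l - k) * (P - P') = 0" using gap by (simp add: P'_def Q'_def)
  then have "P - P' = 0" using kl by simp
  then show "0 \<le> (f1 - f2) * (g1 - g2)"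
    unfolding d using max.cobounded2[of "- ((f1 - f2) * (g1 - g2))" 0] by linarith
qed

lemma continuous_AE_zero_imp_zero:
  fixes h :: "'a::euclidean_space \<Rightarrow> real"
  assumes "continuous_on UNIV h" "AE x in lborel. h x = 0"
  shows "h x = 0"
proof (rule ccontr)
  assume "h x \<noteq> 0"
  have "open {x. h x \<noteq> 0}" using assms(1) by (intro open_Collect_neq continuous_intros)
  moreover have "{x. h x \<noteq> 0} \<noteq> {}" using \<open>h x \<noteq> 0\<close> by blast
  moreover have "negligible {x. h x \<noteq> 0}"
  proof -
    have "{x. h x \<noteq> 0} \<in> sets lborel" using calculation(1) by (simp add: borel_open)
    then have "{x. h x \<noteq> 0} \<in> null_sets lborel" using AE_iff_null[of lborel "\<lambda>x. h x = 0"] assms(2) by simp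
    then show ?thesis unfolding negligible_iff_null_sets by (rule null_sets_completionI)
  qed
  ultimately show False using open_not_negligible by blast
qed

locale hyperplane_reflection =
  fixes e :: "'a::euclidean_space" and t :: real
  assumes unit: "norm e = 1"
begin

abbreviation "\<sigma> \<equiv> reflect e t"

lemmas distr_reflect = distr_lborel_reflect[OF unit, of t]

lemma measurable_reflect_lborel [measurable]: "\<sigma> \<in> lborel \<rightarrow>\<^sub>M lborel"
  by simp

lemma nn_integral_reflect:
  assumes [measurable]: "\<phi> \<in> borel_measurable borel"
  shows "(\<integral>\<^sup>+x. \<phi> (\<sigma> x) \<partial>lborel) = (\<integral>\<^sup>+x. \<phi> x \<partial>lborel)"
  by (subst (2) distr_reflect[symmetric]) (simp add: nn_integral_distr)

lemma
  fixes \<phi> :: "'a \<Rightarrow> real"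
  assumes [measurable]: "\<phi> \<in> borel_measurable borel"
  shows integral_reflect: "(\<integral>x. \<phi> (\<sigma> x) \<partial>lborel) = (\<integral>x. \<phi> x \<partial>lborel)"
    and integrable_reflect: "integrable lborel \<phi> \<Longrightarrow> integrable lborel (\<lambda>x. \<phi> (\<sigma> x))"
proof -
  show "(\<integral>x. \<phi> (\<sigma> x) \<partial>lborel) = (\<integral>x. \<phi> x \<partial>lborel)"
    by (subst (2) distr_reflect[symmetric]) (simp add: integral_distr)
  show "integrable lborel (\<lambda>x. \<phi> (\<sigma> x))" if "integrable lborel \<phi>"
    using that by (subst (asm) distr_reflect[symmetric]) (simp add: integrable_distr_eq)
qed

lemma weighted_reflect:
  assumes lam: "0 < lam" and f: "weighted lam f"
  shows "weighted lam (\<lambda>x. f (\<sigma> x))"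
  unfolding weighted_def
proof (intro conjI allI)
  let ?C = "(1 + 2 powr lam * weight lam (\<sigma> 0))"
  note [measurable] = weighted_measurable[OF f]
  show "(\<lambda>x. f (\<sigma> x)) \<in> borel_measurable borel" by measurable
  show "0 \<le> f (\<sigma> x)" for x by (rule weighted_nonneg[OF f])
  have "integrable lborel (\<lambda>x. f x * weight lam (\<sigma> x))"
  proof (rule Bochner_Integration.integrable_bound)
    show "integrable lborel (\<lambda>x. ?C * (f x * weight lam x))"
      by (intro integrable_mult_right weighted_integrable_weight f)
    show "AE x in lborel. norm (f x * weight lam (\<sigma> x)) \<le> norm (?C * (f x * weight lam x))"
    proof (intro AE_I2)
      fix x
      have "norm (\<sigma> x) powr lam = norm (x - \<sigma> 0) powr lam"
        using norm_reflect_commute[OF unit, of t x 0] by simp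
      also have "\<dots> \<le> 2 powr lam * weight lam x * weight lam (\<sigma> 0)" by (rule kernel_le_weight[OF lam])
      finally have "weight lam (\<sigma> x) \<le> ?C * weight lam x"
        using weight_ge_1[of lam x] by (simp add: weight_def[of lam "\<sigma> x"] algebra_simps)
      from mult_left_mono[OF this weighted_nonneg[OF f, of x]]
      show "norm (f x * weight lam (\<sigma> x)) \<le> norm (?C * (f x * weight lam x))"
        using weighted_nonneg[OF f, of x] weight_pos[of lam x] weight_pos[of lam "\<sigma> x"] weight_pos[of lam "\<sigma> 0"]
        by (simp add: abs_mult mult_ac abs_of_pos add_pos_pos)
    qed
  qed measurable
  from integrable_reflect[OF _ this] show "integrable lborel (\<lambda>x. f (\<sigma> x) * weight lam x)"
    by (simp add: unit)
qed

lemma measurable_polarize [measurable]: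
  assumes [measurable]: "f \<in> borel_measurable borel"
  shows "polarize e t f \<in> borel_measurable borel"
  unfolding polarize_def[abs_def] by measurable

lemma weighted_polarize:
  assumes lam: "0 < lam" and f: "weighted lam f"
  shows "weighted lam (polarize e t f)"
proof (rule weighted_bound)
  note [measurable] = weighted_measurable[OF f]
  show "polarize e t f \<in> borel_measurable borel" by measurable
  show "0 \<le> polarize e t f x" for x using weighted_nonneg[OF f] by (auto simp: polarize_def le_max_iff_disj)
  show "weighted lam (\<lambda>x. f x + f (\<sigma> x))"
    using f weighted_reflect[OF lam f] unfolding weighted_def by (auto simp: distrib_right)
  show "polarize e t f x \<le> f x + f (\<sigma> x)" for x
    using weighted_nonneg[OF f, of x] weighted_nonneg[OF f, of "\<sigma> x"] by (auto simp: polarize_def max_def min_def)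
qed

lemma polarize_reflect:
  assumes "x \<bullet> e < t"
  shows "polarize e t f x = max (f x) (f (\<sigma> x))" "polarize e t f (\<sigma> x) = min (f x) (f (\<sigma> x))"
  using assms inner_reflect[OF unit, of t x] by (auto simp: polarize_def unit min.commute)

lemma side_cases:
  obtains "x \<bullet> e < t" | "\<sigma> x \<bullet> e < t" | "x \<bullet> e = t"
  using inner_reflect[OF unit, of t x] by linarith

text \<open>On each pair \<open>{x, \<sigma> x}\<close> polarization permutes the values, so it preserves distribution functions.\<close>

lemma polarize_orbit_sum:
  fixes \<phi> :: "real \<Rightarrow> 'b::ab_semigroup_add"
  shows "\<phi> (polarize e t f x) + \<phi> (polarize e t f (\<sigma> x)) = \<phi> (f x) + \<phi> (f (\<sigma> x))"
proof (rule side_cases[of x])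
  assume "x \<bullet> e < t"
  then show ?thesis by (simp add: polarize_reflect max_def min_def add.commute)
next
  assume "\<sigma> x \<bullet> e < t"
  from polarize_reflect[OF this, of f] show ?thesis by (simp add: unit max_def min_def add.commute)
next
  assume "x \<bullet> e = t"
  then show ?thesis by (simp add: reflect_on_hyperplane polarize_def)
qed

lemma nn_integral_polarize:
  fixes \<phi> :: "real \<Rightarrow> ennreal"
  assumes [measurable]: "\<phi> \<in> borel_measurable borel" "f \<in> borel_measurable borel"
  shows "(\<integral>\<^sup>+x. \<phi> (polarize e t f x) \<partial>lborel) = (\<integral>\<^sup>+x. \<phi> (f x) \<partial>lborel)"
proof -
  have two: "(\<integral>\<^sup>+x. \<psi> x + \<psi> (\<sigma> x) \<partial>lborel) = 2 * (\<integral>\<^sup>+x. \<psi> x \<partial>lborel)"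
    if [measurable]: "\<psi> \<in> borel_measurable borel" for \<psi> :: "'a \<Rightarrow> ennreal"
    by (subst nn_integral_add) (auto simp: nn_integral_reflect mult_2)
  have "2 * (\<integral>\<^sup>+x. \<phi> (polarize e t f x) \<partial>lborel) = (\<integral>\<^sup>+x. \<phi> (polarize e t f x) + \<phi> (polarize e t f (\<sigma> x)) \<partial>lborel)"
    by (rule two[symmetric]) measurable
  also have "\<dots> = (\<integral>\<^sup>+x. \<phi> (f x) + \<phi> (f (\<sigma> x)) \<partial>lborel)" unfolding polarize_orbit_sum ..
  also have "\<dots> = 2 * (\<integral>\<^sup>+x. \<phi> (f x) \<partial>lborel)" by (rule two) measurable
  finally show ?thesis by (simp add: ennreal_mult_cancel_left)
qed

lemma
  fixes f :: "'a \<Rightarrow> real"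
  assumes [measurable]: "f \<in> borel_measurable borel" and int: "integrable lborel (\<lambda>x. f x powr s)"
  shows integrable_polarize_powr: "integrable lborel (\<lambda>x. polarize e t f x powr s)"
    and integral_polarize_powr: "(\<integral>x. polarize e t f x powr s \<partial>lborel) = (\<integral>x. f x powr s \<partial>lborel)"
proof -
  have eq: "(\<integral>\<^sup>+x. ennreal (polarize e t f x powr s) \<partial>lborel) = (\<integral>\<^sup>+x. ennreal (f x powr s) \<partial>lborel)"
    by (rule nn_integral_polarize) measurable
  have "(\<integral>\<^sup>+x. ennreal (f x powr s) \<partial>lborel) < \<infinity>"
    using int by (simp add: integrable_iff_bounded)
  then show "integrable lborel (\<lambda>x. polarize e t f x powr s)"
    using eq by (intro integrableI_nonneg) auto
  show "(\<integral>x. polarize e t f x powr s \<partial>lborel) = (\<integral>x. f x powr s \<partial>lborel)"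
    using eq by (simp add: integral_eq_nn_integral)
qed

lemma measurable_reflect_pair [measurable]:
  "(\<lambda>z. (\<sigma> (fst z), snd z)) \<in> lborel2 \<rightarrow>\<^sub>M lborel2"
  "(\<lambda>z. (fst z, \<sigma> (snd z))) \<in> lborel2 \<rightarrow>\<^sub>M lborel2"
  by (intro measurable_Pair measurable_fst measurable_snd measurable_compose[OF _ measurable_reflect_lborel])+

lemma nn_integral_reflect_product:
  assumes \<phi>: "\<phi> \<in> borel_measurable lborel2"
  shows "(\<integral>\<^sup>+z. \<phi> (\<sigma> (fst z), snd z) \<partial>lborel2) = (\<integral>\<^sup>+z. \<phi> z \<partial>lborel2)"
    and "(\<integral>\<^sup>+z. \<phi> (fst z, \<sigma> (snd z)) \<partial>lborel2) = (\<integral>\<^sup>+z. \<phi> z \<partial>lborel2)"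
proof -
  note [measurable] = \<phi>
  have "(\<integral>\<^sup>+z. \<phi> (\<sigma> (fst z), snd z) \<partial>lborel2) = (\<integral>\<^sup>+x. \<integral>\<^sup>+y. \<phi> (\<sigma> x, y) \<partial>lborel \<partial>lborel)"
    by (subst lborel.nn_integral_fst[symmetric]) (simp_all add: measurable_compose[OF measurable_reflect_pair(1) \<phi>] measurable_compose[OF measurable_reflect_pair(2) \<phi>])
  also have "\<dots> = (\<integral>\<^sup>+x. \<integral>\<^sup>+y. \<phi> (x, y) \<partial>lborel \<partial>lborel)"
    using lborel.borel_measurable_nn_integral_fst[OF \<phi>]
    by (intro nn_integral_reflect[of "\<lambda>x. \<integral>\<^sup>+y. \<phi> (x, y) \<partial>lborel"]) simp
  also have "\<dots> = (\<integral>\<^sup>+z. \<phi> z \<partial>lborel2)" by (rule lborel.nn_integral_fst[OF \<phi>])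
  finally show "(\<integral>\<^sup>+z. \<phi> (\<sigma> (fst z), snd z) \<partial>lborel2) = (\<integral>\<^sup>+z. \<phi> z \<partial>lborel2)" .
  have "(\<integral>\<^sup>+z. \<phi> (fst z, \<sigma> (snd z)) \<partial>lborel2) = (\<integral>\<^sup>+x. \<integral>\<^sup>+y. \<phi> (x, \<sigma> y) \<partial>lborel \<partial>lborel)"
    by (subst lborel.nn_integral_fst[symmetric]) (simp_all add: measurable_compose[OF measurable_reflect_pair(1) \<phi>] measurable_compose[OF measurable_reflect_pair(2) \<phi>])
  also have "\<dots> = (\<integral>\<^sup>+x. \<integral>\<^sup>+y. \<phi> (x, y) \<partial>lborel \<partial>lborel)"
    by (intro nn_integral_cong nn_integral_reflect[of "\<lambda>y. \<phi> (_, y)"]) measurable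
  also have "\<dots> = (\<integral>\<^sup>+z. \<phi> z \<partial>lborel2)" by (rule lborel.nn_integral_fst[OF \<phi>])
  finally show "(\<integral>\<^sup>+z. \<phi> (fst z, \<sigma> (snd z)) \<partial>lborel2) = (\<integral>\<^sup>+z. \<phi> z \<partial>lborel2)" .
qed

text \<open>The integrand of the bilinear form, summed over the four points obtained by reflecting either variable. The two
points with equal kernel are collected, so that polarization acts on it by \<open>four_point_rearrangement\<close>.\<close>

definition orbit_sum :: "real \<Rightarrow> ('a \<Rightarrow> real) \<Rightarrow> ('a \<Rightarrow> real) \<Rightarrow> 'a \<times> 'a \<Rightarrow> real" where
  "orbit_sum lam f g z = norm (fst z - snd z) powr lam * (f (fst z) * g (snd z) + f (\<sigma> (fst z)) * g (\<sigma> (snd z)))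
     + norm (\<sigma> (fst z) - snd z) powr lam * (f (fst z) * g (\<sigma> (snd z)) + f (\<sigma> (fst z)) * g (snd z))"

lemma nn_integral_orbit_sum:
  assumes lam: "0 < lam" and f: "weighted lam f" and g: "weighted lam g"
  shows "(\<integral>\<^sup>+z. ennreal (orbit_sum lam f g z) \<partial>lborel2) = 4 * ennreal (\<integral>x. f x * pot lam g x \<partial>lborel)"
    and "0 \<le> orbit_sum lam f g z"
    and "(\<lambda>z. orbit_sum lam f g z) \<in> borel_measurable lborel2"
proof -
  note [measurable] = weighted_measurable[OF f] weighted_measurable[OF g]
  define T where "T z = ennreal (f (fst z) * g (snd z) * norm (fst z - snd z) powr lam)" for z :: "'a \<times> 'a"
  have T [measurable]: "T \<in> borel_measurable lborel2" unfolding T_def[abs_def] by measurable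
  define T1 where "T1 z = T (\<sigma> (fst z), snd z)" for z
  have T1 [measurable]: "T1 \<in> borel_measurable lborel2" unfolding T1_def[abs_def] by measurable
  define T2 where "T2 z = T (fst z, \<sigma> (snd z))" for z
  have T2 [measurable]: "T2 \<in> borel_measurable lborel2" unfolding T2_def[abs_def] by measurable
  define T3 where "T3 z = T1 (fst z, \<sigma> (snd z))" for z
  have T3 [measurable]: "T3 \<in> borel_measurable lborel2" unfolding T3_def[abs_def] by measurable
  have I: "integral\<^sup>N lborel2 T = ennreal (\<integral>x. f x * pot lam g x \<partial>lborel)"
    unfolding nn_integral_mult_pot[OF lam f g, symmetric] by (subst lborel.nn_integral_fst[OF T, symmetric]) (simp add: T_def)
  have I1: "integral\<^sup>N lborel2 T1 = integral\<^sup>N lborel2 T"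
    using nn_integral_reflect_product(1)[OF T] by (simp add: T1_def[abs_def])
  have I2: "integral\<^sup>N lborel2 T2 = integral\<^sup>N lborel2 T"
    using nn_integral_reflect_product(2)[OF T] by (simp add: T2_def[abs_def])
  have I3: "integral\<^sup>N lborel2 T3 = integral\<^sup>N lborel2 T"
    using nn_integral_reflect_product(2)[OF T1] I1 by (simp add: T3_def[abs_def])
  have split: "ennreal (orbit_sum lam f g z) = T z + T1 z + T2 z + T3 z" for z
  proof -
    have "norm (fst z - \<sigma> (snd z)) = norm (\<sigma> (fst z) - snd z)" by (rule norm_reflect_commute[OF unit, symmetric])
    then show ?thesis
      using weighted_nonneg[OF f] weighted_nonneg[OF g]
      by (simp add: T_def T1_def T2_def T3_def orbit_sum_def norm_reflect_reflect[OF unit]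
          ennreal_plus[symmetric] algebra_simps del: ennreal_plus)
  qed
  show "(\<integral>\<^sup>+z. ennreal (orbit_sum lam f g z) \<partial>lborel2) = 4 * ennreal (\<integral>x. f x * pot lam g x \<partial>lborel)"
  proof -
    have four: "c + c + c + c = 4 * c" for c :: ennreal
    proof -
      have "(4::ennreal) = 1 + 1 + 1 + 1" by simp
      then show ?thesis by (simp only: distrib_right mult_1)
    qed
    show ?thesis unfolding split by (simp add: nn_integral_add I I1 I2 I3 four)
  qed
  show "0 \<le> orbit_sum lam f g z"
    unfolding orbit_sum_def by (intro add_nonneg_nonneg mult_nonneg_nonneg weighted_nonneg[OF f] weighted_nonneg[OF g]) auto
  have [measurable]: "(\<lambda>z::'a\<times>'a. norm (\<sigma> (fst z) - snd z)) \<in> borel_measurable lborel2"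
    using measurable_compose[of "\<lambda>z. (\<sigma> (fst z), snd z)" lborel2 lborel2, OF _ measurable_prod_norm] by simp
  show "(\<lambda>z. orbit_sum lam f g z) \<in> borel_measurable lborel2"
    unfolding orbit_sum_def[abs_def] by measurable
qed

lemma orbit_sum_polarize:
  assumes lam: "0 < lam"
  shows "orbit_sum lam (polarize e t f) (polarize e t g) z \<le> orbit_sum lam f g z"
    and "fst z \<bullet> e < t \<Longrightarrow> snd z \<bullet> e < t \<Longrightarrow>
      orbit_sum lam (polarize e t f) (polarize e t g) z = orbit_sum lam f g z \<Longrightarrow>
      0 \<le> (f (fst z) - f (\<sigma> (fst z))) * (g (snd z) - g (\<sigma> (snd z)))"
proof -
  obtain x y where z: "z = (x, y)" by (cases z)
  have inv1: "orbit_sum lam f' g' (\<sigma> u, v) = orbit_sum lam f' g' (u, v)" for f' g' u v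
    by (simp add: orbit_sum_def unit add.commute)
  have inv2: "orbit_sum lam f' g' (u, \<sigma> v) = orbit_sum lam f' g' (u, v)" for f' g' u v
    by (simp add: orbit_sum_def unit norm_reflect_reflect[OF unit] norm_reflect_commute[OF unit, symmetric] add.commute)
  have main: "orbit_sum lam (polarize e t f) (polarize e t g) (u, v) \<le> orbit_sum lam f g (u, v)"
    if uv: "u \<bullet> e < t" "v \<bullet> e < t" for u v
  proof -
    have "norm (u - v) powr lam \<le> norm (\<sigma> u - v) powr lam"
      using lam uv norm_reflect_le[OF unit, of u v t] by (intro powr_mono2) (auto intro: mult_nonpos_nonpos)
    from four_point_rearrangement(1)[OF this, of "f u" "f (\<sigma> u)" "g v" "g (\<sigma> v)"]
    show ?thesis using uv by (simp add: orbit_sum_def polarize_reflect)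
  qed
  have flat1: "orbit_sum lam (polarize e t f) (polarize e t g) (u, v) \<le> orbit_sum lam f g (u, v)"
    if u: "u \<bullet> e = t" for u v
  proof -
    have "polarize e t f u = f u" using u by (simp add: polarize_def reflect_on_hyperplane)
    moreover have "orbit_sum lam f' g' (u, v) = 2 * norm (u - v) powr lam * f' u * (g' v + g' (\<sigma> v))" for f' g'
      using u by (simp add: orbit_sum_def reflect_on_hyperplane algebra_simps)
    ultimately show ?thesis by (simp add: polarize_orbit_sum[of "\<lambda>c. c"])
  qed
  have flat2: "orbit_sum lam (polarize e t f) (polarize e t g) (u, v) \<le> orbit_sum lam f g (u, v)"
    if v: "v \<bullet> e = t" for u v
  proof -
    have n: "norm (\<sigma> u - v) = norm (u - v)"
      using norm_reflect_commute[OF unit, of t u v] v by (simp add: reflect_on_hyperplane)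
    have "polarize e t g v = g v" using v by (simp add: polarize_def reflect_on_hyperplane)
    moreover have "orbit_sum lam f' g' (u, v) = 2 * norm (u - v) powr lam * g' v * (f' u + f' (\<sigma> u))" for f' g'
      using v n by (simp add: orbit_sum_def reflect_on_hyperplane algebra_simps)
    ultimately show ?thesis by (simp add: polarize_orbit_sum[of "\<lambda>c. c"])
  qed
  show "orbit_sum lam (polarize e t f) (polarize e t g) z \<le> orbit_sum lam f g z"
  proof -
    let ?le = "\<lambda>u v. orbit_sum lam (polarize e t f) (polarize e t g) (u, v) \<le> orbit_sum lam f g (u, v)"
    have half: "?le u v" if u: "u \<bullet> e < t" for u v
    proof (rule side_cases[of v])
      show "?le u v" if "\<sigma> v \<bullet> e < t" using main[OF u that] unfolding inv2 .
    qed (use u main flat2 in auto)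
    show ?thesis
      unfolding z
    proof (rule side_cases[of x])
      show "?le x y" if "\<sigma> x \<bullet> e < t" using half[OF that, of y] unfolding inv1 .
    qed (use half flat1 in auto)
  qed
  assume s: "fst z \<bullet> e < t" "snd z \<bullet> e < t"
    and eq: "orbit_sum lam (polarize e t f) (polarize e t g) z = orbit_sum lam f g z"
  have "norm (x - y) < norm (\<sigma> x - y)"
    using s norm_reflect_less[OF unit, of x y t] by (simp add: z mult_neg_neg)
  then have kl: "norm (x - y) powr lam < norm (\<sigma> x - y) powr lam"
    using lam by (intro powr_less_mono2) auto
  show "0 \<le> (f (fst z) - f (\<sigma> (fst z))) * (g (snd z) - g (\<sigma> (snd z)))"
    using four_point_rearrangement(2)[OF less_imp_le[OF kl] kl, of "f x" "f (\<sigma> x)" "g y" "g (\<sigma> y)"] eq s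
    by (simp add: z orbit_sum_def polarize_reflect)
qed

text \<open>Polarization decreases the sum over orbits pointwise. If the integral does not decrease, the two sums agree almost
everywhere, hence everywhere by continuity, and the equality case of the four-point inequality applies.\<close>

lemma polarization_equality:
  assumes lam: "0 < lam" and f: "weighted lam f" "continuous_on UNIV f" and g: "weighted lam g" "continuous_on UNIV g"
    and le: "(\<integral>x. f x * pot lam g x \<partial>lborel) \<le> (\<integral>x. polarize e t f x * pot lam (polarize e t g) x \<partial>lborel)"
    and xy: "x \<bullet> e < t" "y \<bullet> e < t"
  shows "0 \<le> (f x - f (\<sigma> x)) * (g y - g (\<sigma> y))"
proof -
  let ?E = "orbit_sum lam f g" and ?P = "orbit_sum lam (polarize e t f) (polarize e t g)"
  note pf = weighted_polarize[OF lam f(1)] and pg = weighted_polarize[OF lam g(1)]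
  note E = nn_integral_orbit_sum[OF lam f(1) g(1)] and P = nn_integral_orbit_sum[OF lam pf pg]
  note [measurable] = E(3) P(3)
  have PE: "?P z \<le> ?E z" for z by (rule orbit_sum_polarize(1)[OF lam])
  let ?M = "lborel2"
  have "(\<integral>\<^sup>+z. ennreal (?E z - ?P z) \<partial>?M) + (\<integral>\<^sup>+z. ennreal (?P z) \<partial>?M) = (\<integral>\<^sup>+z. ennreal (?E z) \<partial>?M)"
    using PE P(2) by (subst nn_integral_add[symmetric]) (auto simp flip: ennreal_plus)
  also have "\<dots> \<le> (\<integral>\<^sup>+z. ennreal (?P z) \<partial>?M)"
    unfolding E(1) P(1) by (intro mult_left_mono ennreal_leI le) simp
  finally have "(\<integral>\<^sup>+z. ennreal (?E z - ?P z) \<partial>?M) + (\<integral>\<^sup>+z. ennreal (?P z) \<partial>?M) \<le> 0 + (\<integral>\<^sup>+z. ennreal (?P z) \<partial>?M)"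
    by simp
  moreover have "(\<integral>\<^sup>+z. ennreal (?P z) \<partial>?M) \<noteq> \<infinity>" unfolding P(1) by (simp add: ennreal_mult_eq_top_iff)
  ultimately have "(\<integral>\<^sup>+z. ennreal (?E z - ?P z) \<partial>?M) \<le> 0"
    using ennreal_add_left_cancel_le[of "\<integral>\<^sup>+z. ennreal (?P z) \<partial>?M" "\<integral>\<^sup>+z. ennreal (?E z - ?P z) \<partial>?M" 0]
    by (simp only: add.commute) blast
  then have "(\<integral>\<^sup>+z. ennreal (?E z - ?P z) \<partial>?M) = 0" by simp
  then have "AE z in ?M. ennreal (?E z - ?P z) = 0" by (subst (asm) nn_integral_0_iff_AE) auto
  then have "AE z in ?M. ?E z - ?P z = 0"
  proof eventually_elim
    case (elim z)
    then show ?case using PE[of z] by (simp add: ennreal_eq_0_iff)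
  qed
  then have AE: "AE z in lborel. ?E z - ?P z = 0" unfolding lborel_prod .
  have cont: "continuous_on UNIV (orbit_sum lam f' g')"
    if f': "continuous_on UNIV f'" and g': "continuous_on UNIV g'" for f' g'
  proof -
    have c: "continuous_on UNIV (\<lambda>z::'a\<times>'a. f' (h z))" "continuous_on UNIV (\<lambda>z::'a\<times>'a. g' (h z))"
      if "continuous_on UNIV h" for h
      using continuous_on_compose2[OF f' that] continuous_on_compose2[OF g' that] by auto
    show ?thesis
      unfolding orbit_sum_def[abs_def]
      by (intro continuous_intros c continuous_on_powr') (use lam in auto)
  qed
  have "?E (x, y) - ?P (x, y) = 0"
    by (rule continuous_AE_zero_imp_zero[OF _ AE])
      (intro continuous_intros cont f(2) g(2) continuous_on_polarize unit)
  then show ?thesis using orbit_sum_polarize(2)[OF lam, of "(x, y)" f g] xy by simp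
qed

lemma pot_reflect:
  assumes "weighted lam f"
  shows "pot lam (\<lambda>y. f (\<sigma> y)) x = pot lam f (\<sigma> x)"
proof -
  note [measurable] = weighted_measurable[OF assms]
  have "pot lam f (\<sigma> x) = (\<integral>y. f (\<sigma> y) * norm (\<sigma> x - \<sigma> y) powr lam \<partial>lborel)"
    unfolding pot_def by (rule integral_reflect[symmetric]) measurable
  then show ?thesis by (simp add: pot_def norm_reflect_reflect[OF unit])
qed

text \<open>Twice the difference of the potentials is the integral of
\<open>(f y - f (\<sigma> y)) * (norm (\<sigma> x - y) powr lam - norm (x - y) powr lam)\<close>, whose factors change sign together when \<open>y\<close>
crosses the hyperplane. The kernel increases with distance, so the side that carries more mass has the smaller
potential.\<close>

lemma pot_reflect_compare:
  assumes lam: "0 < lam" and f: "weighted lam f" and le: "\<And>y. y \<bullet> e < t \<Longrightarrow> f (\<sigma> y) \<le> f y" and x: "x \<bullet> e < t"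
  shows "pot lam f x \<le> pot lam f (\<sigma> x)"
    and "continuous_on UNIV f \<Longrightarrow> z \<bullet> e < t \<Longrightarrow> f (\<sigma> z) < f z \<Longrightarrow> pot lam f x < pot lam f (\<sigma> x)"
proof -
  define u where "u y = (f y - f (\<sigma> y)) * (norm (\<sigma> x - y) powr lam - norm (x - y) powr lam)" for y
  note fr = weighted_reflect[OF lam f]
  have iu: "integrable lborel u"
    unfolding u_def[abs_def] left_diff_distrib right_diff_distrib
    by (intro Bochner_Integration.integrable_diff weighted_integrable_kernel lam f fr)
  have "(\<integral>y. u y \<partial>lborel) = (pot lam f (\<sigma> x) - pot lam f x) - (pot lam (\<lambda>y. f (\<sigma> y)) (\<sigma> x) - pot lam (\<lambda>y. f (\<sigma> y)) x)"
    unfolding u_def left_diff_distrib right_diff_distrib pot_def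
    by (simp add: weighted_integrable_kernel[OF lam f] weighted_integrable_kernel[OF lam fr])
  then have val: "(\<integral>y. u y \<partial>lborel) = 2 * (pot lam f (\<sigma> x) - pot lam f x)"
    by (simp add: pot_reflect[OF f] unit)
  have u0: "0 \<le> u y" for y
  proof (rule side_cases[of y])
    assume y: "y \<bullet> e < t"
    then have "norm (x - y) \<le> norm (\<sigma> x - y)"
      using norm_reflect_le[OF unit, of x y t] x by (simp add: mult_nonpos_nonpos)
    then show ?thesis unfolding u_def using lam le[OF y] by (intro mult_nonneg_nonneg) (auto intro: powr_mono2)
  next
    assume y: "\<sigma> y \<bullet> e < t"
    then have "norm (x - \<sigma> y) \<le> norm (\<sigma> x - \<sigma> y)"
      using norm_reflect_le[OF unit, of x "\<sigma> y" t] x by (simp add: mult_nonpos_nonpos)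
    then have "norm (\<sigma> x - y) \<le> norm (x - y)"
      unfolding norm_reflect_commute[OF unit, of t x y] by (simp only: norm_reflect_reflect[OF unit])
    then have "norm (\<sigma> x - y) powr lam \<le> norm (x - y) powr lam"
      using lam by (intro powr_mono2) auto
    then show ?thesis unfolding u_def using le[OF y] by (intro mult_nonpos_nonpos) (auto simp: unit)
  qed (simp add: u_def reflect_on_hyperplane)
  have int0: "0 \<le> (\<integral>y. u y \<partial>lborel)" by (intro integral_nonneg_AE AE_I2 u0)
  then show "pot lam f x \<le> pot lam f (\<sigma> x)" unfolding val by simp
  assume c: "continuous_on UNIV f" and z: "z \<bullet> e < t" "f (\<sigma> z) < f z"
  have "(\<integral>y. u y \<partial>lborel) \<noteq> 0"
  proof
    assume "(\<integral>y. u y \<partial>lborel) = 0"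
    then have "AE y in lborel. u y = 0"
      using iu u0 by (subst (asm) integral_nonneg_eq_0_iff_AE) auto
    moreover have "continuous_on UNIV u"
      unfolding u_def[abs_def]
      by (intro continuous_intros c continuous_on_compose2[OF c] continuous_on_powr') (use lam in auto)
    ultimately have "u z = 0" by (intro continuous_AE_zero_imp_zero)
    moreover have "norm (x - z) powr lam < norm (\<sigma> x - z) powr lam"
      using norm_reflect_less[OF unit, of x z t] x z lam by (intro powr_less_mono2) (auto simp: mult_neg_neg)
    ultimately show False using z by (simp add: u_def)
  qed
  then show "pot lam f x < pot lam f (\<sigma> x)" using int0 unfolding val by simp
qed

end

section \<open>Radial symmetry of maximizers\<close>

lemma powr_minus_less_iff:
  fixes u v s :: real
  assumes "0 < u" "0 < v" "0 < s"
  shows "u powr (-s - 1) < v powr (-s - 1) \<longleftrightarrow> v < u"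
proof
  show "u powr (-s - 1) < v powr (-s - 1)" if "v < u"
    using assms that by (intro powr_less_mono2_neg) auto
  show "v < u" if "u powr (-s - 1) < v powr (-s - 1)"
  proof (rule ccontr)
    assume "\<not> v < u"
    then have "v powr (-s - 1) \<le> u powr (-s - 1)" using assms by (intro powr_mono2') auto
    then show False using that by simp
  qed
qed

text \<open>A maximizer in the form in which the Euler-Lagrange equation holds at every point. It is then continuous and
strictly positive, which turns almost-everywhere statements about reflections into pointwise ones.\<close>

locale continuous_maximizer = hls_exponents p r lam a b ty
  for p r lam a b and ty :: "'a::euclidean_space itself" +
  fixes f :: "'a \<Rightarrow> real" and k :: real
  assumes unit_f: "unit_density f"
    and maximal: "\<And>f'. unit_density f' \<Longrightarrow> energy f' \<le> energy f"
    and k: "0 < k"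
    and f_eq: "f x = k * pot lam (\<lambda>x. pot lam f x powr (-b - 1)) x powr (-a - 1)"
begin

text \<open>The dual density of \<open>f\<close>. Each of \<open>f\<close> and \<open>g\<close> is a decreasing power of the potential of the other.\<close>

definition g :: "'a \<Rightarrow> real" where "g x = pot lam f x powr (-b - 1)"

lemma f_pot_g: "f x = k * pot lam g x powr (-a - 1)"
  using f_eq[of x] by (simp add: g_def[abs_def])

lemmas f_weighted = unit_densityD(1)[OF unit_f] and f_mass = unit_densityD(4)[OF unit_f]

lemma g_weighted: "weighted lam g" and g_mass: "0 < (\<integral>x. g x \<partial>lborel)"
  and g_powr: "integrable lborel (\<lambda>x. g x powr r)" "(\<integral>x. g x powr r \<partial>lborel) = energy f"
proof -
  obtain c where c: "0 < c" "\<And>x. c * weight lam x \<le> pot lam f x"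
    using pot_ge_weight[OF lam_pos f_weighted f_mass] by blast
  note dual = dual_powr[OF measurable_pot[OF lam_pos f_weighted] c]
  show "weighted lam g" "0 < (\<integral>x. g x \<partial>lborel)" "integrable lborel (\<lambda>x. g x powr r)"
    "(\<integral>x. g x powr r \<partial>lborel) = energy f"
    using dual unfolding g_def[abs_def] energy_def by auto
qed

lemma F_pos: "0 < pot lam f x" and G_pos: "0 < pot lam g x"
  using pot_pos[OF f_weighted f_mass] pot_pos[OF g_weighted g_mass] by auto

lemma f_pos: "0 < f x"
  using f_pot_g[of x] G_pos[of x] k by simp

lemma g_less_iff: "g x < g y \<longleftrightarrow> pot lam f y < pot lam f x"
  and f_less_iff: "f x < f y \<longleftrightarrow> pot lam g y < pot lam g x"
proof -
  show "g x < g y \<longleftrightarrow> pot lam f y < pot lam f x"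
    unfolding g_def by (rule powr_minus_less_iff[OF F_pos F_pos ab_pos(2)])
  have "f x < f y \<longleftrightarrow> pot lam g x powr (-a - 1) < pot lam g y powr (-a - 1)"
    unfolding f_pot_g[of x] f_pot_g[of y] by (rule mult_less_cancel_left_pos[OF k])
  also have "\<dots> \<longleftrightarrow> pot lam g y < pot lam g x"
    by (rule powr_minus_less_iff[OF G_pos G_pos ab_pos(1)])
  finally show "f x < f y \<longleftrightarrow> pot lam g y < pot lam g x" .
qed

lemma continuous_f: "continuous_on UNIV f" and continuous_g: "continuous_on UNIV g"
proof -
  have "continuous_on UNIV (\<lambda>x. k * pot lam g x powr (-a - 1))"
    by (intro continuous_intros continuous_on_pot lam_pos g_weighted)
      (use G_pos in \<open>auto simp: less_imp_neq[symmetric]\<close>)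
  then show "continuous_on UNIV f" by (rule continuous_on_eq) (rule f_pot_g[symmetric])
  have "continuous_on UNIV (\<lambda>x. pot lam f x powr (-b - 1))"
    by (intro continuous_intros continuous_on_pot lam_pos f_weighted)
      (use F_pos in \<open>auto simp: less_imp_neq[symmetric]\<close>)
  then show "continuous_on UNIV g" by (rule continuous_on_eq) (rule g_def[symmetric])
qed

text \<open>Polarization preserves the two constraints, so by duality the pairing of the polarized pair is still at least the
maximal energy, which is the pairing of \<open>f\<close> and \<open>g\<close>.\<close>

lemma polarization_does_not_decrease:
  assumes e: "norm e = 1"
  shows "(\<integral>x. f x * pot lam g x \<partial>lborel) \<le> (\<integral>x. polarize e t f x * pot lam (polarize e t g) x \<partial>lborel)"
proof -
  interpret hyperplane_reflection e t by unfold_locales (rule e)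
  let ?f = "polarize e t f" and ?g = "polarize e t g"
  note fw = weighted_polarize[OF lam_pos f_weighted] and gw = weighted_polarize[OF lam_pos g_weighted]
  note fm = weighted_measurable[OF f_weighted] and gm = weighted_measurable[OF g_weighted]
  have uf: "unit_density ?f"
    unfolding unit_density_def
    using fw integrable_polarize_powr[OF fm unit_densityD(2)[OF unit_f]]
      integral_polarize_powr[OF fm unit_densityD(2)[OF unit_f]] unit_densityD(3)[OF unit_f] by simp
  have gr: "(\<integral>x. ?g x powr r \<partial>lborel) = energy f"
    using integral_polarize_powr[OF gm g_powr(1)] g_powr(2) by simp
  define I where "I = (\<integral>x. ?g x * pot lam ?f x \<partial>lborel)"
  define S where "S = energy f"
  have S: "0 < S" unfolding S_def by (rule energy_pos[OF unit_f])
  have I: "0 < I" unfolding I_def by (rule energy_duality(2)[OF uf gw]) (use gr S in \<open>simp add: S_def\<close>)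
  have "S \<le> I powr r * energy ?f powr (1 - r)"
    using energy_duality(1)[OF uf gw] gr S by (simp add: S_def I_def)
  also have "\<dots> \<le> I powr r * S powr (1 - r)"
    using maximal[OF uf] energy_pos[OF uf] r by (intro mult_left_mono powr_mono2) (auto simp: S_def)
  finally have "S powr r * S powr (1 - r) \<le> I powr r * S powr (1 - r)"
    using S by (simp add: powr_add[symmetric])
  then have "S powr r \<le> I powr r" using S by simp
  then have "S \<le> I" using powr_less_mono2[of r I S] r I by force
  also have "I = (\<integral>x. ?f x * pot lam ?g x \<partial>lborel)"
    unfolding I_def by (rule integral_mult_pot_commute[OF lam_pos gw fw])
  also have "S = (\<integral>x. f x * pot lam g x \<partial>lborel)"
    using dual_step(1)[OF unit_f] by (simp add: S_def g_def[abs_def])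
  finally show ?thesis .
qed

text \<open>One strict inequality for \<open>g\<close> orients \<open>f\<close> on the whole half space, hence its potential, hence \<open>g\<close>, hence the potential
of \<open>g\<close>, now strictly, and hence \<open>f\<close> strictly.\<close>

lemma one_sided_strict:
  assumes e: "norm e = 1" and z: "z \<bullet> e < t" "g (reflect e t z) < g z" and x: "x \<bullet> e < t"
  shows "f (reflect e t x) < f x"
proof -
  interpret hyperplane_reflection e t by unfold_locales (rule e)
  have le: "f (\<sigma> y) \<le> f y" if y: "y \<bullet> e < t" for y
  proof -
    have "0 \<le> (f y - f (\<sigma> y)) * (g z - g (\<sigma> z))"
      by (rule polarization_equality[OF lam_pos f_weighted continuous_f g_weighted continuous_g
          polarization_does_not_decrease[OF e] y z(1)])
    then show ?thesis using z(2) by (simp add: zero_le_mult_iff)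
  qed
  have "g (\<sigma> y) \<le> g y" if y: "y \<bullet> e < t" for y
    using pot_reflect_compare(1)[OF lam_pos f_weighted le y] g_less_iff[of y "\<sigma> y"] by linarith
  then have "pot lam g x < pot lam g (\<sigma> x)"
    by (rule pot_reflect_compare(2)[OF lam_pos g_weighted _ x continuous_g z])
  then show ?thesis by (simp add: f_less_iff)
qed

lemma reflection_trichotomy:
  assumes e: "norm e = 1"
  shows "(\<forall>x. f (reflect e t x) = f x) \<or> (\<forall>x. x \<bullet> e < t \<longrightarrow> f (reflect e t x) < f x)
    \<or> (\<forall>x. x \<bullet> e < t \<longrightarrow> f x < f (reflect e t x))"
proof -
  interpret hyperplane_reflection e t by unfold_locales (rule e)
  consider "\<forall>z. z \<bullet> e < t \<longrightarrow> g (\<sigma> z) = g z" | z where "z \<bullet> e < t" "g (\<sigma> z) < g z" | z where "z \<bullet> e < t" "g z < g (\<sigma> z)"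
    by (meson linorder_neqE)
  then show ?thesis
  proof cases
    case 1
    have "g (\<sigma> z) = g z" for z
    proof (rule side_cases[of z])
      show "g (\<sigma> z) = g z" if "\<sigma> z \<bullet> e < t" using 1[rule_format, OF that] by (simp add: unit)
      show "g (\<sigma> z) = g z" if "z \<bullet> e = t" using that by (simp add: reflect_on_hyperplane)
    qed (use 1 in auto)
    then have "pot lam g (\<sigma> x) = pot lam g x" for x
      using pot_reflect[OF g_weighted, of x] by simp
    then show ?thesis by (simp add: f_pot_g)
  next
    case 2
    then show ?thesis using one_sided_strict[OF e] by blast
  next
    case (3 z)
    \<comment> \<open>The same hyperplane with the opposite normal vector exchanges the two half spaces.\<close>
    have above: "t < \<sigma> y \<bullet> e" if "y \<bullet> e < t" for y
      using inner_reflect[OF unit, of t y] that by linarith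
    have "f x < f (\<sigma> x)" if x: "x \<bullet> e < t" for x
    proof -
      have "f (reflect (- e) (- t) (\<sigma> x)) < f (\<sigma> x)"
      proof (rule one_sided_strict)
        show "g (reflect (- e) (- t) (\<sigma> z)) < g (\<sigma> z)"
          unfolding reflect_minus reflect_reflect[OF unit] by (rule 3(2))
      qed (use above[OF x] above[OF 3(1)] e in auto)
      then show ?thesis unfolding reflect_minus reflect_reflect[OF unit] .
    qed
    then show ?thesis by blast
  qed
qed

lemma f_decay:
  assumes "0 < \<epsilon>"
  obtains R where "\<And>x. R \<le> norm x \<Longrightarrow> f x < \<epsilon>"
proof -
  obtain c where c: "0 < c" "\<And>x. c * weight lam x \<le> pot lam g x"
    using pot_ge_weight[OF lam_pos g_weighted g_mass] by blast
  define A where "A = (\<epsilon> / k) powr (1 / (-a - 1))"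
  have A: "0 < A" using assms k by (simp add: A_def)
  have Ae: "k * A powr (-a - 1) = \<epsilon>" using assms k ab_pos by (simp add: A_def powr_powr)
  show ?thesis
  proof (rule that[of "(A / c) powr (1 / lam)"])
    fix x :: 'a assume "(A / c) powr (1 / lam) \<le> norm x"
    then have "((A / c) powr (1 / lam)) powr lam \<le> norm x powr lam" using lam_pos by (intro powr_mono2) auto
    then have "A / c \<le> norm x powr lam" using A c lam_pos by (simp add: powr_powr)
    then have "A / c < weight lam x" by (simp add: weight_def)
    then have "A < c * weight lam x" using c by (simp add: field_simps)
    then have "A < pot lam g x" using c(2)[of x] by linarith
    then have "pot lam g x powr (-a - 1) < A powr (-a - 1)"
      using A ab_pos by (intro powr_less_mono2_neg) auto
    then show "f x < \<epsilon>" unfolding f_pot_g[of x] Ae[symmetric] using k by simp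
  qed
qed

lemma f_attains_max: obtains x0 where "\<And>x. f x \<le> f x0"
proof -
  obtain R where R: "\<And>x. R \<le> norm x \<Longrightarrow> f x < f 0" using f_decay[OF f_pos[of 0]] by blast
  have "compact (cball (0::'a) (max R 0))" "cball (0::'a) (max R 0) \<noteq> {}" by auto
  then obtain x0 where x0: "x0 \<in> cball 0 (max R 0)" "\<And>x. x \<in> cball 0 (max R 0) \<Longrightarrow> f x \<le> f x0"
    using continuous_attains_sup[of "cball (0::'a) (max R 0)" f] continuous_on_subset[OF continuous_f] by auto
  have "f x \<le> f x0" for x
  proof (cases "norm x \<le> max R 0")
    case False
    then have "f x < f 0" by (intro R) linarith
    then show ?thesis using x0(2)[of 0] by auto
  qed (use x0 in auto)
  then show ?thesis by (rule that)
qed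

text \<open>The centre is a maximum point \<open>x0\<close> of \<open>f\<close>. If \<open>x\<close> is closer to \<open>x0\<close> than \<open>y\<close>, the bisector of \<open>x\<close> and \<open>y\<close> has
\<open>x0\<close> on the side of \<open>x\<close>, and the maximum at \<open>x0\<close> excludes the alternative of \<open>reflection_trichotomy\<close> that would
make \<open>f\<close> larger at \<open>y\<close>. Equal distances follow by continuity.\<close>

lemma radially_decreasing:
  obtains x0 where "\<And>x y. norm (x - x0) < norm (y - x0) \<Longrightarrow> f y < f x"
    "\<And>x y. norm (x - x0) = norm (y - x0) \<Longrightarrow> f x = f y"
proof -
  obtain x0 where max: "\<And>x. f x \<le> f x0" using f_attains_max by blast
  have swap: "f y < f x \<or> (\<exists>e t. norm e = 1 \<and> x0 \<bullet> e < t \<and> (\<forall>z. f (reflect e t z) = f z) \<and> f y = f x)"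
    if xy: "norm (x - x0) < norm (y - x0)" for x y
  proof -
    have "x \<noteq> y" using xy by auto
    then obtain e t where e: "norm e = 1" and sw: "reflect e t x = y"
      and side: "\<And>z. z \<bullet> e < t \<longleftrightarrow> norm (z - x) < norm (z - y)" using reflect_swaps by blast
    have x0: "x0 \<bullet> e < t" unfolding side using xy by (simp add: norm_minus_commute)
    have x: "x \<bullet> e < t" unfolding side using \<open>x \<noteq> y\<close> by simp
    from reflection_trichotomy[OF e, of t] show ?thesis
    proof (elim disjE)
      assume "\<forall>z. f (reflect e t z) = f z"
      then show ?thesis using e x0 sw by metis
    next
      assume "\<forall>x. x \<bullet> e < t \<longrightarrow> f (reflect e t x) < f x"
      then show ?thesis using x sw by blast
    next
      assume "\<forall>x. x \<bullet> e < t \<longrightarrow> f x < f (reflect e t x)"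
      then show ?thesis using x0 max[of "reflect e t x0"] by force
    qed
  qed
  then have mono: "f y \<le> f x" if "norm (x - x0) < norm (y - x0)" for x y using that by fastforce
  have le: "f y \<le> f x" if xy: "norm (x - x0) = norm (y - x0)" for x y
  proof (cases "y = x0")
    case False
    define u where "u n = x0 + (1 + 1 / real (Suc n)) *\<^sub>R (y - x0)" for n
    have "f (u n) \<le> f x" for n
    proof (rule mono)
      have "norm (u n - x0) = (1 + 1 / real (Suc n)) * norm (y - x0)" by (simp add: u_def)
      moreover have "1 * norm (y - x0) < (1 + 1 / real (Suc n)) * norm (y - x0)"
        using False by (intro mult_strict_right_mono) auto
      ultimately show "norm (x - x0) < norm (u n - x0)" using xy by simp
    qed
    moreover have "(\<lambda>n. f (u n)) \<longlonglongrightarrow> f y"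
    proof (rule isCont_tendsto_compose[of y f u])
      show "isCont f y" using continuous_f by (simp add: continuous_on_eq_continuous_at)
      have "(\<lambda>n. x0 + (1 + 1 / real (Suc n)) *\<^sub>R (y - x0)) \<longlonglongrightarrow> x0 + (1 + 0) *\<^sub>R (y - x0)"
        using LIMSEQ_inverse_real_of_nat by (intro tendsto_intros) (simp add: inverse_eq_divide)
      then show "u \<longlonglongrightarrow> y" by (simp add: u_def[abs_def])
    qed
    ultimately show ?thesis by (intro LIMSEQ_le_const2) auto
  qed (use xy in auto)
  have eq: "f x = f y" if "norm (x - x0) = norm (y - x0)" for x y
    using le[of x y] le[of y x] that by simp
  have "f y < f x" if xy: "norm (x - x0) < norm (y - x0)" for x y
  proof (rule ccontr)
    assume "\<not> ?thesis"
    with swap[OF xy] obtain e t where e: "norm e = 1" and x0: "x0 \<bullet> e < t" and sym: "\<And>z. f (reflect e t z) = f z"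
      by blast
    \<comment> \<open>Radial symmetry about \<open>x0\<close> and symmetry in a hyperplane missing \<open>x0\<close> make \<open>f\<close> constant along an
      unbounded sequence of equally spaced points.\<close>
    define s where "s = 2 * (t - x0 \<bullet> e)"
    have s: "0 < s" using x0 by (simp add: s_def)
    define z where "z j = x0 - (real j * s) *\<^sub>R e" for j :: nat
    have ee: "e \<bullet> e = 1" using e by (simp add: dot_square_norm)
    have "reflect e t (z j) = x0 + ((real j + 1) * s) *\<^sub>R e" for j
    proof -
      have "2 * (z j \<bullet> e - t) = - s - 2 * (real j * s)" using ee by (simp add: z_def s_def inner_diff_left)
      then have "reflect e t (z j) = z j - (- s - 2 * (real j * s)) *\<^sub>R e" by (simp add: reflect_def)
      also have "\<dots> = x0 + (- (real j * s) - (- s - 2 * (real j * s))) *\<^sub>R e"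
        unfolding z_def by (simp only: scaleR_left_diff_distrib scaleR_minus_left) simp
      also have "- (real j * s) - (- s - 2 * (real j * s)) = (real j + 1) * s" by (simp add: algebra_simps)
      finally show ?thesis .
    qed
    then have "reflect e t (z j) - x0 = ((real j + 1) * s) *\<^sub>R e" for j by simp
    moreover have "z (Suc j) - x0 = - (((real j + 1) * s) *\<^sub>R e)" for j by (simp add: z_def add.commute)
    ultimately have "norm (reflect e t (z j) - x0) = norm (z (Suc j) - x0)" for j
      by (simp only: norm_minus_cancel)
    from eq[OF this] have step: "f (z (Suc j)) = f (z j)" for j using sym[of "z j"] by simp
    have const: "f (z j) = f x0" for j by (induction j) (use step in \<open>auto simp: z_def\<close>)
    obtain R where R: "\<And>x. R \<le> norm x \<Longrightarrow> f x < f x0" using f_decay[OF f_pos[of x0]] by blast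
    obtain j :: nat where j: "(R + norm x0) / s < real j" using reals_Archimedean2 by blast
    have "R + norm x0 < real j * s" using j s by (simp add: field_simps)
    also have "real j * s = norm ((real j * s) *\<^sub>R e)" using s e by simp
    also have "\<dots> \<le> norm (z j) + norm x0"
      using norm_triangle_ineq4[of x0 "z j"] by (simp add: z_def)
    finally have "f (z j) < f x0" by (intro R) simp
    then show False using const by simp
  qed
  then show ?thesis using eq by (rule that)
qed

lemma radial_profile:
  obtains h :: "real \<Rightarrow> real" and x0 where "\<And>t. 0 \<le> t \<Longrightarrow> 0 \<le> h t" "strict_antimono_on {0..} h"
    "\<And>x. f x = h (norm (x + x0))"
proof -
  obtain x0 where x0: "\<And>x y. norm (x - x0) < norm (y - x0) \<Longrightarrow> f y < f x"
    "\<And>x y. norm (x - x0) = norm (y - x0) \<Longrightarrow> f x = f y" using radially_decreasing by blast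
  obtain e :: 'a where "e \<in> Basis" using nonempty_Basis by blast
  then have e: "norm e = 1" by simp
  define h where "h t = f (x0 + t *\<^sub>R e)" for t
  show ?thesis
  proof (rule that)
    show "0 \<le> h t" for t using f_pos[of "x0 + t *\<^sub>R e"] by (simp add: h_def)
    show "strict_antimono_on {0..} h"
      by (rule monotone_onI) (use e in \<open>auto simp: h_def intro!: x0(1)\<close>)
    show "f x = h (norm (x + - x0))" for x
      unfolding h_def by (rule x0(2)) (use e in simp)
  qed
qed

end

context hls_exponents
begin

lemma pot_cong_AE:
  assumes "weighted lam f" "weighted lam g" "AE x in lborel. f x = g x"
  shows "pot lam f = pot lam g"
proof
  fix x
  show "pot lam f x = pot lam g x"
    unfolding pot_def
  proof (rule integral_cong_AE)
    note [measurable] = assms(1,2)[THEN weighted_measurable]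
    show "(\<lambda>y. f y * norm (x - y) powr lam) \<in> borel_measurable lborel"
      "(\<lambda>y. g y * norm (x - y) powr lam) \<in> borel_measurable lborel" by measurable
    show "AE y in lborel. f y * norm (x - y) powr lam = g y * norm (x - y) powr lam"
      using assms(3) by eventually_elim simp
  qed
qed

text \<open>The right-hand side of the Euler-Lagrange equation is a representative of \<open>f\<close> to which
\<open>continuous_maximizer\<close> applies.\<close>

lemma maximizer_radial:
  assumes f: "unit_density f" and max: "\<And>f'. unit_density f' \<Longrightarrow> energy f' \<le> energy f"
  obtains h :: "real \<Rightarrow> real" and x0 where "\<And>t. 0 \<le> t \<Longrightarrow> 0 \<le> h t" "strict_antimono_on {0..} h"
    "AE x in lborel. f x = h (norm (x + x0))"
proof -
  define g where "g = (\<lambda>x. pot lam f x powr (-b - 1))"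
  obtain k where k: "0 < k" and AE: "AE x in lborel. f x = k * pot lam g x powr (-a - 1)"
    using maximizer_Euler_Lagrange[OF f max] unfolding g_def by blast
  define f0 where "f0 x = k * pot lam g x powr (-a - 1)" for x
  have AE0: "AE x in lborel. f x = f0 x" using AE by (simp add: f0_def)
  note fD = unit_densityD[OF f]
  obtain c where c: "0 < c" "\<And>x. c * weight lam x \<le> pot lam f x"
    using pot_ge_weight[OF lam_pos fD(1,4)] by blast
  have gw: "weighted lam g"
    unfolding g_def by (rule dual_powr(1)[OF measurable_pot[OF lam_pos fD(1)] c])
  have f0_meas: "f0 \<in> borel_measurable borel"
    using measurable_pot[OF lam_pos gw] unfolding f0_def[abs_def] by measurable
  note [measurable] = f0_meas weighted_measurable[OF fD(1)]
  have f0w: "weighted lam f0"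
    unfolding weighted_def
  proof (intro conjI allI f0_meas)
    show "0 \<le> f0 x" for x using k by (simp add: f0_def)
    show "integrable lborel (\<lambda>x. f0 x * weight lam x)"
      by (rule integrable_cong_AE_imp[OF weighted_integrable_weight[OF fD(1)]])
        (measurable, use AE0 in eventually_elim, simp)
  qed
  have pot0: "pot lam f = pot lam f0" by (rule pot_cong_AE[OF fD(1) f0w AE0])
  have u0: "unit_density f0"
    unfolding unit_density_def
  proof (intro conjI f0w)
    show "integrable lborel (\<lambda>x. f0 x powr p)"
      by (rule integrable_cong_AE_imp[OF fD(2)]) (measurable, use AE0 in eventually_elim, simp)
    have "(\<integral>x. f0 x powr p \<partial>lborel) = (\<integral>x. f x powr p \<partial>lborel)"
      by (rule integral_cong_AE) (measurable, use AE0 in eventually_elim, simp)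
    then show "(\<integral>x. f0 x powr p \<partial>lborel) = 1" using fD(3) by simp
  qed
  interpret continuous_maximizer p r lam a b ty f0 k
  proof unfold_locales
    show "energy f' \<le> energy f0" if "unit_density f'" for f'
      using max[OF that] by (simp add: energy_def pot0)
    show "f0 x = k * pot lam (\<lambda>x. pot lam f0 x powr (-b - 1)) x powr (-a - 1)" for x
      by (simp add: f0_def g_def pot0)
  qed (fact u0 k)+
  obtain h x0 where h: "\<And>t. 0 \<le> t \<Longrightarrow> 0 \<le> h t" "strict_antimono_on {0..} h" "\<And>x. f0 x = h (norm (x + x0))"
    using radial_profile by blast
  from h(1,2) show ?thesis
  proof (rule that)
    show "AE x in lborel. f x = h (norm (x + x0))" using AE0 by eventually_elim (simp add: h(3))
  qed
qed

end

section \<open>The extended-valued functionals and the theorem\<close>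

lemma ennpowr_neg_strict_antimono:
  assumes s: "s < 0" and xy: "x < y"
  shows "y ennpowr s < x ennpowr s"
proof (cases x; cases y)
  fix u v assume u: "x = ennreal u" "0 \<le> u" and v: "y = ennreal v" "0 \<le> v"
  then have uv: "u < v" using xy by (simp add: ennreal_less_iff)
  show ?thesis
  proof (cases "u = 0")
    case True
    then show ?thesis using u v uv s by (simp add: ennpowr_def ennreal_less_top)
  next
    case False
    then have "v powr s < u powr s" using u uv s by (intro powr_less_mono2_neg) auto
    then show ?thesis using u v uv s False by (simp add: ennpowr_def ennreal_less_iff)
  qed
next
  fix u assume u: "x = ennreal u" "0 \<le> u" and v: "y = top"
  then show ?thesis using s by (cases "u = 0") (auto simp: ennpowr_def ennreal_eq_0_iff less_le powr_eq_0_iff)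
qed (use xy in auto)

lemma ennpowr_ennreal:
  assumes "0 < u" "s \<noteq> 0"
  shows "ennreal u ennpowr s = ennreal (u powr s)"
  using assms by (simp add: ennpowr_def ennreal_eq_0_iff)

lemma ennpowr_ennreal_pos:
  assumes "0 \<le> u" "0 < s"
  shows "ennreal u ennpowr s = ennreal (u powr s)"
  using assms by (cases "u = 0") (auto simp: ennpowr_ennreal ennpowr_def)

lemma ennpowr_eq_1_iff:
  assumes "0 < s"
  shows "x ennpowr s = 1 \<longleftrightarrow> x = 1"
proof (cases x)
  case (real u)
  have "u = 1" if "u powr s = 1"
    using powr_powr[of u s "1 / s"] that assms real by simp
  then show ?thesis using assms real by (auto simp: ennpowr_ennreal_pos)
qed (use assms in \<open>simp add: ennpowr_def\<close>)

context hls_exponents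
begin

definition energy_ext :: "('a \<Rightarrow> real) \<Rightarrow> ennreal" where
  "energy_ext f = (\<integral>\<^sup>+x. (\<integral>\<^sup>+y. ennreal (f y * norm (x - y) powr lam) \<partial>lborel) ennpowr (-b) \<partial>lborel)"

lemma energy_ext_unit_density:
  assumes f: "unit_density f"
  shows "energy_ext f = ennreal (energy f)"
proof -
  note fD = unit_densityD[OF f]
  have "(\<integral>\<^sup>+y. ennreal (f y * norm (x - y) powr lam) \<partial>lborel) ennpowr (-b) = ennreal (pot lam f x powr (-b))" for x
    unfolding nn_integral_kernel_eq_pot[OF lam_pos fD(1)]
    using pot_pos[OF fD(1,4), of x] ab_pos by (simp add: ennpowr_ennreal)
  then show ?thesis
    unfolding energy_ext_def energy_def
    by (simp add: nn_integral_eq_integral integrable_pot_powr[OF fD(1,4) dim_less(2)])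
qed

text \<open>Positive energy means that the potential is finite on a set of positive measure, in particular at two points.
All remaining competitors have infinite norm of the potential.\<close>

lemma unit_density_if_energy_ext_pos:
  fixes f :: "'a \<Rightarrow> real"
  assumes [measurable]: "f \<in> borel_measurable borel" and f0: "\<And>x. 0 \<le> f x"
    and fp: "(\<integral>\<^sup>+x. ennreal (f x powr p) \<partial>lborel) = 1" and pos: "energy_ext f \<noteq> 0"
  shows "unit_density f"
proof -
  define N where "N x = (\<integral>\<^sup>+y. ennreal (f y * norm (x - y) powr lam) \<partial>lborel)" for x
  have "\<exists>x z. x \<noteq> z \<and> N x < \<infinity> \<and> N z < \<infinity>"
  proof (rule ccontr)
    assume "\<not> ?thesis"
    then obtain x0 where x0: "\<And>x. x \<noteq> x0 \<Longrightarrow> N x = \<infinity>" by (metis infinity_ennreal_def top.not_eq_extremum)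
    have "AE x in lborel. N x ennpowr (-b) = 0"
      using AE_lborel_singleton[of x0] by eventually_elim (use ab_pos in \<open>simp add: x0 ennpowr_def\<close>)
    then have "energy_ext f = (\<integral>\<^sup>+x. 0 \<partial>(lborel :: 'a measure))"
      unfolding energy_ext_def N_def[symmetric] by (rule nn_integral_cong_AE)
    then show False using pos by simp
  qed
  then obtain x z where "x \<noteq> z" "N x < \<infinity>" "N z < \<infinity>" by blast
  then have w: "weighted lam f"
    using weighted_if_finite_at_two_points[OF lam_pos assms(1) f0, of x z] by (simp add: N_def)
  have "integrable lborel (\<lambda>x. f x powr p)" using fp by (intro integrableI_nonneg) auto
  moreover have "(\<integral>x. f x powr p \<partial>lborel) = 1" using fp by (simp add: integral_eq_nn_integral)
  ultimately show ?thesis using w by (simp add: unit_density_def)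
qed

end

lemma nn_integral_I_op_cong:
  fixes f g :: "real ^ 'n \<Rightarrow> real"
  assumes "AE x in lborel. f x = g x"
  shows "I_op lam f x = (\<integral>\<^sup>+y. ennreal (g y * norm (x - y) powr lam) \<partial>lborel)"
  unfolding I_op_def nn_integral_completion
  by (rule nn_integral_cong_AE) (use assms in eventually_elim, simp)

lemma Ls_norm_eq_1_iff:
  assumes p: "0 < p" and f: "\<And>x. 0 \<le> f x" and "AE x in lborel. f x = g x"
  shows "Ls_norm p (\<lambda>x. ennreal (f x)) = 1 \<longleftrightarrow> (\<integral>\<^sup>+x. ennreal (g x powr p) \<partial>lborel) = 1"
proof -
  have "(\<integral>\<^sup>+x. ennreal (f x) ennpowr p \<partial>lebesgue) = (\<integral>\<^sup>+x. ennreal (g x powr p) \<partial>lborel)"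
    unfolding nn_integral_completion
  proof (rule nn_integral_cong_AE)
    show "AE x in lborel. ennreal (f x) ennpowr p = ennreal (g x powr p)"
      using assms(3) by eventually_elim (metis ennpowr_ennreal_pos f p)
  qed
  then show ?thesis using p by (simp add: Ls_norm_def ennpowr_eq_1_iff)
qed

theorem theorem2:
  fixes p r q lam :: real
  assumes "0 < p" "p < 1" "0 < r" "r < 1" "0 < lam"
    and "1 / p + 1 / r - lam / real CARD('n::finite) = 2"
    and "q = r / (r - 1)"
  shows "(\<exists>f :: real ^ 'n \<Rightarrow> real.
            f \<in> admissible p \<and> Ls_norm q (I_op lam f) = inf_const TYPE('n) lam p q) \<and>
         (\<forall>f :: real ^ 'n \<Rightarrow> real.
            f \<in> admissible p \<and> Ls_norm q (I_op lam f) = inf_const TYPE('n) lam p q \<longrightarrow>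
            (\<exists>(h :: real \<Rightarrow> real) (x\<^sub>0 :: real ^ 'n).
               (\<forall>t\<ge>0. 0 \<le> h t) \<and> strict_antimono_on {0..} h \<and>
               (AE x in lebesgue. f x = h (norm (x + x\<^sub>0)))))"
proof -
  define a b where "a = p / (1 - p)" and "b = r / (1 - r)"
  have "q = - b" using assms by (simp add: b_def field_simps)
  moreover have "0 < b" using assms by (simp add: b_def)
  ultimately have q: "q = - b" "q < 0" by auto
  interpret hls_exponents p r lam a b "TYPE(real ^ 'n)"
  proof unfold_locales
    have "1 / a = 1 / p - 1" "1 / b = 1 / r - 1" using assms(1-4) by (auto simp: a_def b_def field_simps)
    then have "lam / real CARD('n) = 1 / a + 1 / b" using assms(6) by linarith
    then have "lam = real CARD('n) * (1 / a + 1 / b)" by (simp add: field_simps)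
    then show "lam = real DIM(real ^ 'n) / a + real DIM(real ^ 'n) / b" by (simp add: algebra_simps)
  qed (use assms in \<open>auto simp: a_def b_def\<close>)
  have norm_eq: "Ls_norm q (I_op lam f) = energy_ext g ennpowr (1 / q)"
    if "AE x in lborel. f x = g x" for f g :: "real ^ 'n \<Rightarrow> real"
    unfolding Ls_norm_def energy_ext_def nn_integral_I_op_cong[OF that] nn_integral_completion q(1) ..
  have rep: "\<exists>g. g \<in> borel_measurable borel \<and> (\<forall>x. 0 \<le> g x) \<and> (AE x in lborel. f x = g x)
      \<and> (\<integral>\<^sup>+x. ennreal (g x powr p) \<partial>lborel) = 1"
    if f: "f \<in> admissible p" for f :: "real ^ 'n \<Rightarrow> real"
  proof -
    have fm: "f \<in> borel_measurable lebesgue" and f0: "\<And>x. 0 \<le> f x" and f1: "Ls_norm p (\<lambda>x. ennreal (f x)) = 1"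
      using f by (auto simp: admissible_def)
    obtain g where g: "g \<in> borel_measurable lborel" "AE x in lborel. f x = g x"
      using completion_ex_borel_measurable_real[OF fm] by blast
    have AE: "AE x in lborel. f x = max 0 (g x)" using g(2) by eventually_elim (metis f0 max_absorb2)
    show ?thesis
      using g(1) AE Ls_norm_eq_1_iff[OF assms(1) f0 AE] f1 by (intro exI[of _ "\<lambda>x. max 0 (g x)"]) auto
  qed
  obtain f where f: "unit_density f" and max: "\<And>f'. unit_density f' \<Longrightarrow> energy f' \<le> energy f"
    using energy_maximum_attained by blast
  note fD = unit_densityD[OF f]
  have f_adm: "f \<in> admissible p"
  proof -
    have "(\<integral>\<^sup>+x. ennreal (f x powr p) \<partial>lborel) = 1"
      using fD by (simp add: nn_integral_eq_integral)
    then have "Ls_norm p (\<lambda>x. ennreal (f x)) = 1"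
      using Ls_norm_eq_1_iff[of p f f] by (simp add: assms(1) weighted_nonneg[OF fD(1)])
    moreover have "f \<in> borel_measurable lebesgue"
      using weighted_measurable[OF fD(1)] by (simp add: measurable_completion)
    ultimately show ?thesis using weighted_nonneg[OF fD(1)] by (simp add: admissible_def)
  qed
  have norm_f: "Ls_norm q (I_op lam f) = ennreal (energy f) ennpowr (1 / q)"
    using norm_eq[of f f] energy_ext_unit_density[OF f] by simp
  have bound: "energy_ext g \<le> ennreal (energy f)"
    if "g \<in> borel_measurable borel" "\<forall>x. 0 \<le> g x" "(\<integral>\<^sup>+x. ennreal (g x powr p) \<partial>lborel) = 1" for g
  proof (cases "energy_ext g = 0")
    case False
    then have "unit_density g" using that by (intro unit_density_if_energy_ext_pos) auto
    then show ?thesis using max by (simp add: energy_ext_unit_density ennreal_leI)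
  qed simp
  have q': "1 / q < 0" using q by simp
  have inf: "inf_const TYPE('n) lam p q = ennreal (energy f) ennpowr (1 / q)"
    unfolding inf_const_def norm_f[symmetric]
  proof (rule antisym)
    show "(INF f \<in> (admissible p :: (real ^ 'n \<Rightarrow> real) set). Ls_norm q (I_op lam f)) \<le> Ls_norm q (I_op lam f)"
      by (rule INF_lower[OF f_adm])
    show "Ls_norm q (I_op lam f) \<le> (INF f \<in> (admissible p :: (real ^ 'n \<Rightarrow> real) set). Ls_norm q (I_op lam f))"
    proof (rule INF_greatest)
      fix f' :: "real ^ 'n \<Rightarrow> real" assume "f' \<in> admissible p"
      then obtain g where g: "g \<in> borel_measurable borel" "\<forall>x. 0 \<le> g x" "AE x in lborel. f' x = g x"
        "(\<integral>\<^sup>+x. ennreal (g x powr p) \<partial>lborel) = 1" using rep by blast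
      show "Ls_norm q (I_op lam f) \<le> Ls_norm q (I_op lam f')"
        unfolding norm_f norm_eq[OF g(3)]
        using bound[OF g(1,2,4)] ennpowr_neg_strict_antimono[OF q', of "energy_ext g" "ennreal (energy f)"]
        by (cases "energy_ext g = ennreal (energy f)") (auto simp: less_le)
    qed
  qed
  show ?thesis
  proof (intro conjI allI impI)
    show "\<exists>f :: real ^ 'n \<Rightarrow> real. f \<in> admissible p \<and> Ls_norm q (I_op lam f) = inf_const TYPE('n) lam p q"
      using f_adm norm_f inf by auto
  next
    fix f' :: "real ^ 'n \<Rightarrow> real"
    assume f': "f' \<in> admissible p \<and> Ls_norm q (I_op lam f') = inf_const TYPE('n) lam p q"
    then obtain g where g: "g \<in> borel_measurable borel" "\<forall>x. 0 \<le> g x" "AE x in lborel. f' x = g x"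
      "(\<integral>\<^sup>+x. ennreal (g x powr p) \<partial>lborel) = 1" using rep by blast
    have "energy_ext g ennpowr (1 / q) = ennreal (energy f) ennpowr (1 / q)"
      using f' norm_eq[OF g(3)] inf by simp
    then have eq: "energy_ext g = ennreal (energy f)"
      using bound[OF g(1,2,4)] ennpowr_neg_strict_antimono[OF q', of "energy_ext g" "ennreal (energy f)"]
      by (auto simp: less_le)
    then have "energy_ext g \<noteq> 0" using energy_pos[OF f] by simp
    then have ug: "unit_density g" using g by (intro unit_density_if_energy_ext_pos) auto
    then have "energy g = energy f"
      using eq energy_pos[OF f] energy_pos[OF ug] by (simp add: energy_ext_unit_density)
    then have "energy f' \<le> energy g" if "unit_density f'" for f' using max[OF that] by simp
    from maximizer_radial[OF ug this] obtain h :: "real \<Rightarrow> real" and x0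
      where h: "\<And>t. 0 \<le> t \<Longrightarrow> 0 \<le> h t" "strict_antimono_on {0..} h" "AE x in lborel. g x = h (norm (x + x0))"
      by blast
    have "AE x in lborel. f' x = h (norm (x + x0))" using g(3) h(3) by eventually_elim simp
    then show "\<exists>(h :: real \<Rightarrow> real) (x\<^sub>0 :: real ^ 'n).
               (\<forall>t\<ge>0. 0 \<le> h t) \<and> strict_antimono_on {0..} h \<and>
               (AE x in lebesgue. f' x = h (norm (x + x\<^sub>0)))"
      using h(1,2) AE_completion by blast
  qed
qed

end
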